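(* Let $n\ge1$, let $U(R)$ be the algebra defined in the context, and let $z^\pm(u)$ be the series with coefficients in $U(R)$ determined by $$L^{\pm}(u)DL^{\pm}(u\xi)^{\mathrm t}D^{-1}=z^{\pm}(u)\,1 .$$ Then all coefficients of the series $z^{+}(u)$ and $z^{-}(u)$ belong to the center of the algebra $U(R)$.
   Context: $q$ is a variable and algebras are over $\mathbb C(q)$. For $1\le i\le 2n$ put $i'=2n+1-i$; $\varepsilon_i=1$ for $i\le n$ and $-1$ for $i>n$; $(\bar1,\dots,\overline{2n})=(n,\dots,1,-1,\dots,-n)$; $e_{ij}\in\mathrm{End}\,\mathbb C^{2n}$ are matrix units; $\xi=q^{-2n-2}$. Set $P=\sum_{i,j}e_{ij}\otimes e_{ji}$, $Q=\sum_{i,j}q^{\bar i-\bar j}\varepsilon_i\varepsilon_je_{i'j'}\otimes e_{ij}$, $$R=q\sum_ie_{ii}\otimes e_{ii}+\sum_{i\ne j,j'}e_{ii}\otimes e_{jj}+q^{-1}\sum_{i}e_{ii}\otimes e_{i'i'}+(q-q^{-1})\sum_{i<j}e_{ij}\otimes e_{ji}-(q-q^{-1})\sum_{i>j}q^{\bar i-\bar j}\varepsilon_i\varepsilon_je_{i'j'}\otimes e_{ij}.$$ Let $f(u)=1+\sum_{k\ge1}f_ku^k$, $f_k\in\mathbb C(q)$, be the unique series with $f(u)f(u\xi)=\big((1-uq^{-2})(1-uq^2)(1-u\xi)(1-u\xi^{-1})\big)^{-1}$, and $$R(u)=f(u)\big(q^{-1}(u-1)(u-\xi)R-(q^{-2}-1)(u-\xi)P+(q^{-2}-1)(u-1)\xi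 Q\big).$$ The algebra $U(R)$ is generated by an invertible central element $q^{c/2}$ and elements $l^\pm_{ij}[\mp m]$ ($1\le i,j\le 2n$, $m\ge0$). Put $l^\pm_{ij}(u)=\sum_{m\ge0}l^\pm_{ij}[\mp m]u^{\pm m}$, $L^\pm(u)=\sum e_{ij}\otimes l^\pm_{ij}(u)$, $L_1^\pm(u)=\sum e_{ij}\otimes1\otimes l^\pm_{ij}(u)$, $L_2^\pm(u)=\sum1\otimes e_{ij}\otimes l^\pm_{ij}(u)$. Relations: $l^+_{ij}[0]=l^-_{ji}[0]=0$ for $i<j$; $l^+_{nn}[0]l^+_{n+1,n+1}[0]=1$; $l^+_{ii}[0]l^-_{ii}[0]=l^-_{ii}[0]l^+_{ii}[0]=1$; $$R(u/v)L^\pm_1(u)L^\pm_2(v)=L_2^\pm(v)L_1^\pm(u)R(u/v),\qquad R(uq^c/v)L^+_1(u)L^-_2(v)=L^-_2(v)L^+_1(u)R(uq^{-c}/v).$$ $\mathrm t$ is the matrix transposition $e_{ij}^{\mathrm t}=\varepsilon_i\varepsilon_je_{j'i'}$, and $D=\mathrm{diag}[q^n,\dots,q,q^{-1},\dots,q^{-n}]$. It is known that in $U(R)$ the matrices $L^{\pm}(u)DL^{\pm}(u\xi)^{\mathrm t}D^{-1}$ and $DL^{\pm}(u\xi)^{\mathrm t}D^{-1}L^{\pm}(u)$ are equal and scalar, i.e. of the form $z^\pm(u)\,1$ with $1$ the identity matrix, so $z^\pm(u)$ is well defined. *)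

theory Defs
  imports
    "HOL-Analysis.Analysis"
    "HOL-Computational_Algebra.Computational_Algebra"
    "HOL-Library.Poly_Mapping"
begin

section \<open>The ground field and the scalar series\<close>

type_synonym Cq = "complex poly fract"

definition qq :: Cq where
  "qq = Fract [:0, 1:] 1"

definition xi :: "nat \<Rightarrow> Cq" where
  "xi n = qq powi (- 2 * int n - 2)"

definition f_rhs :: "nat \<Rightarrow> Cq fps" where
  "f_rhs n = inverse ((1 - fps_X * fps_const (qq powi (- 2))) * (1 - fps_X * fps_const (qq\<^sup>2)) *
     (1 - fps_X * fps_const (xi n)) * (1 - fps_X * fps_const (inverse (xi n))))"

definition f_series :: "nat \<Rightarrow> Cq fps" where
  "f_series n = (THE F. fps_nth F 0 = 1 \<and>
     F * fps_compose F (fps_const (xi n) * fps_X) = f_rhs n)"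

lemma qq_nonzero: "qq \<noteq> 0"
  by (simp add: qq_def Zero_fract_def eq_fract)

lemma qq_power: "qq ^ k = Fract (monom 1 k) 1"
proof (induction k)
  case 0
  then show ?case by (simp add: One_fract_def)
next
  case (Suc k)
  then show ?case by (simp add: qq_def monom_Suc mult.commute)
qed

lemma one_plus_qq_power: "1 + qq ^ k \<noteq> 0"
proof
  assume "1 + qq ^ k = 0"
  then have "Fract (1 + monom 1 k :: complex poly) 1 = Fract 0 1"
    by (simp add: qq_power One_fract_def Zero_fract_def)
  then have "(1 + monom 1 k :: complex poly) = 0"
    by (simp add: eq_fract)
  then have "coeff (1 + monom 1 k :: complex poly) k = 0" by simp
  then show False by (cases "k = 0") (simp_all del: one_add_one add: coeff_monom monom_0)
qed

lemma one_plus_xi_power: "1 + xi n ^ k \<noteq> 0"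
proof -
  define N where "N = (2 * n + 2) * k"
  have "- 2 * int n - 2 = - int (2 * n + 2)" by simp
  then have "xi n = inverse (qq ^ (2 * n + 2))"
    unfolding xi_def by (metis power_int_minus power_int_of_nat)
  then have x: "xi n ^ k = inverse (qq ^ N)"
    unfolding N_def by (simp only: power_inverse power_mult)
  have "qq ^ N * (1 + xi n ^ k) = 1 + qq ^ N"
    using qq_nonzero by (simp add: x algebra_simps)
  then show ?thesis using one_plus_qq_power[of N] by auto
qed

lemma scaled_series_coeff:
  fixes F :: "'a::field fps"
  assumes "fps_nth F 0 = 1"
  shows "fps_nth (F * fps_compose F (fps_const c * fps_X)) (Suc k) =
    fps_nth F (Suc k) * (1 + c ^ Suc k) +
    (\<Sum>i=1..k. fps_nth F i * (c ^ (Suc k - i) * fps_nth F (Suc k - i)))"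
proof -
  have "{0..Suc k} = insert 0 (insert (Suc k) {1..k})" by auto
  then show ?thesis
    using assms unfolding fps_mult_nth fps_nth_compose_linear by (simp add: algebra_simps)
qed

lemma scaled_series_unique_existence:
  fixes g :: "'a::field fps"
  assumes c: "\<And>k. 1 + c ^ k \<noteq> 0" and g0: "fps_nth g 0 = 1"
  shows "\<exists>!F. fps_nth F 0 = 1 \<and> F * fps_compose F (fps_const c * fps_X) = g"
proof -
  define step where "step = (\<lambda>(a :: nat \<Rightarrow> 'a) n. if n = 0 then 1 else
    (fps_nth g n - (\<Sum>i=1..n-1. a i * (c ^ (n - i) * a (n - i)))) / (1 + c ^ n))"
  define a where "a = wfrec less_than step"
  have adm: "step h n = step h' n" if "\<And>m. m < n \<Longrightarrow> h m = h' m" for h h' n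
    unfolding step_def using that by (auto intro!: sum.cong arg_cong2[where f = "(/)"])
  have a: "a n = step a n" for n
  proof -
    have "a n = step (cut a less_than n) n"
      unfolding a_def by (rule wfrec) simp
    also have "\<dots> = step a n"
      by (rule adm) (simp add: cut_apply)
    finally show ?thesis .
  qed
  define F where "F = Abs_fps a"
  have F0: "fps_nth F 0 = 1" by (simp add: F_def a[of 0] step_def)
  have "fps_nth (F * fps_compose F (fps_const c * fps_X)) n = fps_nth g n" for n
  proof (cases n)
    case 0
    then show ?thesis using F0 g0 by (simp add: fps_compose_linear)
  next
    case (Suc k)
    have "a (Suc k) * (1 + c ^ Suc k) =
        fps_nth g (Suc k) - (\<Sum>i=1..k. a i * (c ^ (Suc k - i) * a (Suc k - i)))"
      using c[of "Suc k"] by (subst a) (simp add: step_def del: power_Suc)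
    then show ?thesis
      unfolding Suc scaled_series_coeff[OF F0] by (simp add: F_def del: power_Suc)
  qed
  then have ex: "fps_nth F 0 = 1 \<and> F * fps_compose F (fps_const c * fps_X) = g"
    using F0 by (simp add: fps_eq_iff)
  moreover have "G = H"
    if G: "fps_nth G 0 = 1 \<and> G * fps_compose G (fps_const c * fps_X) = g"
    and H: "fps_nth H 0 = 1 \<and> H * fps_compose H (fps_const c * fps_X) = g" for G H
  proof (rule fps_ext)
    fix n
    show "fps_nth G n = fps_nth H n"
    proof (induction n rule: less_induct)
      case (less n)
      show ?case
      proof (cases n)
        case 0
        then show ?thesis using G H by simp
      next
        case (Suc k)
        have "(\<Sum>i=1..k. fps_nth G i * (c ^ (Suc k - i) * fps_nth G (Suc k - i))) =
            (\<Sum>i=1..k. fps_nth H i * (c ^ (Suc k - i) * fps_nth H (Suc k - i)))"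
          using less Suc by (intro sum.cong) auto
        moreover note scaled_series_coeff[of G c k] scaled_series_coeff[of H c k]
        ultimately have "fps_nth G (Suc k) * (1 + c ^ Suc k) = fps_nth H (Suc k) * (1 + c ^ Suc k)"
          using G H by (simp del: power_Suc)
        then show ?thesis using c[of "Suc k"] Suc by (simp del: power_Suc)
      qed
    qed
  qed
  ultimately show ?thesis by blast
qed

lemma f_series_unique_existence:
  "\<exists>!F. fps_nth F 0 = 1 \<and> F * fps_compose F (fps_const (xi n) * fps_X) = f_rhs n"
  by (rule scaled_series_unique_existence[OF one_plus_xi_power]) (simp add: f_rhs_def)

lemma f_series:
  "fps_nth (f_series n) 0 = 1"
  "f_series n * fps_compose (f_series n) (fps_const (xi n) * fps_X) = f_rhs n"
  using theI'[OF f_series_unique_existence[of n]] unfolding f_series_def by auto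


section \<open>The R-matrix\<close>

text \<open>Throughout, n is the cardinality of the type parameter. The set of indices
  \<open>{1, \<dots>, 2n}\<close> is turned into a type, so that the matrix library applies and no generators with
  indices out of range exist.\<close>

typedef ('n::finite) idx = "{1..2 * CARD('n)}"
  morphisms pos Idx
  by (auto intro!: exI[of _ 1] simp: Suc_le_eq)

instance idx :: (finite) finite
proof
  have "(UNIV :: 'a idx set) = Idx ` {1..2 * CARD('a)}"
    using type_definition.univ[OF type_definition_idx] .
  then show "finite (UNIV :: 'a idx set)" by (metis finite_atLeastAtMost finite_imageI)
qed

definition opp :: "'n::finite idx \<Rightarrow> 'n idx" where  \<comment> \<open>\<open>i'\<close>\<close>
  "opp i = Idx (2 * CARD('n) + 1 - pos i)"

definition eps :: "'n::finite idx \<Rightarrow> int" where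
  "eps i = (if pos i \<le> CARD('n) then 1 else - 1)"

definition bar :: "'n::finite idx \<Rightarrow> int" where
  "bar i = (if pos i \<le> CARD('n) then int CARD('n) + 1 - int (pos i)
            else int CARD('n) - int (pos i))"

text \<open>Elements of \<open>End V \<otimes> End V\<close> are matrices indexed by pairs: \<open>e\<^sub>i\<^sub>j \<otimes> e\<^sub>k\<^sub>l\<close> has its entry 1
  in row \<open>(i, k)\<close> and column \<open>(j, l)\<close>, and the product is the matrix product.\<close>

definition tensor_unit ::
  "'n::finite idx \<Rightarrow> 'n idx \<Rightarrow> 'n idx \<Rightarrow> 'n idx \<Rightarrow> 'a::zero \<Rightarrow> 'a ^ ('n idx \<times> 'n idx) ^ ('n idx \<times> 'n idx)"
  where  \<comment> \<open>\<open>x e\<^sub>i\<^sub>j \<otimes> e\<^sub>k\<^sub>l\<close>\<close>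
  "tensor_unit i j k l x = (\<chi> r c. if r = (i, k) \<and> c = (j, l) then x else 0)"

definition P_mat :: "Cq ^ ('n::finite idx \<times> 'n idx) ^ ('n idx \<times> 'n idx)" where
  "P_mat = (\<Sum>i\<in>UNIV. \<Sum>j\<in>UNIV. tensor_unit i j j i 1)"

definition Q_mat :: "Cq ^ ('n::finite idx \<times> 'n idx) ^ ('n idx \<times> 'n idx)" where
  "Q_mat = (\<Sum>i\<in>UNIV. \<Sum>j\<in>UNIV.
     tensor_unit (opp i) (opp j) i j (qq powi (bar i - bar j) * of_int (eps i * eps j)))"

definition R_mat :: "Cq ^ ('n::finite idx \<times> 'n idx) ^ ('n idx \<times> 'n idx)" where
  "R_mat =
     (\<Sum>i\<in>UNIV. tensor_unit i i i i qq)
     + (\<Sum>i\<in>UNIV. \<Sum>j\<in>{j. i \<noteq> j \<and> i \<noteq> opp j}. tensor_unit i i j j 1)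
     + (\<Sum>i\<in>UNIV. tensor_unit i i (opp i) (opp i) (inverse qq))
     + (\<Sum>i\<in>UNIV. \<Sum>j\<in>{j. pos i < pos j}. tensor_unit i j j i (qq - inverse qq))
     - (\<Sum>i\<in>UNIV. \<Sum>j\<in>{j. pos i > pos j}. tensor_unit (opp i) (opp j) i j
          ((qq - inverse qq) * qq powi (bar i - bar j) * of_int (eps i * eps j)))"

definition R_series :: "Cq fps ^ ('n::finite idx \<times> 'n idx) ^ ('n idx \<times> 'n idx)" where
  "R_series = (\<chi> r c. f_series CARD('n) *
     (fps_const (inverse qq) * (fps_X - 1) * (fps_X - fps_const (xi CARD('n))) * fps_const (R_mat $ r $ c)
      - fps_const (qq powi (- 2) - 1) * (fps_X - fps_const (xi CARD('n))) * fps_const (P_mat $ r $ c)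
      + fps_const (qq powi (- 2) - 1) * (fps_X - 1) * fps_const (xi CARD('n)) * fps_const (Q_mat $ r $ c)))"


section \<open>The free algebra on the generators\<close>

datatype pm = Plus | Minus

text \<open>\<open>LGen Plus i j m\<close> and \<open>LGen Minus i j m\<close> stand for \<open>l\<^sup>+\<^sub>i\<^sub>j[-m]\<close> and \<open>l\<^sup>-\<^sub>i\<^sub>j[m]\<close>.\<close>

datatype ('n::finite) gen = QHalf | QHalfInv | LGen pm "'n idx" "'n idx" nat

datatype 'g mon = Mon "'g list"

instantiation mon :: (type) monoid_add
begin

definition zero_mon :: "'a mon" where "zero_mon = Mon []"

fun plus_mon :: "'a mon \<Rightarrow> 'a mon \<Rightarrow> 'a mon" where
  "plus_mon (Mon u) (Mon v) = Mon (u @ v)"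

instance
proof
  fix a b c :: "'a mon"
  show "a + b + c = a + (b + c)" by (cases a; cases b; cases c) simp
  show "0 + a = a" "a + 0 = a" by (cases a; simp add: zero_mon_def)+
qed

end

text \<open>The free algebra is the monoid algebra of the free monoid of words.\<close>

type_synonym 'g free_alg = "'g mon \<Rightarrow>\<^sub>0 Cq"

definition fscal :: "Cq \<Rightarrow> 'g free_alg" where
  "fscal c = Poly_Mapping.single 0 c"

definition fgen :: "'g \<Rightarrow> 'g free_alg" where
  "fgen g = Poly_Mapping.single (Mon [g]) 1"


section \<open>The defining relations\<close>

text \<open>The coefficient of \<open>u\<^sup>p\<close> (\<open>p\<close> any integer) in \<open>l\<^sup>\<plusminus>\<^sub>i\<^sub>j(u)\<close>, and those of the matrices
  \<open>L\<^sup>\<plusminus>\<^sub>1(u)\<close>, \<open>L\<^sup>\<plusminus>\<^sub>2(u)\<close>.\<close>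

fun l_coeff :: "pm \<Rightarrow> 'n::finite idx \<Rightarrow> 'n idx \<Rightarrow> int \<Rightarrow> 'n gen free_alg" where
  "l_coeff Plus i j p = (if p \<ge> 0 then fgen (LGen Plus i j (nat p)) else 0)"
| "l_coeff Minus i j p = (if p \<le> 0 then fgen (LGen Minus i j (nat (- p))) else 0)"

definition L1_coeff :: "pm \<Rightarrow> int \<Rightarrow> 'n::finite gen free_alg ^ ('n idx \<times> 'n idx) ^ ('n idx \<times> 'n idx)" where
  "L1_coeff s p = (\<chi> r c. if snd r = snd c then l_coeff s (fst r) (fst c) p else 0)"

definition L2_coeff :: "pm \<Rightarrow> int \<Rightarrow> 'n::finite gen free_alg ^ ('n idx \<times> 'n idx) ^ ('n idx \<times> 'n idx)" where
  "L2_coeff s p = (\<chi> r c. if fst r = fst c then l_coeff s (snd r) (snd c) p else 0)"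

text \<open>The coefficient of \<open>u\<^sup>k\<close> in \<open>R(ux)\<close>, where \<open>x\<close> is \<open>1\<close> or (in the mixed relation) a power
  of \<open>q\<^sup>c\<close>.\<close>

definition R_coeff :: "'n::finite gen free_alg \<Rightarrow> nat \<Rightarrow> 'n gen free_alg ^ ('n idx \<times> 'n idx) ^ ('n idx \<times> 'n idx)" where
  "R_coeff x k = (\<chi> r c. fscal (fps_nth (R_series $ r $ c) k) * x ^ k)"

text \<open>The coefficients of \<open>u\<^sup>a v\<^sup>b\<close> in \<open>R(ux/v) L\<^sup>s\<^sub>1(u) L\<^sup>t\<^sub>2(v)\<close> and in
  \<open>L\<^sup>t\<^sub>2(v) L\<^sup>s\<^sub>1(u) R(ux/v)\<close>, with \<open>R(ux/v)\<close> expanded in powers of \<open>u/v\<close>. The sums over all \<open>k\<close>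
  have only finitely many nonzero terms except for \<open>(s, t) = (Minus, Plus)\<close>, which
  does not occur in the relations.\<close>

definition RLL_coeff ::
  "'n::finite gen free_alg \<Rightarrow> pm \<Rightarrow> pm \<Rightarrow> int \<Rightarrow> int \<Rightarrow> 'n gen free_alg ^ ('n idx \<times> 'n idx) ^ ('n idx \<times> 'n idx)" where
  "RLL_coeff x s t a b =
     Sum_any (\<lambda>k. R_coeff x k ** L1_coeff s (a - int k) ** L2_coeff t (b + int k))"

definition LLR_coeff ::
  "'n::finite gen free_alg \<Rightarrow> pm \<Rightarrow> pm \<Rightarrow> int \<Rightarrow> int \<Rightarrow> 'n gen free_alg ^ ('n idx \<times> 'n idx) ^ ('n idx \<times> 'n idx)" where
  "LLR_coeff x s t a b =
     Sum_any (\<lambda>k. L2_coeff t (b + int k) ** L1_coeff s (a - int k) ** R_coeff x k)"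

inductive relation :: "'n::finite gen free_alg \<Rightarrow> 'n gen free_alg \<Rightarrow> bool" where
  "relation (fgen QHalf * fgen QHalfInv) 1"
| "relation (fgen QHalfInv * fgen QHalf) 1"
| "relation (fgen QHalf * fgen g) (fgen g * fgen QHalf)"
| "pos i < pos j \<Longrightarrow> relation (fgen (LGen Plus i j 0)) 0"
| "pos i < pos j \<Longrightarrow> relation (fgen (LGen Minus j i 0)) 0"
| "pos i = CARD('n) \<Longrightarrow> pos j = CARD('n) + 1 \<Longrightarrow>
     relation (fgen (LGen Plus i i 0) * fgen (LGen Plus j j 0)) (1 :: 'n gen free_alg)"
| "relation (fgen (LGen Plus i i 0) * fgen (LGen Minus i i 0)) 1"
| "relation (fgen (LGen Minus i i 0) * fgen (LGen Plus i i 0)) 1"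
| "relation (RLL_coeff 1 s s a b $ r $ c) (LLR_coeff 1 s s a b $ r $ c)"
| "relation (RLL_coeff ((fgen QHalf)\<^sup>2) Plus Minus a b $ r $ c)
            (LLR_coeff ((fgen QHalfInv)\<^sup>2) Plus Minus a b $ r $ c)"

inductive_set two_sided_ideal :: "'a::ring_1 set \<Rightarrow> 'a set" for S where
  zero: "0 \<in> two_sided_ideal S"
| gen: "x \<in> S \<Longrightarrow> a * x * b \<in> two_sided_ideal S"
| add: "x \<in> two_sided_ideal S \<Longrightarrow> y \<in> two_sided_ideal S \<Longrightarrow> x + y \<in> two_sided_ideal S"

definition relation_ideal :: "'n::finite gen free_alg set" where
  "relation_ideal = two_sided_ideal {x - y | x y. relation x y}"

lemma two_sided_ideal_mult:
  "x \<in> two_sided_ideal S \<Longrightarrow> a * x * b \<in> two_sided_ideal S"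
proof (induction rule: two_sided_ideal.induct)
  case zero
  then show ?case by (simp add: two_sided_ideal.zero)
next
  case (gen x c d)
  have "a * (c * x * d) * b = (a * c) * x * (d * b)" by (simp add: mult.assoc)
  with gen show ?case by (metis two_sided_ideal.gen)
next
  case (add x y)
  then show ?case by (simp add: distrib_left distrib_right two_sided_ideal.add)
qed

lemma relation_ideal_closed:
  "0 \<in> relation_ideal"
  "x \<in> relation_ideal \<Longrightarrow> y \<in> relation_ideal \<Longrightarrow> x + y \<in> relation_ideal"
  "x \<in> relation_ideal \<Longrightarrow> a * x \<in> relation_ideal"
  "x \<in> relation_ideal \<Longrightarrow> x * a \<in> relation_ideal"
  "x \<in> relation_ideal \<Longrightarrow> - x \<in> relation_ideal"
  using two_sided_ideal_mult[of x _ a 1] two_sided_ideal_mult[of x _ 1 a]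
    two_sided_ideal_mult[of x _ "- 1" 1]
  by (auto simp: relation_ideal_def intro: two_sided_ideal.zero two_sided_ideal.add)


section \<open>The relations are consistent\<close>

text \<open>The algebra is nonzero (as the class \<^class>\<open>ring_1\<close> requires): all relations hold under
  the character \<open>q\<^sup>c\<^sup>/\<^sup>2 \<mapsto> 1\<close>, \<open>L\<^sup>\<plusminus>(u) \<mapsto> 1\<close>.\<close>

fun gen_char :: "'n::finite gen \<Rightarrow> Cq" where
  "gen_char (LGen s i j m) = (if i = j \<and> m = 0 then 1 else 0)"
| "gen_char _ = 1"

fun mon_char :: "'n::finite gen mon \<Rightarrow> Cq" where
  "mon_char (Mon w) = prod_list (map gen_char w)"

definition alg_char :: "'n::finite gen free_alg \<Rightarrow> Cq" where
  "alg_char p = (\<Sum>w\<in>Poly_Mapping.keys p. Poly_Mapping.lookup p w * mon_char w)"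

lemma mon_char_plus: "mon_char (u + v) = mon_char u * mon_char v"
  by (cases u; cases v) simp

lemma alg_char_superset:
  "finite A \<Longrightarrow> Poly_Mapping.keys p \<subseteq> A \<Longrightarrow>
    alg_char p = (\<Sum>w\<in>A. Poly_Mapping.lookup p w * mon_char w)"
  unfolding alg_char_def by (rule sum.mono_neutral_left) (auto simp: in_keys_iff)

lemma alg_char_add: "alg_char (p + q) = alg_char p + alg_char q"
  using alg_char_superset[of "Poly_Mapping.keys p \<union> Poly_Mapping.keys q" p]
    alg_char_superset[of "Poly_Mapping.keys p \<union> Poly_Mapping.keys q" q]
    alg_char_superset[of "Poly_Mapping.keys p \<union> Poly_Mapping.keys q" "p + q"]
    Poly_Mapping.keys_add[of p q]
  by (simp add: lookup_add distrib_right sum.distrib)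

lemma alg_char_zero [simp]: "alg_char 0 = 0"
  by (simp add: alg_char_def)

lemma alg_char_sum: "alg_char (sum h A) = (\<Sum>x\<in>A. alg_char (h x))"
  by (induction A rule: infinite_finite_induct) (simp_all add: alg_char_add)

lemma alg_char_single: "alg_char (Poly_Mapping.single w c) = c * mon_char w"
  by (cases "c = 0") (simp_all add: alg_char_def)

lemma sum_of_singles:
  "p = (\<Sum>w\<in>Poly_Mapping.keys p. Poly_Mapping.single w (Poly_Mapping.lookup p w))"
  by (rule poly_mapping_eqI)
    (auto simp: lookup_sum lookup_single when_def sum.delta in_keys_iff if_distrib cong: if_cong)

lemma alg_char_mult: "alg_char (p * q) = alg_char p * alg_char q"
proof -
  have "alg_char (p * q) = alg_char
      ((\<Sum>w\<in>Poly_Mapping.keys p. Poly_Mapping.single w (Poly_Mapping.lookup p w)) *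
       (\<Sum>w\<in>Poly_Mapping.keys q. Poly_Mapping.single w (Poly_Mapping.lookup q w)))"
    using sum_of_singles[of p] sum_of_singles[of q] by metis
  also have "\<dots> = (\<Sum>v\<in>Poly_Mapping.keys p. \<Sum>w\<in>Poly_Mapping.keys q.
      (Poly_Mapping.lookup p v * Poly_Mapping.lookup q w) * mon_char (v + w))"
    by (simp add: sum_product alg_char_sum mult_single alg_char_single)
  also have "\<dots> = alg_char p * alg_char q"
    unfolding alg_char_def sum_product mon_char_plus by (simp add: mult_ac)
  finally show ?thesis .
qed

lemma alg_char_scal [simp]: "alg_char (fscal c) = c"
  by (simp add: fscal_def alg_char_single zero_mon_def)

lemma alg_char_one [simp]: "alg_char 1 = 1"
  using alg_char_scal[of 1] by (simp add: fscal_def)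

lemma alg_char_diff: "alg_char (p - q) = alg_char p - alg_char q"
  using alg_char_add[of "p - q" q] by simp

lemma alg_char_gen [simp]: "alg_char (fgen g) = gen_char g"
  by (simp add: fgen_def alg_char_single)

lemma alg_char_power: "alg_char (x ^ k) = alg_char x ^ k"
  by (induction k) (simp_all add: alg_char_mult)

definition mat_char :: "'n::finite gen free_alg ^ 'i ^ 'j \<Rightarrow> Cq ^ 'i ^ 'j" where
  "mat_char A = (\<chi> r c. alg_char (A $ r $ c))"

lemma mat_char_mult: "mat_char (A ** B) = mat_char A ** mat_char B"
  by (simp add: mat_char_def matrix_matrix_mult_def alg_char_sum alg_char_mult vec_eq_iff)

lemma mat_char_sum: "mat_char (sum h A) = (\<Sum>x\<in>A. mat_char (h x))"
  by (simp add: mat_char_def vec_eq_iff alg_char_sum)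

lemma l_coeff_char: "alg_char (l_coeff s i j p) = (if i = j \<and> p = 0 then 1 else 0)"
  by (cases s) auto

lemma L_coeff_char:
  "mat_char (L1_coeff s p) = mat (if p = 0 then 1 else 0)"
  "mat_char (L2_coeff s p) = mat (if p = 0 then 1 else 0)"
  by (auto simp: mat_char_def L1_coeff_def L2_coeff_def vec_eq_iff mat_def l_coeff_char
      prod_eq_iff if_distrib[of alg_char])

lemma R_coeff_char:
  "alg_char x = alg_char y \<Longrightarrow> mat_char (R_coeff x k) = mat_char (R_coeff y k)"
  by (simp add: mat_char_def R_coeff_def alg_char_mult alg_char_power)

lemma L_coeff_zero:
  "s = Plus \<Longrightarrow> p < 0 \<Longrightarrow> L1_coeff s p = 0" "t = Minus \<Longrightarrow> p > 0 \<Longrightarrow> L2_coeff t p = 0"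
  by (auto simp: L1_coeff_def L2_coeff_def vec_eq_iff)

lemma RLL_coeff_finite:
  assumes "s = Plus \<or> t = Minus"
  shows "RLL_coeff x s t a b =
      (\<Sum>k\<le>nat (\<bar>a\<bar> + \<bar>b\<bar>). R_coeff x k ** L1_coeff s (a - int k) ** L2_coeff t (b + int k))"
    and "LLR_coeff x s t a b =
      (\<Sum>k\<le>nat (\<bar>a\<bar> + \<bar>b\<bar>). L2_coeff t (b + int k) ** L1_coeff s (a - int k) ** R_coeff x k)"
proof -
  have z: "L1_coeff s (a - int k) = 0 \<or> L2_coeff t (b + int k) = 0" if "k > nat (\<bar>a\<bar> + \<bar>b\<bar>)" for k
  proof -
    have "a - int k < 0" "b + int k > 0" using that by linarith+
    then show ?thesis using assms L_coeff_zero by blast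
  qed
  have "R_coeff x k ** L1_coeff s (a - int k) ** L2_coeff t (b + int k) = 0"
    "L2_coeff t (b + int k) ** L1_coeff s (a - int k) ** R_coeff x k = 0"
    if "k > nat (\<bar>a\<bar> + \<bar>b\<bar>)" for k
    using z[OF that] by (metis times0_left times0_right)+
  note z = this
  show "RLL_coeff x s t a b =
      (\<Sum>k\<le>nat (\<bar>a\<bar> + \<bar>b\<bar>). R_coeff x k ** L1_coeff s (a - int k) ** L2_coeff t (b + int k))"
    unfolding RLL_coeff_def
    by (rule Sum_any.expand_superset) (use z not_le in blast)+
  show "LLR_coeff x s t a b =
      (\<Sum>k\<le>nat (\<bar>a\<bar> + \<bar>b\<bar>). L2_coeff t (b + int k) ** L1_coeff s (a - int k) ** R_coeff x k)"
    unfolding LLR_coeff_def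
    by (rule Sum_any.expand_superset) (use z not_le in blast)+
qed

lemma RLL_coeff_char:
  assumes "s = Plus \<or> t = Minus" "alg_char x = alg_char y"
  shows "alg_char (RLL_coeff x s t a b $ r $ c) = alg_char (LLR_coeff y s t a b $ r $ c)"
proof -
  have "mat_char (RLL_coeff x s t a b) = mat_char (LLR_coeff y s t a b)"
    unfolding RLL_coeff_finite[OF assms(1)]
    by (auto intro!: sum.cong simp: mat_char_sum mat_char_mult L_coeff_char R_coeff_char[OF assms(2)])
  then have "mat_char (RLL_coeff x s t a b) $ r $ c = mat_char (LLR_coeff y s t a b) $ r $ c"
    by simp
  then show ?thesis by (simp add: mat_char_def)
qed

lemma relation_char: "relation x y \<Longrightarrow> alg_char x = alg_char y"
proof (induction rule: relation.induct)
  case (9 s a b r c)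
  then show ?case by (intro RLL_coeff_char) (use pm.exhaust in auto)
next
  case (10 a b r c)
  then show ?case by (intro RLL_coeff_char) (auto simp: alg_char_power)
qed (auto simp: alg_char_mult)

lemma one_notin_relation_ideal: "1 \<notin> (relation_ideal :: 'n::finite gen free_alg set)"
proof -
  have "alg_char p = 0" if "p \<in> relation_ideal" for p :: "'n gen free_alg"
    using that unfolding relation_ideal_def
    by (induction rule: two_sided_ideal.induct)
      (auto simp: alg_char_add alg_char_mult alg_char_diff dest!: relation_char)
  then show ?thesis by force
qed


section \<open>The algebra U(R)\<close>

definition rel_equiv :: "'n::finite gen free_alg \<Rightarrow> 'n gen free_alg \<Rightarrow> bool" where
  "rel_equiv x y \<longleftrightarrow> x - y \<in> relation_ideal"

quotient_type 'n UR = "'n::finite gen free_alg" / rel_equiv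
proof (rule equivpI)
  show "reflp (rel_equiv :: 'n gen free_alg \<Rightarrow> _)"
    by (simp add: reflp_def rel_equiv_def relation_ideal_closed)
  show "symp (rel_equiv :: 'n gen free_alg \<Rightarrow> _)"
    by (auto simp: symp_def rel_equiv_def dest: relation_ideal_closed(5))
  show "transp (rel_equiv :: 'n gen free_alg \<Rightarrow> _)"
    by (auto simp: transp_def rel_equiv_def dest: relation_ideal_closed(2))
qed

instantiation UR :: (finite) ring_1
begin

lift_definition zero_UR :: "'a UR" is 0 .
lift_definition one_UR :: "'a UR" is 1 .
lift_definition plus_UR :: "'a UR \<Rightarrow> 'a UR \<Rightarrow> 'a UR" is "(+)"
  unfolding rel_equiv_def by (metis add_diff_add relation_ideal_closed(2))
lift_definition minus_UR :: "'a UR \<Rightarrow> 'a UR \<Rightarrow> 'a UR" is "(-)"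
proof -
  fix x y u v :: "'a gen free_alg"
  assume "rel_equiv x y" "rel_equiv u v"
  then have "(x - y) + - (u - v) \<in> relation_ideal"
    unfolding rel_equiv_def by (blast intro: relation_ideal_closed)
  then show "rel_equiv (x - u) (y - v)" by (simp add: rel_equiv_def algebra_simps)
qed
lift_definition uminus_UR :: "'a UR \<Rightarrow> 'a UR" is uminus
proof -
  fix x y :: "'a gen free_alg"
  assume "rel_equiv x y"
  then have "- (x - y) \<in> relation_ideal"
    unfolding rel_equiv_def by (rule relation_ideal_closed)
  then show "rel_equiv (- x) (- y)" by (simp add: rel_equiv_def)
qed
lift_definition times_UR :: "'a UR \<Rightarrow> 'a UR \<Rightarrow> 'a UR" is "(*)"
proof -
  fix x y u v :: "'a gen free_alg"
  assume "rel_equiv x y" "rel_equiv u v"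
  then have "(x - y) * u + y * (u - v) \<in> relation_ideal"
    unfolding rel_equiv_def by (blast intro: relation_ideal_closed)
  then show "rel_equiv (x * u) (y * v)" by (simp add: rel_equiv_def algebra_simps)
qed

instance
proof
  fix a b c :: "'a UR"
  note id0 = relation_ideal_closed(1)
  show "a * b * c = a * (b * c)" by transfer (simp add: rel_equiv_def mult.assoc id0)
  show "a + b + c = a + (b + c)" by transfer (simp add: rel_equiv_def add.assoc id0)
  show "a + b = b + a" by transfer (simp add: rel_equiv_def add.commute id0)
  show "0 + a = a" by transfer (simp add: rel_equiv_def id0)
  show "- a + a = 0" by transfer (simp add: rel_equiv_def id0)
  show "a - b = a + - b" by transfer (simp add: rel_equiv_def id0)
  show "(a + b) * c = a * c + b * c" by transfer (simp add: rel_equiv_def algebra_simps id0)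
  show "a * (b + c) = a * b + a * c" by transfer (simp add: rel_equiv_def algebra_simps id0)
  show "1 * a = a" "a * 1 = a" by (transfer; simp add: rel_equiv_def id0)+
  show "(0 :: 'a UR) \<noteq> 1"
    by transfer
      (use one_notin_relation_ideal relation_ideal_closed(5)[of "- 1"] in \<open>auto simp: rel_equiv_def\<close>)
qed

end

text \<open>The structure map of the algebra, and the images of the generators
  \<open>l\<^sup>+\<^sub>i\<^sub>j[-m]\<close>, \<open>l\<^sup>-\<^sub>i\<^sub>j[m]\<close>.\<close>

lift_definition scal :: "Cq \<Rightarrow> 'n::finite UR" is fscal .

lift_definition ell :: "pm \<Rightarrow> 'n::finite idx \<Rightarrow> 'n idx \<Rightarrow> nat \<Rightarrow> 'n UR" is
  "\<lambda>s i j m. fgen (LGen s i j m)" .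

definition center :: "'a::ring_1 set" where
  "center = {x. \<forall>y. x * y = y * x}"


section \<open>The matrices L(u) and D\<close>

text \<open>\<open>L\<^sup>\<plusminus>(cu)\<close> for a nonzero scalar \<open>c\<close>, as a matrix of power series in \<open>u\<close> for the sign
  \<open>Plus\<close> and in \<open>u\<^sup>-\<^sup>1\<close> for the sign \<open>Minus\<close>.\<close>

definition L_mat :: "pm \<Rightarrow> Cq \<Rightarrow> 'n::finite UR fps ^ 'n idx ^ 'n idx" where
  "L_mat s c = (\<chi> i j. Abs_fps (\<lambda>m.
     scal (c powi (case s of Plus \<Rightarrow> int m | Minus \<Rightarrow> - int m)) * ell s i j m))"

definition D_mat :: "'n::finite UR fps ^ 'n idx ^ 'n idx" where
  "D_mat = (\<chi> i j. if i = j then fps_const (scal (qq powi bar i)) else 0)"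

definition D_inv :: "'n::finite UR fps ^ 'n idx ^ 'n idx" where
  "D_inv = (\<chi> i j. if i = j then fps_const (scal (qq powi (- bar i))) else 0)"

text \<open>The transposition \<open>e\<^sub>i\<^sub>j \<mapsto> \<epsilon>\<^sub>i \<epsilon>\<^sub>j e\<^sub>j\<^sub>'\<^sub>i\<^sub>'\<close>: the entry of the image at \<open>(k, l)\<close> comes from
  \<open>(i, j) = (l', k')\<close>.\<close>

definition transp_t :: "'a::ring_1 ^ 'n::finite idx ^ 'n idx \<Rightarrow> 'a ^ 'n idx ^ 'n idx" where
  "transp_t A = (\<chi> k l. of_int (eps (opp l) * eps (opp k)) * A $ opp l $ opp k)"

end

theory Submission
  imports Defs
begin

unbundle no Formal_Power_Series.fps_syntax

text \<open>
  Let \<open>w = \<Sum> q\<^bsup>bar k\<^esup> \<epsilon>\<^sub>k e\<^sub>k \<otimes> e\<^sub>k\<^sub>'\<close>. Moving a matrix from the second leg of \<open>w\<close> to the first one turns \<open>B\<close> into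
  \<open>D B\<^sup>t D\<^sup>-\<^sup>1\<close>, so the defining equation of \<open>z(u)\<close> says \<open>L\<^sub>1(u) L\<^sub>2(u\<xi>) w = z(u) w\<close>. The same move turns \<open>R(x\<xi>)\<close>
  into a multiple of \<open>R(x)\<^sup>-\<^sup>1\<close>; by the functional equation of \<open>f\<close> the multiple is a constant \<open>g\<close>, whence
  \<open>R\<^sub>1\<^sub>3(x) R\<^sub>2\<^sub>3(x\<xi>) w = g w\<close>. Pulling \<open>L\<^sub>3(v)\<close> through \<open>L\<^sub>1(u) L\<^sub>2(u\<xi>) w\<close> by two exchange relations therefore
  produces the same factor \<open>g\<close> on both sides, even if the arguments of \<open>R\<close> are shifted by powers of \<open>q\<^sup>c\<close>, and
  \<open>z(u)\<close> commutes with \<open>L(v)\<close>. The inversion of \<open>R\<close> reduces to identities between \<open>R\<close>, \<open>P\<close> and \<open>Q\<close>.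
\<close>

section \<open>Indices and entries of the matrices\<close>

text \<open>The matrices \<open>R_mat ** P_mat\<close> and \<open>K_mat\<close> satisfy the skein,
  twist and loop relations of a Birman-Murakami-Wenzl algebra. Hence the product of
  \<open>R(x)\<close> with the transformed \<open>R(x\<xi>)\<close> lies in the span of 1,
  \<open>R_mat ** P_mat\<close> and \<open>K_mat\<close>. The last two coefficients vanish; the
  first is \<open>q^-2 \<xi>^2\<close> times the four linear factors that f cancels, so the constant
  is \<open>g = q^-2 \<xi>^2\<close>. Two obstacles shape the rest. Series in u or 1/u, in v or 1/v,
  and in u/v have no common ring of power series in u and v. For each pair of signs they are
  therefore evaluated at three monomials in two new variables, which keeps all power series ordinary
  and loses no coefficient needed. Moreover, the mixed exchange relation is given only with
  \<open>L\<^sup>+\<close> in the first factor. To compare \<open>z\<^sup>-\<close> with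
  \<open>L\<^sup>+\<close>, the two fused matrices must come from the second factor, which requires
  a mirrored fusion argument with \<open>R(x/\<xi>)\<close> and \<open>R(x)\<close>, and crossing
  with respect to the other leg.\<close>

lemma pos_bounds: "1 \<le> pos i" "pos (i :: 'n::finite idx) \<le> 2 * CARD('n)"
  using pos[of i] by auto

lemma pos_eq_iff: "pos i = pos j \<longleftrightarrow> i = j"
  by (rule pos_inject)

lemma pos_opp: "pos (opp i) = 2 * CARD('n) + 1 - pos (i :: 'n::finite idx)"
  using pos_bounds[of i] unfolding opp_def by (subst Idx_inverse) auto

lemma opp_opp [simp]: "opp (opp i) = i"
  using pos_bounds[of i] by (subst pos_eq_iff[symmetric]) (simp add: pos_opp)

lemma opp_eq_iff: "opp i = j \<longleftrightarrow> i = opp j"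
  by auto

lemma opp_eq_commute: "(i = opp j) = (j = opp i)"
  by (subst eq_commute) (rule opp_eq_iff)

lemma opp_inject [simp]: "opp i = opp j \<longleftrightarrow> i = j"
  by (metis opp_opp)

lemma pos_opp_less_iff [simp]: "pos (opp i) < pos (opp j) \<longleftrightarrow> pos j < pos i"
  for i j :: "'n::finite idx"
  using pos_bounds[of i] pos_bounds[of j] by (auto simp: pos_opp)

lemma opp_neq [simp]: "opp i \<noteq> i" "i \<noteq> opp i"
proof -
  have "pos (opp i) \<noteq> pos i"
    using pos_bounds[of i] by (simp add: pos_opp) presburger
  then show "opp i \<noteq> i" "i \<noteq> opp i" by metis+
qed

lemma bar_opp [simp]: "bar (opp i) = - bar i"
  using pos_bounds[of i] by (auto simp: bar_def pos_opp)

lemma eps_opp [simp]: "eps (opp i) = - eps i"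
  using pos_bounds[of i] by (auto simp: eps_def pos_opp)

lemma eps_square [simp]: "eps i * eps i = 1" "eps i * (eps i * x) = x"
  by (auto simp: eps_def)

lemma sum_pair: "(\<Sum>d\<in>UNIV. F d) = (\<Sum>i\<in>UNIV. \<Sum>j\<in>UNIV. F (i, j))"
  for F :: "'a::finite \<times> 'b::finite \<Rightarrow> 'c::comm_monoid_add"
  by (simp add: sum.cartesian_product UNIV_Times_UNIV[symmetric] del: UNIV_Times_UNIV)

lemma tensor_unit_nth:
  "tensor_unit i j k l x $ (a, b) $ (c, d) =
    (if i = a then (if j = c then (if k = b then (if l = d then x else 0) else 0) else 0) else 0)"
  by (auto simp: tensor_unit_def)

lemma double_sum_single:
  fixes F :: "'a::finite \<Rightarrow> 'b::finite \<Rightarrow> 'c::comm_monoid_add"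
  assumes "\<And>i j. F i j \<noteq> 0 \<Longrightarrow> i = a \<and> j = b"
  shows "(\<Sum>i\<in>UNIV. \<Sum>j\<in>{j. S i j}. F i j) = (if S a b then F a b else 0)"
proof -
  have z: "F i j = 0" if "j \<noteq> b" for i j using assms that by blast
  have "(\<Sum>j\<in>{j. S i j}. F i j) = (if i = a \<and> S a b then F a b else 0)" for i
  proof (cases "i = a")
    case True
    have "(\<Sum>j\<in>{j. S a j}. F a j) = (\<Sum>j\<in>{j. S a j}. if j = b then F a b else 0)"
      by (rule sum.cong) (auto simp: z)
    then show ?thesis using True by simp
  next
    case False
    then have "F i j = 0" for j using assms by blast
    then show ?thesis using False by simp
  qed
  then show ?thesis by simp
qed

lemma double_sum_UNIV_single:
  fixes F :: "'a::finite \<Rightarrow> 'b::finite \<Rightarrow> 'c::comm_monoid_add"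
  assumes "\<And>i j. F i j \<noteq> 0 \<Longrightarrow> i = a \<and> j = b"
  shows "(\<Sum>i\<in>UNIV. \<Sum>j\<in>UNIV. F i j) = F a b"
  using double_sum_single[of F a b "\<lambda>_ _. True", OF assms] by simp

abbreviation (input) "hh \<equiv> qq - inverse qq"

lemma P_mat_nth: "P_mat $ (a, b) $ (c, d) = (if a = d \<and> b = c then 1 else 0)"
  unfolding P_mat_def sum_component
  by (subst double_sum_UNIV_single[of _ a b]) (auto simp: tensor_unit_nth split: if_splits)

lemma Q_mat_nth:
  "Q_mat $ (a, b) $ (c, d) = (if b = opp a \<and> d = opp c
     then qq powi (bar b - bar d) * of_int (eps b * eps d) else 0)"
  unfolding Q_mat_def sum_component
  by (subst double_sum_UNIV_single[of _ b d]) (auto simp: tensor_unit_nth split: if_splits)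

lemma R_mat_nth: "R_mat $ (a, b) $ (c, d) =
     (if a = c \<and> b = d then (if a = b then qq else if b = opp a then inverse qq else 1) else 0)
     + (if a = d \<and> b = c \<and> pos a < pos b then hh else 0)
     - (if b = opp a \<and> d = opp c \<and> pos d < pos b
        then hh * (qq powi (bar b - bar d) * of_int (eps b * eps d)) else 0)"
  for a b c d :: "'a::finite idx"
proof -
  have 1: "(\<Sum>i\<in>UNIV. tensor_unit i i i i qq) $ (a, b) $ (c, d)
     = (if a = c \<and> b = d \<and> a = b then qq else 0)"
    by (auto simp: tensor_unit_nth sum.delta)
  have 2: "(\<Sum>i\<in>UNIV. \<Sum>j\<in>{j. i \<noteq> j \<and> i \<noteq> opp j}. tensor_unit i i j j (1::Cq)) $ (a, b) $ (c, d)
    = (if a \<noteq> b \<and> a \<noteq> opp b \<and> a = c \<and> b = d then 1 else 0)"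
    unfolding sum_component
    by (subst double_sum_single[of _ a b]) (auto simp: tensor_unit_nth split: if_splits)
  have 3: "(\<Sum>i\<in>UNIV. tensor_unit i i (opp i) (opp i) (inverse qq)) $ (a, b) $ (c, d)
     = (if a = c \<and> b = d \<and> b = opp a then inverse qq else 0)"
    by (auto simp: tensor_unit_nth sum.delta)
  have 4: "(\<Sum>i\<in>UNIV. \<Sum>j\<in>{j. pos i < pos j}. tensor_unit i j j i hh) $ (a, b) $ (c, d)
    = (if pos a < pos b \<and> a = d \<and> b = c then hh else 0)"
    unfolding sum_component
    by (subst double_sum_single[of _ a b]) (auto simp: tensor_unit_nth split: if_splits)
  have 5: "(\<Sum>i\<in>UNIV. \<Sum>j\<in>{j. pos i > pos j}. tensor_unit (opp i) (opp j) i j (x i j)) $ (a, b) $ (c, d)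
    = (if pos b > pos d \<and> a = opp b \<and> c = opp d then x b d else 0)" for x :: "_ \<Rightarrow> _ \<Rightarrow> Cq"
    unfolding sum_component
    by (subst double_sum_single[of _ b d]) (simp_all add: tensor_unit_nth split: if_split_asm)
  have 6: "(if A \<and> B \<and> C then q else 0)
      + (if \<not> C \<and> \<not> D \<and> A \<and> B then 1 else 0)
      + (if A \<and> B \<and> D then q' else 0)
    = (if A \<and> B then (if C then q else if D then q' else 1) else 0)"
    if "\<not> (C \<and> D)" for q q' :: Cq and A B C D
    using that by auto
  have 7: "\<not> (a = b \<and> b = opp a)" by auto
  show ?thesis
    unfolding R_mat_def vector_add_component vector_minus_component 1 2 3 4 5 mult.assoc opp_eq_commute[of a b] opp_eq_commute[of c d] 6[OF 7]
    by (simp only: conj_ac)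
qed

lemma qq_powi_nonzero [simp]: "qq powi k \<noteq> 0"
  using qq_nonzero by simp

lemma qq_powi_diff: "qq powi (a - b) = qq powi a / qq powi b"
  using qq_nonzero by (rule power_int_diff[OF disjI1])

lemma qq_powi_add: "qq powi (a + b) = qq powi a * qq powi b"
  using qq_nonzero by (simp add: power_int_add)

lemma hh_nonzero: "hh \<noteq> 0"
proof
  assume "hh = 0"
  then have "qq = inverse qq" by simp
  then have "qq\<^sup>2 = 1" using qq_nonzero by (metis power2_eq_square right_inverse)
  then have "Fract (monom 1 2 :: complex poly) 1 = Fract 1 1"
    by (simp add: qq_power One_fract_def)
  then have "(monom 1 2 :: complex poly) = 1" by (simp add: eq_fract)
  then have "degree (monom 1 2 :: complex poly) = 0" by simp
  then show False by (simp add: degree_monom_eq)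
qed

section \<open>Telescoping sums of powers of q along the index set\<close>

lemma pos_less_insert:
  "{k :: 'n::finite idx. pos k \<le> pos i} = insert i {k. pos k < pos i}"
  by (auto simp: le_less pos_eq_iff)

lemma ex_pos: "1 \<le> p \<Longrightarrow> p \<le> 2 * CARD('n) \<Longrightarrow> \<exists>i :: 'n::finite idx. pos i = p"
  using Idx_inverse[of p, where 'n = 'n] by auto

text \<open>The exponents \<open>-2 bar k\<close> run through \<open>-2n, \<dots>, -2, 2, \<dots>, 2n\<close>, and the missing \<open>0\<close>
  in the middle accounts for the summand \<open>- hh\<close>.\<close>

lemma bar_sum_le:
  "hh * (\<Sum>k | pos k \<le> p. qq powi (- 2 * bar (k :: 'n::finite idx))) =
     (if p < CARD('n) then qq powi (2 * int p - 2 * int CARD('n) - 1) else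
       qq powi (2 * int p - 2 * int CARD('n) + 1) - hh)
      - qq powi (- 2 * int CARD('n) - 1)"
  if "p \<le> 2 * CARD('n)"
  using that
proof (induction p)
  case 0
  have "{k :: 'n idx. pos k \<le> 0} = {}"
    using pos_bounds(1) by (metis (no_types, lifting) Collect_empty_eq le_zero_eq not_one_le_zero)
  then show ?case by (simp only: sum.empty) simp
next
  case (Suc p)
  then obtain i :: "'n idx" where i: "pos i = Suc p"
    using ex_pos[of "Suc p", where 'n = 'n] by auto
  have s: "{k :: 'n idx. pos k \<le> Suc p} = insert i {k. pos k \<le> p}"
    using pos_less_insert[of i] by (simp add: i less_Suc_eq_le)
  have IH: "hh * (\<Sum>k | pos k \<le> p. qq powi (- 2 * bar (k :: 'n::finite idx))) =
     (if p < CARD('n) then qq powi (2 * int p - 2 * int CARD('n) - 1) else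
       qq powi (2 * int p - 2 * int CARD('n) + 1) - hh)
      - qq powi (- 2 * int CARD('n) - 1)" using Suc by simp
  have t: "hh * (\<Sum>k | pos k \<le> Suc p. qq powi (- 2 * bar (k :: 'n::finite idx))) =
    hh * qq powi (- 2 * bar i) + hh * (\<Sum>k | pos k \<le> p. qq powi (- 2 * bar (k :: 'n::finite idx)))"
    unfolding s by (subst sum.insert) (auto simp: i distrib_left)
  have u: "hh * qq powi e = qq powi (e + 1) - qq powi (e - 1)" for e
    using qq_nonzero by (simp add: qq_powi_add qq_powi_diff algebra_simps divide_inverse)
  consider "Suc p < CARD('n)" | "Suc p = CARD('n)" | "Suc p > CARD('n)" by linarith
  then show ?case
  proof cases
    case 1
    then have b: "- 2 * bar i = 2 * int (Suc p) - 2 * int CARD('n) - 2" by (simp add: bar_def i)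
    show ?thesis using 1 unfolding t u IH b by (simp add: add.commute)
  next
    \<comment> \<open>The middle index, where the branch changes: the telescoped value is
      \<open>inverse qq\<close>, which equals \<open>qq - hh\<close>.\<close>
    case 2
    then have b: "- 2 * bar i = - 2" by (simp add: bar_def i)
    have p: "int p = int CARD('n) - 1" using 2 by simp
    show ?thesis using 2 unfolding t u IH b p by (simp add: power_int_minus)
  next
    case 3
    then have b: "- 2 * bar i = 2 * int (Suc p) - 2 * int CARD('n)" by (simp add: bar_def i)
    show ?thesis using 3 unfolding t u IH b by (simp add: add.commute)
  qed
qed

text \<open>Up to sign and the factor \<open>hh\<close>, this is the loop value: the scalar by which
  \<open>K_mat\<close> multiplies itself in \<open>Q_flip_Q\<close>.\<close>

lemma bar_sum_UNIV:
  "hh * (\<Sum>k\<in>UNIV. qq powi (- 2 * bar (k :: 'n::finite idx))) =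
    qq powi (2 * int CARD('n) + 1) - hh - qq powi (- 2 * int CARD('n) - 1)"
proof -
  have "{k :: 'n idx. pos k \<le> 2 * CARD('n)} = UNIV" using pos_bounds by auto
  then show ?thesis using bar_sum_le[of "2 * CARD('n)", where 'n = 'n] by simp
qed

lemma bar_sum_less:
  "hh * (\<Sum>k | pos k < pos i. qq powi (- 2 * bar (k :: 'n idx))) =
    qq powi (- 2 * bar i - 1) - (if pos i \<le> CARD('n) then 0 else hh) - qq powi (- 2 * int CARD('n) - 1)"
  for i :: "'n::finite idx"
proof -
  obtain p where p: "pos i = Suc p" using pos_bounds(1)[of i] by (cases "pos i") auto
  then have "p \<le> 2 * CARD('n)" using pos_bounds(2)[of i] by simp
  note b = bar_sum_le[OF this]
  have e: "{k :: 'n idx. pos k \<le> p} = {k. pos k < pos i}" by (simp add: p less_Suc_eq_le)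
  note b[unfolded e]
  moreover have "bar i = (if p < CARD('n) then int CARD('n) - int p else int CARD('n) - int p - 1)"
    by (simp add: bar_def p)
  ultimately show ?thesis by (cases "p < CARD('n)") (simp_all add: p Suc_le_eq add.commute)
qed

text \<open>A difference of two partial sums; the correction \<open>hh\<close> survives only if the
  interval crosses the gap in the exponents between \<open>n\<close> and
  \<open>n + 1\<close>.\<close>

lemma bar_sum_between:
  "hh * (\<Sum>k | pos j < pos k \<and> pos k < pos i. qq powi (- 2 * bar (k :: 'n idx))) =
    qq powi (- 2 * bar i - 1) - qq powi (- 2 * bar j + 1)
      - (if pos j \<le> CARD('n) \<and> CARD('n) < pos i then hh else 0)"
  if "pos j < pos i" for i j :: "'n::finite idx"
proof -
  have s: "{k :: 'n idx. pos k < pos i} = insert j ({k. pos k < pos j} \<union> {k. pos j < pos k \<and> pos k < pos i})"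
  proof (rule set_eqI)
    fix k :: "'n idx"
    have "pos k < pos i \<longleftrightarrow> pos k = pos j \<or> pos k < pos j \<or> pos j < pos k \<and> pos k < pos i"
      using that by linarith
    then show "k \<in> {k. pos k < pos i} \<longleftrightarrow>
        k \<in> insert j ({k. pos k < pos j} \<union> {k. pos j < pos k \<and> pos k < pos i})"
      by (simp add: pos_eq_iff)
  qed
  have t: "hh * (\<Sum>k | pos k < pos i. qq powi (- 2 * bar (k :: 'n idx))) = hh * qq powi (- 2 * bar j)
     + (hh * (\<Sum>k | pos k < pos j. qq powi (- 2 * bar (k :: 'n idx)))
     + hh * (\<Sum>k | pos j < pos k \<and> pos k < pos i. qq powi (- 2 * bar (k :: 'n idx))))"
    unfolding s by (subst sum.insert, simp, simp, subst sum.union_disjoint) (auto simp: distrib_left)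
  have u: "hh * qq powi e = qq powi (e + 1) - qq powi (e - 1)" for e
    using qq_nonzero by (simp add: qq_powi_add qq_powi_diff algebra_simps divide_inverse)
  have r: "x = y" if "A - B - C = (P - M) + ((M - D - C) + x)" "y = A - P - (B - D)"
    for x y A B C D M P :: Cq using that by (simp add: algebra_simps)
  show ?thesis by (rule r[OF t[unfolded u bar_sum_less]]) (use that in auto)
qed

text \<open>The sparse form in which \<open>R_mat\<close> is multiplied from the left: a diagonal
  term, a swapped term, and a sum over pairs \<open>(opp m, m)\<close> that occurs only in rows of
  the same kind.\<close>

lemma R_mat_row:
  "(\<Sum>d\<in>UNIV. R_mat $ (a, b) $ d * v d) =
     (if a = b then qq else if b = opp a then inverse qq else 1) * v (a, b)
     + (if pos a < pos b then hh * v (b, a) else 0)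
     - (if b = opp a then hh * (\<Sum>m | pos m < pos b.
          qq powi (bar b - bar m) * of_int (eps b * eps m) * v (opp m, m)) else 0)"
  for a b :: "'n::finite idx"
proof -
  define c where "c = (if a = b then qq else if b = opp a then inverse qq else 1)"
  define h where "h = hh"
  define x where "x = (\<lambda>m :: 'n idx. qq powi (bar b - bar m) * of_int (eps b * eps m))"
  note e = opp_eq_commute
  have "(\<Sum>d\<in>UNIV. R_mat $ (a, b) $ d * v d) = (\<Sum>k\<in>UNIV. \<Sum>l\<in>UNIV.
      (if a = k \<and> b = l then c * v (a, b) else 0)
     + (if a = l \<and> b = k then (if pos a < pos b then h * v (b, a) else 0) else 0)
     - (if b = opp a \<and> k = opp l \<and> pos l < pos b then h * (x l * v (opp l, l)) else 0))"
    unfolding sum_pair R_mat_nth c_def[symmetric] h_def[symmetric] x_def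
      left_diff_distrib distrib_right
    by (intro sum.cong refl arg_cong2[where f = "(-)"] arg_cong2[where f = "(+)"])
      (auto simp: e mult.assoc)
  also have "\<dots> = c * v (a, b) + (if pos a < pos b then h * v (b, a) else 0)
     - (\<Sum>l\<in>UNIV. \<Sum>k\<in>UNIV. if b = opp a \<and> k = opp l \<and> pos l < pos b then h * (x l * v (opp l, l)) else 0)"
    unfolding sum.distrib sum_subtractf
    by (subst double_sum_UNIV_single[of _ a b], simp split: if_split_asm,
        subst double_sum_UNIV_single[of _ b a], simp split: if_split_asm, subst sum.swap, simp)
  also have "(\<Sum>l\<in>UNIV. \<Sum>k\<in>UNIV. if b = opp a \<and> k = opp l \<and> pos l < pos b then h * (x l * v (opp l, l)) else 0)
    = (\<Sum>l\<in>UNIV. if pos l < pos b then (if b = opp a then h * (x l * v (opp l, l)) else 0) else 0)"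
    by (intro sum.cong refl) (auto simp: sum.delta)
  also have "\<dots> = (if b = opp a then h * (\<Sum>m | pos m < pos b. x m * v (opp m, m)) else 0)"
    by (simp add: sum.If_cases sum_distrib_left)
  finally show ?thesis unfolding c_def x_def h_def .
qed

section \<open>Identities between the constant matrices\<close>

text \<open>Exchange of the two tensor factors, that is, conjugation by the permutation
  matrix.\<close>

definition flip :: "'a ^ ('i::finite \<times> 'j::finite) ^ ('k::finite \<times> 'l::finite) \<Rightarrow> 'a ^ ('j \<times> 'i) ^ ('l \<times> 'k)" where
  "flip M = (\<chi> r c. M $ prod.swap r $ prod.swap c)"

lemma flip_nth: "flip M $ (a, b) $ (c, d) = M $ (b, a) $ (d, c)"
  by (simp add: flip_def)

text \<open>This is \<open>R_mat\<close> with \<open>q\<close> replaced by its inverse; by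
  \<open>R_Rbar\<close> it is also the inverse matrix.\<close>

definition Rbar_mat :: "Cq ^ ('n::finite idx \<times> 'n idx) ^ ('n idx \<times> 'n idx)" where
  "Rbar_mat = (\<chi> r c. case r of (a, b) \<Rightarrow> case c of (c, d) \<Rightarrow>
     (if a = c \<and> b = d then (if a = b then inverse qq else if b = opp a then qq else 1) else 0)
     - (if a = d \<and> b = c \<and> pos a < pos b then hh else 0)
     + (if b = opp a \<and> d = opp c \<and> pos d < pos b
        then hh * (qq powi (bar d - bar b) * of_int (eps b * eps d)) else 0))"

lemma Rbar_mat_nth: "Rbar_mat $ (a, b) $ (c, d) =
     (if a = c \<and> b = d then (if a = b then inverse qq else if b = opp a then qq else 1) else 0)
     - (if a = d \<and> b = c \<and> pos a < pos b then hh else 0)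
     + (if b = opp a \<and> d = opp c \<and> pos d < pos b
        then hh * (qq powi (bar d - bar b) * of_int (eps b * eps d)) else 0)"
  by (simp add: Rbar_mat_def)

lemma R_mult_row: "(R_mat ** M) $ (a, b) $ c =
     (if a = b then qq else if b = opp a then inverse qq else 1) * M $ (a, b) $ c
     + (if pos a < pos b then hh * M $ (b, a) $ c else 0)
     - (if b = opp a then hh * (\<Sum>m | pos m < pos b.
          qq powi (bar b - bar m) * of_int (eps b * eps m) * M $ (opp m, m) $ c) else 0)"
  unfolding matrix_matrix_mult_def vec_lambda_beta R_mat_row ..

lemma pos_opp_less_self: "pos (opp i) < pos i \<longleftrightarrow> CARD('n) < pos i"
  for i :: "'n::finite idx"
  using pos_bounds[of i] by (auto simp: pos_opp)

lemma pos_less_opp_self: "pos i < pos (opp i) \<longleftrightarrow> pos i \<le> CARD('n)"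
  for i :: "'n::finite idx"
  using pos_bounds[of i] by (auto simp: pos_opp)

lemma CARD_less_pos_opp: "CARD('n) < pos (opp i) \<longleftrightarrow> pos i \<le> CARD('n)"
  "pos (opp i) \<le> CARD('n) \<longleftrightarrow> CARD('n) < pos i"
  for i :: "'n::finite idx"
  using pos_bounds[of i] by (auto simp: pos_opp)

text \<open>Away from the pairs \<open>(opp m, m)\<close> the matrix splits into blocks of size one
  and two. On the span of these pairs, the product of the two triangular parts is a sum over the
  indices strictly between \<open>d\<close> and \<open>b\<close>, which
  \<open>bar_sum_between\<close> evaluates; what remains is a comparison of boundary terms.\<close>

lemma R_Rbar: "R_mat ** Rbar_mat = (mat 1 :: Cq ^ ('n::finite idx \<times> 'n idx) ^ ('n idx \<times> 'n idx))"
proof -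
  have diag: "(R_mat ** Rbar_mat) $ (opp b, b) $ (opp d, d) = (if b = d then 1 else 0)"
    for b d :: "'n idx"
  proof -
    define h where "h = hh"
    define x where "x = qq powi bar b"
    define y where "y = qq powi bar d"
    define S where "S = (\<Sum>m | pos d < pos m \<and> pos m < pos b. qq powi (- 2 * bar (m :: 'n idx)))"
    have nz: "x \<noteq> 0" "y \<noteq> 0" "qq \<noteq> 0" by (simp_all add: x_def y_def qq_nonzero)
    define F where "F = (\<lambda>m. (if m = d then qq else 0) - (if m = opp d \<and> pos d < pos m then h else 0)
      + (if pos d < pos m then h * (qq powi (bar d - bar m) * of_int (eps m * eps d)) else 0))"
    have F: "Rbar_mat $ (opp m, m) $ (opp d, d) = F m" for m
      by (simp add: Rbar_mat_nth F_def h_def opp_eq_iff)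
    have F': "Rbar_mat $ (b, opp b) $ (opp d, d) = F (opp b)"
      using F[of "opp b"] by simp
    define k where "k = (\<lambda>m :: 'n idx. qq powi (bar b - bar m) * of_int (eps b * eps m))"
    have "(\<Sum>m | pos m < pos b. k m * F m) =
        (\<Sum>m\<in>{m. pos m < pos b}. (if m = d then k d * qq else 0)
        - (if m = opp d then (if pos d < pos m then k m * h else 0) else 0)
        + (if pos d < pos m then h * (x * y * of_int (eps b * eps d) * qq powi (- 2 * bar m)) else 0))"
    proof (intro sum.cong refl)
      fix m :: "'n idx"
      have "k m * (qq powi (bar d - bar m) * of_int (eps m * eps d))
        = x * y * of_int (eps b * eps d) * qq powi (- bar m - bar m) * of_int (eps m * eps m)"
        by (simp only: k_def x_def y_def qq_powi_diff power_int_minus of_int_mult divide_inverse mult_ac)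
      then have "k m * (qq powi (bar d - bar m) * of_int (eps m * eps d))
        = x * y * of_int (eps b * eps d) * qq powi (- 2 * bar m)" by simp
      note km = this[THEN arg_cong, of "\<lambda>z. h * z"]
      show "k m * F m = (if m = d then k d * qq else 0)
        - (if m = opp d then (if pos d < pos m then k m * h else 0) else 0)
        + (if pos d < pos m then h * (x * y * of_int (eps b * eps d) * qq powi (- 2 * bar m)) else 0)"
        unfolding F_def km[symmetric] by (simp add: algebra_simps)
    qed
    also have "\<dots> = (if pos d < pos b then k d * qq else 0)
      - (if pos (opp d) < pos b \<and> pos d < pos (opp d) then k (opp d) * h else 0)
      + x * y * of_int (eps b * eps d) * (h * S)"
    proof -
      have "(\<Sum>m\<in>{m :: 'n idx. pos m < pos b}. (if pos d < pos m then h * (x * y * of_int (eps b * eps d) * qq powi (- 2 * bar m)) else 0))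
        = x * y * of_int (eps b * eps d) * (h * S)"
        unfolding S_def sum_distrib_left
        by (subst sum.inter_filter[symmetric]) (auto intro!: sum.cong simp: algebra_simps conj_commute)
      then show ?thesis by (simp add: sum.distrib sum_subtractf)
    qed
    finally have s: "(\<Sum>m | pos m < pos b. k m * F m) = (if pos d < pos b then k d * qq else 0)
      - (if pos (opp d) < pos b \<and> pos d < pos (opp d) then k (opp d) * h else 0)
      + x * y * of_int (eps b * eps d) * (h * S)" .
    \<comment> \<open>The telescoped sum in terms of \<open>x\<close> and \<open>y\<close>: the
      exponents \<open>- 2 * bar b - 1\<close> and \<open>- 2 * bar d + 1\<close> become
      \<open>1 / (x * x * qq)\<close> and \<open>qq / (y * y)\<close>.\<close>
    have S: "h * S = (if pos d < pos b then 1 / (x * x * qq) - qq / (y * y)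
        - (if pos d \<le> CARD('n) \<and> CARD('n) < pos b then h else 0) else 0)"
    proof (cases "pos d < pos b")
      case True
      have "- 2 * bar b - 1 = - bar b - bar b - 1" "- 2 * bar d + 1 = - bar d - bar d + 1" by auto
      with True show ?thesis unfolding S_def h_def bar_sum_between[OF True] x_def y_def
        by (simp only: qq_powi_diff qq_powi_add power_int_minus) (simp add: field_simps)
    next
      case False
      then have "{m :: 'n idx. pos d < pos m \<and> pos m < pos b} = {}" by auto
      then have "S = 0" unfolding S_def by (simp only: sum.empty)
      then show ?thesis using False by simp
    qed
    have kd: "k d = x / y * of_int (eps b * eps d)" "k (opp d) = - (x * y * of_int (eps b * eps d))"
      by (simp_all add: k_def x_def y_def qq_powi_diff power_int_minus divide_inverse)
    have Fb: "F b = (if b = d then qq else 0) - (if b = opp d \<and> CARD('n) < pos b then h else 0)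
      + (if pos d < pos b then h * (y / x * of_int (eps b * eps d)) else 0)"
      unfolding F_def x_def y_def qq_powi_diff by (auto simp: pos_less_opp_self CARD_less_pos_opp)
    have Fb': "F (opp b) = (if b = opp d then qq else 0) - (if b = d \<and> pos b \<le> CARD('n) then h else 0)
      - (if pos d < pos (opp b) then h * (x * y * of_int (eps b * eps d)) else 0)"
    proof -
      have "qq powi (bar d * 2) = y * y" "qq powi (bar d + bar b) = x * y"
        by (simp_all add: x_def y_def qq_powi_add[symmetric] ac_simps)
      then show ?thesis unfolding F_def
        by (auto simp: opp_eq_iff mult_ac pos_less_opp_self CARD_less_pos_opp)
    qed
    have "(R_mat ** Rbar_mat) $ (opp b, b) $ (opp d, d) =
      inverse qq * F b + (if CARD('n) < pos b then h * F (opp b) else 0)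
      - h * (\<Sum>m | pos m < pos b. k m * F m)"
      unfolding R_mult_row F F' h_def k_def pos_opp_less_self by simp
    also have "\<dots> = (if b = d then 1 else 0)"
    proof -
      define N p r where "N = CARD('n)" and "p = pos b" and "r = pos d"
      have bounds: "1 \<le> p" "p \<le> 2 * N" "1 \<le> r" "r \<le> 2 * N"
        using pos_bounds[of b] pos_bounds[of d] by (auto simp: N_def p_def r_def)
      have eqs: "(b = d) = (p = r)" "(b = opp d) = (p + r = 2 * N + 1)"
        "pos (opp d) < pos b \<longleftrightarrow> 2 * N + 1 < p + r" "pos d < pos (opp d) \<longleftrightarrow> r \<le> N"
        "pos d < pos (opp b) \<longleftrightarrow> p + r < 2 * N + 1"
        "CARD('n) = N" "pos b = p" "pos d = r" "eps b = (if p \<le> N then 1 else -1)"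
        "eps d = (if r \<le> N then 1 else -1)"
        using pos_bounds[of b] pos_bounds[of d]
        by (auto simp: pos_eq_iff[symmetric] pos_opp N_def p_def r_def eps_def)
      \<comment> \<open>Only on the two diagonals \<open>b = d\<close> and \<open>b = opp d\<close>
        are \<open>x\<close> and \<open>y\<close> dependent; elsewhere the identity holds with both
        free.\<close>
      have "b = d \<Longrightarrow> x = y" "b = opp d \<Longrightarrow> x * y = 1"
        by (auto simp: x_def y_def qq_powi_add[symmetric])
      then have xy: "p = r \<Longrightarrow> x = y" "p + r = 2 * N + 1 \<Longrightarrow> x * y = 1"
        using eqs(1,2) by blast+
      have h: "h = qq - 1 / qq" by (simp add: h_def divide_inverse)
      have X: "h * (A - B + (x * y * c) * (h * S)) = h * A - h * B + h * (x * y * c) * (h * S)" for A B c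
        by (simp add: algebra_simps)
      \<comment> \<open>Each case decides every condition in the formula: the order of
        \<open>p\<close> and \<open>r\<close>, their sides of the middle \<open>N\<close>, and the
        sign of \<open>p + r - (2 * N + 1)\<close>, which compares an index with the opposite of the
        other.\<close>
      consider "p = r" "r \<le> N" | "p = r" "N < r" | "p < r" "p + r = 2 * N + 1" | "r < p" "p + r = 2 * N + 1"
        | "p < r" "r \<le> N" | "p < r" "p \<le> N" "N < r" "p + r < 2 * N + 1" | "p < r" "p \<le> N" "N < r" "p + r > 2 * N + 1"
        | "p < r" "N < p" | "r < p" "p \<le> N" | "r < p" "r \<le> N" "N < p" "p + r < 2 * N + 1"
        | "r < p" "r \<le> N" "N < p" "p + r > 2 * N + 1" | "r < p" "N < r"
        using bounds
        by atomize_elim (cases p r rule: linorder_cases; cases "p + r" "2 * N + 1" rule: linorder_cases;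
          cases "p \<le> N"; cases "r \<le> N"; simp)
      then show ?thesis
      proof cases
        case 1
        have y: "y = x" using nz xy 1 by simp
        show ?thesis unfolding s unfolding X S kd Fb Fb' eqs(1-5) unfolding eqs(6-) using 1 bounds nz
          by (simp add: y, (simp add: h field_simps)?)
      next
        case 2
        have y: "y = x" using nz xy 2 by simp
        show ?thesis unfolding s unfolding X S kd Fb Fb' eqs(1-5) unfolding eqs(6-) using 2 bounds nz
          by (simp add: y, (simp add: h field_simps)?)
      next
        case 3
        have y: "y = 1 / x" using nz xy 3 by (simp add: field_simps)
        show ?thesis unfolding s unfolding X S kd Fb Fb' eqs(1-5) unfolding eqs(6-) using 3 bounds nz
          by (simp add: y, (simp add: h field_simps)?)
      next
        case 4
        have y: "y = 1 / x" using nz xy 4 by (simp add: field_simps)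
        show ?thesis unfolding s unfolding X S kd Fb Fb' eqs(1-5) unfolding eqs(6-) using 4 bounds nz
          by (simp add: y, (simp add: h field_simps)?)
      next
        case 5
        show ?thesis unfolding s unfolding X S kd Fb Fb' eqs(1-5) unfolding eqs(6-) using 5 bounds nz
          by (simp, (simp add: h field_simps)?)
      next
        case 6
        show ?thesis unfolding s unfolding X S kd Fb Fb' eqs(1-5) unfolding eqs(6-) using 6 bounds nz
          by (simp, (simp add: h field_simps)?)
      next
        case 7
        show ?thesis unfolding s unfolding X S kd Fb Fb' eqs(1-5) unfolding eqs(6-) using 7 bounds nz
          by (simp, (simp add: h field_simps)?)
      next
        case 8
        show ?thesis unfolding s unfolding X S kd Fb Fb' eqs(1-5) unfolding eqs(6-) using 8 bounds nz
          by (simp, (simp add: h field_simps)?)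
      next
        case 9
        show ?thesis unfolding s unfolding X S kd Fb Fb' eqs(1-5) unfolding eqs(6-) using 9 bounds nz
          by (simp, (simp add: h field_simps)?)
      next
        case 10
        show ?thesis unfolding s unfolding X S kd Fb Fb' eqs(1-5) unfolding eqs(6-) using 10 bounds nz
          by (simp, (simp add: h field_simps)?)
      next
        case 11
        show ?thesis unfolding s unfolding X S kd Fb Fb' eqs(1-5) unfolding eqs(6-) using 11 bounds nz
          by (simp, (simp add: h field_simps)?)
      next
        case 12
        show ?thesis unfolding s unfolding X S kd Fb Fb' eqs(1-5) unfolding eqs(6-) using 12 bounds nz
          by (simp, (simp add: h field_simps)?)
      qed
    qed
    finally show ?thesis .
  qed
  have "(R_mat ** Rbar_mat) $ (a, b) $ (c, d) = (if (a, b) = (c, d) then 1 else 0)" for a b c d :: "'n idx"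
  proof (cases "b = opp a \<and> d = opp c")
    case True
    then show ?thesis using diag[of b d] by simp
  next
    case False
    \<comment> \<open>No sum over pairs contributes any more: either the row is not of the form
      \<open>(opp m, m)\<close>, or the column is not and \<open>Rbar_mat\<close> vanishes on all
      the relevant entries.\<close>
    note e = opp_eq_commute
    show ?thesis
    proof (cases "b = opp a")
      case True
      with False have "d \<noteq> opp c" "c \<noteq> opp d" by (auto simp: e[of d c])
      then have "Rbar_mat $ (opp m, m) $ (c, d) = 0" for m by (auto simp: Rbar_mat_nth)
      note z = this this[of "opp m" for m, simplified]
      show ?thesis using True \<open>c \<noteq> opp d\<close> unfolding R_mult_row
        by (auto simp: z e)
    next
      case nb: False
      then have na: "a \<noteq> opp b" by auto
      show ?thesis
      proof (cases "a = b")
        case True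
        then show ?thesis using nb qq_nonzero unfolding R_mult_row Rbar_mat_nth by auto
      next
        case ab: False
        define h where "h = hh"
        have r: "Rbar_mat $ (a, b) $ (c, d) = (if a = c \<and> b = d then 1 else 0)
            - (if a = d \<and> b = c \<and> pos a < pos b then h else 0)"
          "Rbar_mat $ (b, a) $ (c, d) = (if b = c \<and> a = d then 1 else 0)
            - (if b = d \<and> a = c \<and> pos b < pos a then h else 0)"
          by (simp_all only: Rbar_mat_nth nb na ab ab[symmetric] h_def simp_thms if_False add_0_right)
        show ?thesis
          unfolding R_mult_row r h_def[symmetric] using nb ab
          by (cases "a = c"; cases "b = d"; cases "pos a < pos b") simp_all
      qed
    qed
  qed
  then show ?thesis by (simp add: vec_eq_iff mat_def split_paired_all)
qed

section \<open>Skein, twist and loop relations between R, P and Q\<close>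

lemma bar_sum_greater:
  "hh * (\<Sum>k | pos i < pos k. qq powi (- 2 * bar (k :: 'n idx))) =
    qq powi (2 * int CARD('n) + 1) - (if pos i \<le> CARD('n) then hh else 0) - qq powi (- 2 * bar i + 1)"
  for i :: "'n::finite idx"
proof -
  have s: "(UNIV :: 'n idx set) = insert i ({k. pos k < pos i} \<union> {k. pos i < pos k})"
  proof (rule set_eqI)
    fix k :: "'n idx"
    have "pos k = pos i \<or> pos k < pos i \<or> pos i < pos k" by linarith
    then show "k \<in> UNIV \<longleftrightarrow> k \<in> insert i ({k. pos k < pos i} \<union> {k. pos i < pos k})"
      by (simp add: pos_eq_iff)
  qed
  have "hh * (\<Sum>k\<in>UNIV. qq powi (- 2 * bar (k :: 'n idx))) = hh * qq powi (- 2 * bar i)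
     + (hh * (\<Sum>k | pos k < pos i. qq powi (- 2 * bar (k :: 'n idx)))
     + hh * (\<Sum>k | pos i < pos k. qq powi (- 2 * bar (k :: 'n idx))))"
    by (subst s, subst sum.insert, simp, simp, subst sum.union_disjoint) (auto simp: distrib_left)
  moreover have "hh * qq powi e = qq powi (e + 1) - qq powi (e - 1)" for e
    using qq_nonzero by (simp add: qq_powi_add qq_powi_diff algebra_simps divide_inverse)
  ultimately have t: "qq powi (2 * int CARD('n) + 1) - hh - qq powi (- 2 * int CARD('n) - 1)
    = qq powi (- 2 * bar i + 1) - qq powi (- 2 * bar i - 1)
     + (qq powi (- 2 * bar i - 1) - (if pos i \<le> CARD('n) then 0 else hh) - qq powi (- 2 * int CARD('n) - 1)
     + hh * (\<Sum>k | pos i < pos k. qq powi (- 2 * bar (k :: 'n idx))))"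
    unfolding bar_sum_UNIV bar_sum_less by simp
  have r: "x = A - g - B" if "A - h - C = B - D + (D - e - C + x)" "h - e = g" for A B C D e g h x :: Cq
    using that by (simp add: algebra_simps)
  show ?thesis by (rule r[OF t]) simp
qed

text \<open>The Birman-Murakami-Wenzl generator next to the braid generator
  \<open>R_mat ** P_mat\<close>. By \<open>K_mat_nth\<close> it has rank one, being minus the outer
  square of a single vector.\<close>

definition K_mat :: "Cq ^ ('n::finite idx \<times> 'n idx) ^ ('n idx \<times> 'n idx)" where
  "K_mat = Q_mat ** P_mat"

lemma P_mult_row: "(P_mat ** M) $ (a, b) $ c = M $ (b, a) $ c"
  unfolding matrix_matrix_mult_def vec_lambda_beta sum_pair P_mat_nth
  by (subst double_sum_UNIV_single[of _ b a]) (auto split: if_splits)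

lemma P_mult_col: "(M ** P_mat) $ r $ (c, d) = M $ r $ (d, c)"
  unfolding matrix_matrix_mult_def vec_lambda_beta sum_pair P_mat_nth
  by (subst double_sum_UNIV_single[of _ d c]) (auto split: if_splits)

lemma K_mat_nth:
  "K_mat $ (a, b) $ (c, d) = (if b = opp a \<and> d = opp c
     then - (qq powi bar b * qq powi bar d * of_int (eps b * eps d)) else 0)"
  unfolding K_mat_def P_mult_col Q_mat_nth opp_eq_commute[of c d]
  by (auto simp: qq_powi_diff power_int_minus divide_inverse)

lemma Q_mult_row: "(Q_mat ** M) $ (a, b) $ c = (if b = opp a then
    \<Sum>m\<in>UNIV. qq powi (bar b - bar m) * of_int (eps b * eps m) * M $ (opp m, m) $ c else 0)"
proof -
  have "(Q_mat ** M) $ (a, b) $ c = (\<Sum>m\<in>UNIV. \<Sum>k\<in>UNIV. if k = opp m then (if b = opp a then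
    qq powi (bar b - bar m) * of_int (eps b * eps m) * M $ (opp m, m) $ c else 0) else 0)"
    unfolding matrix_matrix_mult_def vec_lambda_beta sum_pair Q_mat_nth
    by (subst sum.swap) (auto intro!: sum.cong simp: opp_eq_commute)
  then show ?thesis by simp
qed

lemma flip_Q_mat_nth:
  "flip Q_mat $ (a, b) $ (c, d) = (if b = opp a \<and> d = opp c
     then qq powi (bar d - bar b) * of_int (eps b * eps d) else 0)"
  unfolding flip_nth Q_mat_nth opp_eq_commute[of a b] opp_eq_commute[of c d]
  by auto

lemma P_P: "P_mat ** P_mat = mat 1"
  by (simp add: vec_eq_iff split_paired_all P_mult_row P_mat_nth mat_def)

lemma P_flip_Q: "P_mat ** flip Q_mat = K_mat"
  by (auto simp: vec_eq_iff split_paired_all P_mult_row K_mat_def P_mult_col flip_nth)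

text \<open>The skein relation. With \<open>S = R_mat ** P_mat\<close>, the left-hand side is the
  inverse of \<open>S\<close>, and the identity reads
  \<open>S^-1 = S - hh (1 - K_mat)\<close>.\<close>

lemma P_Rbar: "P_mat ** Rbar_mat = R_mat ** P_mat + (\<chi> r c. hh * K_mat $ r $ c)
    - (\<chi> r c. hh * (mat 1 :: Cq ^ ('n::finite idx \<times> 'n idx) ^ ('n idx \<times> 'n idx)) $ r $ c)"
proof -
  have "Rbar_mat $ (b, a) $ (c, d) = R_mat $ (a, b) $ (d, c) + hh * K_mat $ (a, b) $ (c, d)
    - (if a = c \<and> b = d then hh else 0)" for a b c d :: "'n idx"
  proof -
    define h where "h = hh"
    define z where "z = qq powi bar b * qq powi bar d * of_int (eps b * eps d)"
    have q: "inverse qq = qq - h" by (simp add: h_def)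
    have R3: "(if b = opp a \<and> c = opp d \<and> pos c < pos b
        then h * (qq powi (bar b - bar c) * of_int (eps b * eps c)) else 0)
      = - (if b = opp a \<and> d = opp c \<and> pos c < pos b then h * z else 0)"
    proof (cases "c = opp d")
      case True
      then have z1: "qq powi (bar b - bar c) * of_int (eps b * eps c) = - z"
        by (simp add: z_def qq_powi_add)
      show ?thesis unfolding z1 opp_eq_commute[of c d] by auto
    next
      case False
      then show ?thesis using opp_eq_commute[of c d] by simp
    qed
    have R: "R_mat $ (a, b) $ (d, c) =
     (if a = d \<and> b = c then (if a = b then qq else if b = opp a then inverse qq else 1) else 0)
     + (if a = c \<and> b = d \<and> pos a < pos b then h else 0)
     + (if b = opp a \<and> d = opp c \<and> pos c < pos b then h * z else 0)"
      unfolding R_mat_nth h_def[symmetric] R3 by (simp only: diff_minus_eq_add)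
    have Rb3: "(if a = opp b \<and> d = opp c \<and> pos d < pos a
        then h * (qq powi (bar d - bar a) * of_int (eps a * eps d)) else 0)
      = - (if b = opp a \<and> d = opp c \<and> pos b < pos c then h * z else 0)"
    proof (cases "a = opp b \<and> d = opp c")
      case True
      then have z1: "qq powi (bar d - bar a) * of_int (eps a * eps d) = - z" "pos d < pos a \<longleftrightarrow> pos b < pos c"
        by (simp_all add: z_def qq_powi_diff power_int_minus divide_inverse mult.commute)
      show ?thesis unfolding z1 using True by simp
    next
      case False
      then show ?thesis using opp_eq_commute[of a b] by auto
    qed
    have Rb: "Rbar_mat $ (b, a) $ (c, d) =
     (if b = c \<and> a = d then (if b = a then inverse qq else if a = opp b then qq else 1) else 0)
     - (if b = d \<and> a = c \<and> pos b < pos a then h else 0)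
     - (if b = opp a \<and> d = opp c \<and> pos b < pos c then h * z else 0)"
      unfolding Rbar_mat_nth h_def[symmetric] Rb3 by (simp only: add_uminus_conv_diff)
    have z: "z = - 1" if "b = c" "d = opp c"
      using that by (simp add: z_def power_int_minus qq_nonzero)
    have K: "K_mat $ (a, b) $ (c, d) = - (if b = opp a \<and> d = opp c then z else 0)"
      by (simp add: K_mat_nth z_def)
    have "pos b = pos c \<longleftrightarrow> b = c" by (rule pos_eq_iff)
    then consider "b = c" "\<not> pos b < pos c" "\<not> pos c < pos b"
      | "b \<noteq> c" "pos b < pos c" "\<not> pos c < pos b" | "b \<noteq> c" "\<not> pos b < pos c" "pos c < pos b"
      by linarith
    \<comment> \<open>The entry identity is split into two. Strict inequalities in the exchange
      terms miss the entry \<open>a = b = c = d\<close>; the resulting correction \<open>h\<close>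
      enters both halves and is absorbed here by \<open>inverse qq = qq - h\<close>.\<close>
    then have 3: "(if b = c \<and> a = d then (if b = a then inverse qq else if a = opp b then qq else 1) else 0)
      - (if b = opp a \<and> d = opp c \<and> pos b < pos c then h * z else 0)
     = (if a = d \<and> b = c then (if a = b then qq else if b = opp a then inverse qq else 1) else 0)
      + (if b = opp a \<and> d = opp c \<and> pos c < pos b then h * z else 0)
      - h * (if b = opp a \<and> d = opp c then z else 0)
      - (if a = b \<and> a = d \<and> b = c then h else 0)"
    proof cases
      case 1
      show ?thesis
      proof (cases "a = d")
        case True
        have e: "(b = opp a \<and> d = opp c) = (b = opp a)" using True 1 opp_eq_commute[of a b] by auto
        have z': "z = - 1" if "b = opp a" using z[OF 1(1)] that True 1 by auto
        consider "a = b" "b \<noteq> opp a" | "a \<noteq> b" "b = opp a" | "a \<noteq> b" "b \<noteq> opp a" by fastforce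
        then show ?thesis
        proof cases
          case i: 1
          show ?thesis unfolding e opp_eq_commute[of a b] q using True 1 i
            by (simp only: simp_thms if_True if_False) simp
        next
          case i: 2
          show ?thesis unfolding e opp_eq_commute[of a b] q z'[OF i(2)] using True 1 i
            by (simp only: simp_thms if_True if_False) simp
        next
          case i: 3
          show ?thesis unfolding e opp_eq_commute[of a b] using True 1 i
            by (simp only: simp_thms if_True if_False) simp
        qed
      next
        case False
        then have "\<not> (b = opp a \<and> d = opp c)" using 1 by auto
        then show ?thesis using False by auto
      qed
    qed auto
    have "pos b = pos a \<longleftrightarrow> a = b" using pos_eq_iff[of b a] by auto
    then consider "a = b" "\<not> pos b < pos a" "\<not> pos a < pos b"
      | "a \<noteq> b" "pos b < pos a" "\<not> pos a < pos b" | "a \<noteq> b" "\<not> pos b < pos a" "pos a < pos b"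
      by linarith
    then have 4: "(if b = d \<and> a = c \<and> pos b < pos a then h else 0)
      = (if a = c \<and> b = d then h else 0) - (if a = c \<and> b = d \<and> pos a < pos b then h else 0)
        - (if a = b \<and> a = d \<and> b = c then h else 0)"
      by cases auto
    have r: "X1 - Y1 - Z1 = X2 + Y2 + Z2 + h * - k - g"
      if "X1 - Z1 = X2 + Z2 - h * k - w" "Y1 = g - Y2 - w" for X1 Y1 Z1 X2 Y2 Z2 k g w :: Cq
    proof -
      have "X1 - Y1 - Z1 = (X1 - Z1) - Y1" by simp
      then show ?thesis unfolding that by simp
    qed
    show ?thesis
      unfolding R Rb K h_def[symmetric] by (rule r[OF 3 4])
  qed
  then show ?thesis
    by (auto simp: vec_eq_iff split_paired_all P_mult_row P_mult_col mat_def)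
qed

text \<open>The source of the sums of \<open>qq powi (- 2 * bar m)\<close>: the signs of the
  summation index \<open>m\<close> cancel while its powers of \<open>q\<close> double.\<close>

lemma bar_factors:
  "qq powi (bar b - bar m) * of_int (eps b * eps m) * (qq powi (bar d - bar m) * of_int (eps m * eps d))
    = qq powi bar b * qq powi bar d * of_int (eps b * eps d) * qq powi (- 2 * bar m)"
proof -
  have "qq powi (bar b - bar m) * of_int (eps b * eps m) * (qq powi (bar d - bar m) * of_int (eps m * eps d))
    = qq powi bar b * qq powi bar d * of_int (eps b * eps d) * qq powi (- bar m - bar m) * of_int (eps m * eps m)"
    by (simp only: qq_powi_diff power_int_minus of_int_mult divide_inverse mult_ac)
  then show ?thesis by simp
qed

text \<open>Since \<open>flip Q_mat = P_mat ** K_mat\<close>, this is the twist relation: the braid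
  generator \<open>R_mat ** P_mat\<close> acts on \<open>K_mat\<close> by the scalar
  \<open>- q^(-2n-1)\<close>.\<close>

lemma R_flip_Q: "(R_mat ** flip Q_mat) $ r $ c = - (qq powi (- 2 * int CARD('n) - 1) * K_mat $ r $ c)"
  for r c :: "'n::finite idx \<times> 'n idx"
proof -
  obtain a b c' d where rc: "r = (a, b)" "c = (c', d)" by (cases r; cases c)
  show ?thesis
  proof (cases "b = opp a \<and> d = opp c'")
    case False
    have z: "flip Q_mat $ (opp m, m) $ (c', d) = 0" "flip Q_mat $ (m, opp m) $ (c', d) = 0" if "d \<noteq> opp c'" for m
      using that by (simp_all add: flip_Q_mat_nth)
    show ?thesis
    proof (cases "b = opp a")
      case True
      with False have "d \<noteq> opp c'" by blast
      with True show ?thesis unfolding rc R_mult_row using z by (simp add: K_mat_nth)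
    next
      case nb: False
      then have na: "a \<noteq> opp b" by auto
      show ?thesis using nb na unfolding rc R_mult_row by (simp add: flip_Q_mat_nth K_mat_nth)
    qed
  next
    case True
    then have ac: "a = opp b" "c' = opp d" by auto
    define h where "h = hh"
    define x where "x = qq powi bar b"
    define y where "y = qq powi bar d"
    define e :: Cq where "e = of_int (eps b * eps d)"
    define l where "l = qq powi (- 2 * int CARD('n) - 1)"
    have nz: "x \<noteq> 0" "qq \<noteq> 0" by (simp_all add: x_def qq_nonzero)
    have F: "flip Q_mat $ (opp m, m) $ (c', d) = qq powi (bar d - bar m) * of_int (eps m * eps d)" for m
      by (simp add: flip_Q_mat_nth ac)
    have F': "flip Q_mat $ (b, opp b) $ (c', d) = - (x * y * e)"
      using F[of "opp b"] by (simp add: x_def y_def e_def qq_powi_add)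
    have "h * (\<Sum>m | pos m < pos b. qq powi (bar b - bar m) * of_int (eps b * eps m) *
        flip Q_mat $ (opp m, m) $ (c', d))
      = x * y * e * (h * (\<Sum>m | pos m < pos b. qq powi (- 2 * bar (m :: 'n idx))))"
      unfolding F bar_factors by (simp add: sum_distrib_left x_def y_def e_def mult_ac)
    also have "\<dots> = x * y * e * (1 / (x * x * qq) - (if pos b \<le> CARD('n) then 0 else h) - l)"
    proof -
      have "qq powi (- 2 * bar b - 1) = qq powi (- bar b - bar b - 1)" by simp
      also have "\<dots> = 1 / (x * x * qq)"
        unfolding qq_powi_diff power_int_minus x_def by (simp add: field_simps)
      finally show ?thesis unfolding h_def bar_sum_less l_def by simp
    qed
    finally have s: "h * (\<Sum>m | pos m < pos b. qq powi (bar b - bar m) * of_int (eps b * eps m) *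
        flip Q_mat $ (opp m, m) $ (c', d)) = \<dots>" .
    have K: "K_mat $ (opp b, b) $ (c', d) = - (x * y * e)"
      by (simp add: K_mat_nth ac x_def y_def e_def)
    have Fb: "flip Q_mat $ (opp b, b) $ (c', d) = y / x * e"
      unfolding F by (simp add: x_def y_def e_def qq_powi_diff)
    have "(R_mat ** flip Q_mat) $ (opp b, b) $ (c', d) = inverse qq * (y / x * e)
      + (if pos b \<le> CARD('n) then 0 else h * (- (x * y * e)))
      - x * y * e * (1 / (x * x * qq) - (if pos b \<le> CARD('n) then 0 else h) - l)"
      unfolding R_mult_row h_def[symmetric] s F' Fb pos_opp_less_self by simp
    \<comment> \<open>The diagonal term cancels the upper end of the telescoped sum, and the swapped
      term cancels its jump at the middle. Only the lower end \<open>l\<close> is left, which does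
      not depend on the row.\<close>
    also have "\<dots> = l * (x * y * e)"
      using nz by (cases "pos b \<le> CARD('n)") (simp_all add: field_simps)
    finally show ?thesis unfolding rc l_def[symmetric] ac(1) K by simp
  qed
qed

text \<open>The inverse twist relation: inserting \<open>P_mat ** P_mat\<close> between the factors
  turns the left-hand side into \<open>K_mat\<close> times the inverse of
  \<open>R_mat ** P_mat\<close>.\<close>

lemma Q_Rbar: "(Q_mat ** Rbar_mat) $ r $ c = - (qq powi (2 * int CARD('n) + 1) * K_mat $ r $ c)"
  for r c :: "'n::finite idx \<times> 'n idx"
proof -
  obtain a b c' d where rc: "r = (a, b)" "c = (c', d)" by (cases r; cases c)
  have z: "Rbar_mat $ (opp m, m) $ (c', d) = 0" if "d \<noteq> opp c'" for m
    using that opp_eq_commute[of c' d] by (auto simp: Rbar_mat_nth)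
  show ?thesis
  proof (cases "b = opp a \<and> d = opp c'")
    case False
    then show ?thesis using z unfolding rc Q_mult_row by (auto simp: K_mat_nth)
  next
    case True
    then have ac: "a = opp b" "c' = opp d" by auto
    define h where "h = hh"
    define x where "x = qq powi bar b"
    define y where "y = qq powi bar d"
    define e :: Cq where "e = of_int (eps b * eps d)"
    define l where "l = qq powi (2 * int CARD('n) + 1)"
    have nz: "y \<noteq> 0" "qq \<noteq> 0" by (simp_all add: y_def qq_nonzero)
    define k where "k = (\<lambda>m :: 'n idx. qq powi (bar b - bar m) * of_int (eps b * eps m))"
    have kd: "k d = x / y * e" "k (opp d) = - (x * y * e)"
      by (simp_all add: k_def x_def y_def e_def qq_powi_diff power_int_minus divide_inverse)
    have T: "k m * Rbar_mat $ (opp m, m) $ (opp d, d) = (if m = d then k d * qq else 0)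
      - (if m = opp d then if pos d < pos (opp d) then k (opp d) * h else 0 else 0)
      + (if pos d < pos m then x * y * e * h * qq powi (- 2 * bar m) else 0)" for m
    proof -
      have km: "h * (k m * (qq powi (bar d - bar m) * of_int (eps m * eps d))) = x * y * e * h * qq powi (- 2 * bar m)"
        unfolding k_def bar_factors x_def y_def e_def by (simp add: mult_ac)
      have Rb: "Rbar_mat $ (opp m, m) $ (opp d, d) = (if m = d then qq else 0)
        - (if m = opp d then if pos d < pos (opp d) then h else 0 else 0)
        + (if pos d < pos m then h * (qq powi (bar d - bar m) * of_int (eps m * eps d)) else 0)"
        by (simp add: Rbar_mat_nth h_def opp_eq_commute[of d m])
      show ?thesis unfolding Rb km[symmetric] by (auto simp: algebra_simps)
    qed
    have kk: "qq powi (bar b - bar m) * of_int (eps b * eps m) = k m" for m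
      by (simp add: k_def)
    have "(Q_mat ** Rbar_mat) $ (opp b, b) $ (opp d, d) = k d * qq
      - (if pos d < pos (opp d) then k (opp d) * h else 0)
      + (\<Sum>m\<in>UNIV. if pos d < pos m then x * y * e * h * qq powi (- 2 * bar (m :: 'n idx)) else 0)"
      unfolding Q_mult_row kk T by (simp add: sum.distrib sum_subtractf)
    also have "(\<Sum>m\<in>UNIV. if pos d < pos m then x * y * e * h * qq powi (- 2 * bar (m :: 'n idx)) else 0)
      = x * y * e * (h * (\<Sum>m | pos d < pos m. qq powi (- 2 * bar (m :: 'n idx))))"
      by (simp add: sum.If_cases sum_distrib_left mult_ac)
    also have "\<dots> = x * y * e * (l - (if pos d \<le> CARD('n) then h else 0) - qq / (y * y))"
    proof -
      have "qq powi (- 2 * bar d + 1) = qq powi (- bar d - bar d + 1)" by simp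
      also have "\<dots> = qq / (y * y)"
        unfolding qq_powi_diff qq_powi_add power_int_minus y_def by (simp add: field_simps)
      finally show ?thesis unfolding h_def bar_sum_greater l_def by simp
    qed
    finally have "(Q_mat ** Rbar_mat) $ (opp b, b) $ (opp d, d) = x * y * e * l"
      using nz unfolding kd pos_less_opp_self by (cases "pos d \<le> CARD('n)") (simp_all add: field_simps)
    then show ?thesis unfolding rc l_def[symmetric] ac by (simp add: K_mat_nth x_def y_def e_def)
  qed
qed

text \<open>The loop relation, as \<open>Q_mat ** flip Q_mat = K_mat ** K_mat\<close>; a rank one
  matrix is proportional to its square. The factor \<open>hh\<close> avoids a division.\<close>

lemma Q_flip_Q: "hh * (Q_mat ** flip Q_mat) $ r $ c
    = - ((qq powi (2 * int CARD('n) + 1) - hh - qq powi (- 2 * int CARD('n) - 1)) * K_mat $ r $ c)"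
  for r c :: "'n::finite idx \<times> 'n idx"
proof -
  obtain a b c' d where rc: "r = (a, b)" "c = (c', d)" by (cases r; cases c)
  have "(Q_mat ** flip Q_mat) $ (a, b) $ (c', d) = - (K_mat $ (a, b) $ (c', d) *
    (\<Sum>m\<in>UNIV. qq powi (- 2 * bar (m :: 'n idx))))"
  proof (cases "b = opp a \<and> d = opp c'")
    case False
    then show ?thesis unfolding Q_mult_row flip_Q_mat_nth K_mat_nth by auto
  next
    case True
    then have "a = opp b" "c' = opp d" by auto
    then show ?thesis unfolding Q_mult_row flip_Q_mat_nth K_mat_nth
      by (simp add: bar_factors sum_distrib_left[symmetric] del: of_int_mult)
  qed
  then show ?thesis unfolding rc bar_sum_UNIV[symmetric] by simp
qed

section \<open>Crossing symmetry and unitarity of the R-matrix\<close>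

text \<open>The coefficient of the identity matrix in the product of \<open>R(X)\<close> with the
  crossed \<open>R(X\<xi>)\<close>, where \<open>p = 1/q\<close>, \<open>z = \<xi>\<close> and
  \<open>y = 1/\<xi>\<close>. The four linear factors on the right are those in the functional
  equation of f. Only \<open>q * p = 1\<close> and \<open>z * y = 1\<close> are assumed, so that
  constant power series can be substituted.\<close>

lemma crossing_scalar_one:
  fixes X q p z y :: "'a::comm_ring_1"
  assumes "q * p = 1" "z * y = 1"
  shows "(p * (X - 1) * (X - z)) * (p * (z * X - 1) * (z * X - z))
      - (q - p) * (- ((p\<^sup>2 - 1) * (X - z)) * (p * (z * X - 1) * (z * X - z)))
      + (- ((p\<^sup>2 - 1) * (X - z))) * ((p\<^sup>2 - 1) * (z * X - 1) * z)
    = p\<^sup>2 * z\<^sup>2 * ((1 - X * p\<^sup>2) * (1 - X * q\<^sup>2) * (1 - X * z) * (1 - X * y))"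
proof -
  have qp: "(q - p) * p = 1 - p\<^sup>2" "(p\<^sup>2 - 1)\<^sup>2 = p\<^sup>2 * (p\<^sup>2 + q\<^sup>2 - 2)" "p\<^sup>2 * q\<^sup>2 = 1"
    "z * (1 - X * y) = z - X"
  proof -
    show "(q - p) * p = 1 - p\<^sup>2" using assms(1) by (simp add: left_diff_distrib power2_eq_square)
    show s: "p\<^sup>2 * q\<^sup>2 = 1" using assms(1) by (metis mult.commute power_mult_distrib power_one)
    have "p\<^sup>2 * (p\<^sup>2 + q\<^sup>2 - 2) = p\<^sup>2 * p\<^sup>2 - 2 * p\<^sup>2 + p\<^sup>2 * q\<^sup>2" by (simp add: algebra_simps)
    then show "(p\<^sup>2 - 1)\<^sup>2 = p\<^sup>2 * (p\<^sup>2 + q\<^sup>2 - 2)" unfolding s by (simp add: power2_eq_square algebra_simps)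
    have "z * (1 - X * y) = z - X * (z * y)" by (simp add: algebra_simps)
    then show "z * (1 - X * y) = z - X" by (simp add: assms)
  qed
  have "(p * (X - 1) * (X - z)) * (p * (z * X - 1) * (z * X - z))
      - (q - p) * (- ((p\<^sup>2 - 1) * (X - z)) * (p * (z * X - 1) * (z * X - z)))
      + (- ((p\<^sup>2 - 1) * (X - z))) * ((p\<^sup>2 - 1) * (z * X - 1) * z)
    = z * (X - z) * (z * X - 1) * (p\<^sup>2 * (X - 1)\<^sup>2 + ((q - p) * p) * (p\<^sup>2 - 1) * (X - 1) - (p\<^sup>2 - 1)\<^sup>2)"
    by (simp add: power2_eq_square algebra_simps)
  also have "\<dots> = z * (X - z) * (z * X - 1) * (p\<^sup>2 * (X - 1)\<^sup>2 - (p\<^sup>2 - 1)\<^sup>2 * X)"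
    unfolding qp(1) by (simp add: power2_eq_square algebra_simps)
  also have "\<dots> = p\<^sup>2 * (X - z) * (z * X - 1) * z * (1 - X * p\<^sup>2 - X * q\<^sup>2 + 1 * X\<^sup>2)"
    unfolding qp(2) by (simp add: power2_eq_square algebra_simps)
  also have "\<dots> = p\<^sup>2 * z * (z - X) * ((1 - X * p\<^sup>2) * (1 - X * q\<^sup>2) * (1 - X * z))"
  proof -
    have "(1 - X * p\<^sup>2) * (1 - X * q\<^sup>2) = 1 - X * p\<^sup>2 - X * q\<^sup>2 + p\<^sup>2 * q\<^sup>2 * X\<^sup>2"
      by (simp add: power2_eq_square algebra_simps)
    then have "(1 - X * p\<^sup>2) * (1 - X * q\<^sup>2) = 1 - X * p\<^sup>2 - X * q\<^sup>2 + 1 * X\<^sup>2"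
      unfolding qp(3) .
    then show ?thesis by (simp add: algebra_simps)
  qed
  finally show ?thesis unfolding qp(4)[symmetric] by (simp add: power2_eq_square algebra_simps)
qed

text \<open>The coefficient of \<open>K_mat\<close> in the same product. The six summands come from
  the twist relations, the skein relation, the products giving \<open>K_mat\<close> itself, and the
  loop relation \<open>Q_mat ** flip Q_mat = - t K_mat\<close>. The relation between
  \<open>\<xi>\<close> and \<open>q^(2n+2)\<close> enters only through the third assumption and the
  twist scalars.\<close>

lemma crossing_scalar_K:
  fixes X q p z y t :: "'a::comm_ring_1"
  assumes "q * p = 1" "z * y = 1" "(q - p) * t = y * p - (q - p) - z * q"
  shows "- (z * q) * ((p * (X - 1) * (X - z)) * (- ((p\<^sup>2 - 1) * (z * X - z))))
      + (q - p) * (- ((p\<^sup>2 - 1) * (X - z)) * (p * (z * X - 1) * (z * X - z)))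
      + (- ((p\<^sup>2 - 1) * (X - z))) * (- ((p\<^sup>2 - 1) * (z * X - z)))
      - (y * p) * (((p\<^sup>2 - 1) * (X - 1) * z) * (p * (z * X - 1) * (z * X - z)))
      - t * (((p\<^sup>2 - 1) * (X - 1) * z) * (- ((p\<^sup>2 - 1) * (z * X - z))))
      + ((p\<^sup>2 - 1) * (X - 1) * z) * ((p\<^sup>2 - 1) * (z * X - 1) * z) = 0"
proof -
  \<comment> \<open>A common factor of all six summands; dividing it out leaves a quadratic identity
    in \<open>X\<close>.\<close>
  define c where "c = (p\<^sup>2 - 1) * z * (X - 1)"
  have qp: "(q - p) * p = 1 - p\<^sup>2"
    using assms(1) by (simp add: left_diff_distrib power2_eq_square)
  have "(1 - p\<^sup>2) * t = p * (y * p - (q - p) - z * q)"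
    unfolding qp[symmetric] assms(3)[symmetric] by (simp add: mult_ac)
  also have "\<dots> = y * p\<^sup>2 - (q - p) * p - z * (q * p)"
    by (simp add: power2_eq_square algebra_simps)
  finally have t: "(p\<^sup>2 - 1) * t = - y * p\<^sup>2 + 1 - p\<^sup>2 + z"
    unfolding qp assms(1) by (simp add: algebra_simps)
  have 1: "- (z * q) * ((p * (X - 1) * (X - z)) * (- ((p\<^sup>2 - 1) * (z * X - z)))) = c * (z * (X - 1) * (X - z))"
  proof -
    have "- (z * q) * ((p * (X - 1) * (X - z)) * (- ((p\<^sup>2 - 1) * (z * X - z))))
      = (q * p) * (c * (z * (X - 1) * (X - z)))" by (simp add: c_def algebra_simps)
    then show ?thesis by (simp add: assms)
  qed
  have 2: "(q - p) * (- ((p\<^sup>2 - 1) * (X - z)) * (p * (z * X - 1) * (z * X - z)))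
    = c * ((p\<^sup>2 - 1) * (X - z) * (z * X - 1))"
  proof -
    have "(q - p) * (- ((p\<^sup>2 - 1) * (X - z)) * (p * (z * X - 1) * (z * X - z)))
      = - ((q - p) * p) * (c * (X - z) * (z * X - 1))" by (simp add: c_def algebra_simps)
    then show ?thesis unfolding qp by (simp add: algebra_simps)
  qed
  have 4: "(y * p) * (((p\<^sup>2 - 1) * (X - 1) * z) * (p * (z * X - 1) * (z * X - z)))
    = c * (p\<^sup>2 * (X - 1) * (z * X - 1))"
  proof -
    have "(y * p) * (((p\<^sup>2 - 1) * (X - 1) * z) * (p * (z * X - 1) * (z * X - z)))
      = (z * y) * (c * (p\<^sup>2 * (X - 1) * (z * X - 1)))" by (simp add: c_def power2_eq_square algebra_simps)
    then show ?thesis by (simp add: assms)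
  qed
  have 5: "t * (((p\<^sup>2 - 1) * (X - 1) * z) * (- ((p\<^sup>2 - 1) * (z * X - z))))
    = c * (- (X - 1) * (- p\<^sup>2 + z * (1 - p\<^sup>2) + z\<^sup>2))"
  proof -
    have "t * (((p\<^sup>2 - 1) * (X - 1) * z) * (- ((p\<^sup>2 - 1) * (z * X - z))))
      = c * (- (X - 1) * (z * ((p\<^sup>2 - 1) * t)))" by (simp add: c_def algebra_simps)
    also have "z * ((p\<^sup>2 - 1) * t) = - (z * y) * p\<^sup>2 + z * (1 - p\<^sup>2) + z\<^sup>2"
      unfolding t by (simp add: power2_eq_square algebra_simps)
    finally show ?thesis by (simp add: assms)
  qed
  show ?thesis
    unfolding 1 2 4 5 by (simp add: c_def power2_eq_square algebra_simps)
qed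

section \<open>Crossing: transposition of one leg against the vector w\<close>

definition wt :: "'n::finite idx \<Rightarrow> Cq" where
  "wt i = qq powi bar i * of_int (eps i)"

lemma eps_of_int_square: "of_int (eps i) * (of_int (eps i) * x) = (x :: Cq)"
  by (auto simp: eps_def)

text \<open>The scalar in an entry of \<open>Q_mat\<close> is a quotient of two coefficients
  \<open>wt\<close> of \<open>w\<close>, because the signs square to one. This is why crossing turns
  Q into a plain permutation.\<close>

lemma bar_diff_wt: "qq powi (bar a - bar b) * of_int (eps a * eps b) * wt b = wt a"
  "qq powi (bar a - bar b) * of_int (eps a * eps b) * wt (opp a) = wt (opp b)"
  "qq powi (bar a - bar b) * of_int (eps b * eps a) * wt b = wt a"
  "qq powi (bar a - bar b) * of_int (eps b * eps a) * wt (opp a) = wt (opp b)"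
  by (simp_all add: wt_def qq_powi_diff power_int_minus eps_of_int_square field_simps qq_nonzero)

lemma if_mult_zero: "(if C then x else 0) * y = (if C then x * y else (0 :: 'a::mult_zero))"
  by simp

text \<open>In each of the crossing lemmas the first identity transposes the first leg and the
  second identity the second leg, with conjugation by the weights. Both legs yield the same matrix,
  which makes crossing usable on either side of the exchange relation.\<close>

lemma crossing_P:
  "P_mat $ (j, m) $ (opp a, l) * wt a = flip Q_mat $ (a, m) $ (opp j, l) * wt (opp j)"
  "P_mat $ (m, i) $ (l, opp b) * wt (opp b) = flip Q_mat $ (m, b) $ (l, opp i) * wt i"
proof -
  show "P_mat $ (j, m) $ (opp a, l) * wt a = flip Q_mat $ (a, m) $ (opp j, l) * wt (opp j)"
    unfolding P_mat_nth flip_Q_mat_nth using bar_diff_wt(4)[of l m] by auto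
  show "P_mat $ (m, i) $ (l, opp b) * wt (opp b) = flip Q_mat $ (m, b) $ (l, opp i) * wt i"
  proof -
    have e: "qq powi (bar (opp i) - bar b) * of_int (eps b * eps (opp i)) * wt i = wt (opp b)"
      using bar_diff_wt(4)[of "opp i" b] by (simp only: opp_opp)
    show ?thesis
      unfolding P_mat_nth flip_Q_mat_nth if_mult_zero e opp_eq_commute[of m b] by auto
  qed
qed

lemma crossing_Q:
  "Q_mat $ (j, m) $ (opp a, l) * wt a = P_mat $ (a, m) $ (opp j, l) * wt (opp j)"
  "Q_mat $ (m, i) $ (l, opp b) * wt (opp b) = P_mat $ (m, b) $ (l, opp i) * wt i"
proof -
  show "Q_mat $ (j, m) $ (opp a, l) * wt a = P_mat $ (a, m) $ (opp j, l) * wt (opp j)"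
    unfolding P_mat_nth Q_mat_nth using bar_diff_wt(1)[of m l] by auto
  show "Q_mat $ (m, i) $ (l, opp b) * wt (opp b) = P_mat $ (m, b) $ (l, opp i) * wt i"
    unfolding P_mat_nth Q_mat_nth using bar_diff_wt(1)[of i "opp b"] by auto
qed

lemma if_cong_value: "P = Q \<Longrightarrow> (Q \<Longrightarrow> x = y) \<Longrightarrow> (if P then x else z) = (if Q then y else z)"
  by simp

text \<open>Crossing interchanges the triangular parts of P and of Q inside \<open>R_mat\<close>. On
  the diagonal it interchanges the cases of equal and of opposite indices, so \<open>qq\<close> and
  \<open>inverse qq\<close> trade places. The result is the inverse matrix.\<close>

lemma crossing_R:
  "R_mat $ (j, m) $ (opp a, l) * wt a = Rbar_mat $ (a, m) $ (opp j, l) * wt (opp j)"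
  "R_mat $ (m, i) $ (l, opp b) * wt (opp b) = Rbar_mat $ (m, b) $ (l, opp i) * wt i"
proof -
  define h where "h = hh"
  have c: "A + B - C = D - E + F" if "A = D" "B = F" "C = E" for A B C D E F :: Cq using that by simp
  show "R_mat $ (j, m) $ (opp a, l) * wt a = Rbar_mat $ (a, m) $ (opp j, l) * wt (opp j)"
    unfolding R_mat_nth Rbar_mat_nth h_def[symmetric] distrib_right left_diff_distrib if_mult_zero
  proof (rule c; rule if_cong_value)
    show "(j = opp a \<and> m = l) = (a = opp j \<and> m = l)" by auto
    show "(j = l \<and> m = opp a \<and> pos j < pos m) = (m = opp a \<and> l = opp (opp j) \<and> pos l < pos m)" by auto
    show "(m = opp j \<and> l = opp (opp a) \<and> pos l < pos m) = (a = l \<and> m = opp j \<and> pos a < pos m)" by auto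
    show "(if j = m then qq else if m = opp j then inverse qq else 1) * wt a =
      (if a = m then inverse qq else if m = opp a then qq else 1) * wt (opp j)" if "a = opp j \<and> m = l"
      using that by auto
    show "h * wt a = h * (qq powi (bar l - bar m) * of_int (eps m * eps l)) * wt (opp j)"
      if "m = opp a \<and> l = opp (opp j) \<and> pos l < pos m"
    proof -
      have lm: "opp l = opp j" "opp m = a" using that by auto
      have "qq powi (bar l - bar m) * of_int (eps m * eps l) * wt (opp l) = wt (opp m)"
        by (rule bar_diff_wt(4))
      then show ?thesis unfolding lm by (simp only: mult.assoc)
    qed
    show "h * (qq powi (bar m - bar l) * of_int (eps m * eps l)) * wt a = h * wt (opp j)"
      if "a = l \<and> m = opp j \<and> pos a < pos m"
    proof -
      have lm: "a = l" "opp j = m" using that by auto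
      have "qq powi (bar m - bar l) * of_int (eps m * eps l) * wt l = wt m"
        by (rule bar_diff_wt(1))
      then show ?thesis unfolding lm by (simp only: mult.assoc)
    qed
  qed
  show "R_mat $ (m, i) $ (l, opp b) * wt (opp b) = Rbar_mat $ (m, b) $ (l, opp i) * wt i"
    unfolding R_mat_nth Rbar_mat_nth h_def[symmetric] distrib_right left_diff_distrib if_mult_zero
  proof (rule c; rule if_cong_value)
    show "(m = l \<and> i = opp b) = (m = l \<and> b = opp i)" by auto
    show "(m = opp b \<and> i = l \<and> pos m < pos i) = (b = opp m \<and> opp i = opp l \<and> pos (opp i) < pos b)"
      using pos_opp_less_iff[of b "opp i"] by auto
    show "(i = opp m \<and> opp b = opp l \<and> pos (opp b) < pos i) = (m = opp i \<and> b = l \<and> pos m < pos b)"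
      using pos_opp_less_iff[of b "opp i"] by auto
    show "(if m = i then qq else if i = opp m then inverse qq else 1) * wt (opp b) =
      (if m = b then inverse qq else if b = opp m then qq else 1) * wt i" if "m = l \<and> b = opp i"
      using that by auto
    show "h * wt (opp b) = h * (qq powi (bar (opp i) - bar b) * of_int (eps b * eps (opp i))) * wt i"
    proof -
      have "qq powi (bar (opp i) - bar b) * of_int (eps b * eps (opp i)) * wt (opp (opp i)) = wt (opp b)"
        by (rule bar_diff_wt(4))
      then show ?thesis by (simp only: opp_opp mult.assoc)
    qed
    show "h * (qq powi (bar i - bar (opp b)) * of_int (eps i * eps (opp b))) * wt (opp b) = h * wt i"
    proof -
      have "qq powi (bar i - bar (opp b)) * of_int (eps i * eps (opp b)) * wt (opp b) = wt i"
        by (rule bar_diff_wt(1))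
      then show ?thesis by (simp only: mult.assoc)
    qed
  qed
qed

lemma fps_const_sum: "fps_const (sum f S) = (\<Sum>d\<in>S. fps_const (f d :: 'a::ring_1))"
  by (induction S rule: infinite_finite_induct)
    (simp_all add: fps_const_add[symmetric] del: fps_const_add)

lemma sum_triple_expand:
  fixes a1 b1 c1 a2 b2 c2 :: "'a::comm_ring_1"
  shows "(\<Sum>d\<in>S. (a1 * x1 d + b1 * y1 d + c1 * z1 d) * (a2 * x2 d + b2 * y2 d + c2 * z2 d)) =
    a1 * a2 * (\<Sum>d\<in>S. x1 d * x2 d) + a1 * b2 * (\<Sum>d\<in>S. x1 d * y2 d) + a1 * c2 * (\<Sum>d\<in>S. x1 d * z2 d)
    + b1 * a2 * (\<Sum>d\<in>S. y1 d * x2 d) + b1 * b2 * (\<Sum>d\<in>S. y1 d * y2 d) + b1 * c2 * (\<Sum>d\<in>S. y1 d * z2 d)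
    + c1 * a2 * (\<Sum>d\<in>S. z1 d * x2 d) + c1 * b2 * (\<Sum>d\<in>S. z1 d * y2 d) + c1 * c2 * (\<Sum>d\<in>S. z1 d * z2 d)"
  unfolding sum_distrib_left sum.distrib[symmetric] by (intro sum.cong refl) (simp add: algebra_simps)

abbreviation (input) scaled :: "Cq \<Rightarrow> Cq fps \<Rightarrow> Cq fps" where
  "scaled c F \<equiv> fps_compose F (fps_const c * fps_X)"

text \<open>This is \<open>R(u\<xi>)\<close> with R, P, Q replaced by their images
  \<open>Rbar_mat\<close>, \<open>flip Q_mat\<close>, \<open>P_mat\<close> under crossing.\<close>

definition Rt_series :: "Cq fps ^ ('n::finite idx \<times> 'n idx) ^ ('n idx \<times> 'n idx)" where
  "Rt_series = (\<chi> r c. scaled (xi CARD('n)) (f_series CARD('n)) *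
     (fps_const (inverse qq) * (fps_const (xi CARD('n)) * fps_X - 1)
        * (fps_const (xi CARD('n)) * fps_X - fps_const (xi CARD('n))) * fps_const (Rbar_mat $ r $ c)
      - fps_const (qq powi (- 2) - 1) * (fps_const (xi CARD('n)) * fps_X - fps_const (xi CARD('n)))
        * fps_const (flip Q_mat $ r $ c)
      + fps_const (qq powi (- 2) - 1) * (fps_const (xi CARD('n)) * fps_X - 1) * fps_const (xi CARD('n))
        * fps_const (P_mat $ r $ c)))"

lemma scaled_R_series:
  "scaled (xi CARD('n)) (R_series $ r $ c) = scaled (xi CARD('n)) (f_series CARD('n)) *
     (fps_const (inverse qq) * (fps_const (xi CARD('n)) * fps_X - 1)
        * (fps_const (xi CARD('n)) * fps_X - fps_const (xi CARD('n))) * fps_const (R_mat $ r $ c)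
      - fps_const (qq powi (- 2) - 1) * (fps_const (xi CARD('n)) * fps_X - fps_const (xi CARD('n)))
        * fps_const (P_mat $ r $ c)
      + fps_const (qq powi (- 2) - 1) * (fps_const (xi CARD('n)) * fps_X - 1) * fps_const (xi CARD('n))
        * fps_const (Q_mat $ r $ c))"
  for r c :: "'n::finite idx \<times> 'n idx"
  by (simp add: R_series_def fps_compose_mult_distrib fps_compose_add_distrib fps_compose_sub_distrib)

lemma crossing_series_aux:
  fixes a b c f x y z x' y' z' w w' :: Cq
  assumes "x * w = x' * w'" "y * w = y' * w'" "z * w = z' * w'"
  shows "F * (A * fps_const x - B * fps_const y + C * fps_const z) * fps_const w
    = F * (A * fps_const x' - B * fps_const y' + C * fps_const z') * fps_const w'"
proof -
  have "F * (A * fps_const x - B * fps_const y + C * fps_const z) * fps_const w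
    = F * (A * fps_const (x * w) - B * fps_const (y * w) + C * fps_const (z * w))"
    by (simp only: fps_const_mult[symmetric] algebra_simps)
  also have "\<dots> = F * (A * fps_const x' - B * fps_const y' + C * fps_const z') * fps_const w'"
    unfolding assms by (simp only: fps_const_mult[symmetric] algebra_simps)
  finally show ?thesis .
qed

lemma crossing_series:
  "scaled (xi CARD('n)) (R_series $ (j, m) $ (opp a, l)) * fps_const (wt a)
    = Rt_series $ (a, m) $ (opp j, l) * fps_const (wt (opp j))"
  "scaled (xi CARD('n)) (R_series $ (m, i) $ (l, opp b)) * fps_const (wt (opp b))
    = Rt_series $ (m, b) $ (l, opp i) * fps_const (wt i)"
  for a b i j l m :: "'n::finite idx"
  unfolding scaled_R_series Rt_series_def vec_lambda_beta
  by (rule crossing_series_aux crossing_R crossing_P crossing_Q)+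

lemma xi_eq: "xi n * qq = qq powi (- 2 * int n - 1)" "inverse (xi n) * inverse qq = qq powi (2 * int n + 1)"
  "xi n \<noteq> 0"
proof -
  have e: "- 2 * int n - 1 = (- 2 * int n - 2) + 1" by simp
  show *: "xi n * qq = qq powi (- 2 * int n - 1)" unfolding e qq_powi_add xi_def by simp
  have "inverse (xi n) * inverse qq = inverse (qq powi (- 2 * int n - 1))" unfolding *[symmetric] by simp
  also have "\<dots> = qq powi (- (- 2 * int n - 1))" by (simp only: power_int_minus)
  finally show "inverse (xi n) * inverse qq = qq powi (2 * int n + 1)" by (simp add: add.commute)
  show "xi n \<noteq> 0" by (simp add: xi_def qq_nonzero)
qed

text \<open>Crossing unitarity. The nine products of constant matrices reduce to 1,
  \<open>R_mat ** P_mat\<close> and \<open>K_mat\<close> by the relations above, leaving three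
  scalar identities; only the coefficient of 1 needs the functional equation of f.\<close>

lemma R_series_Rt:
  "R_series ** Rt_series = (mat (fps_const ((inverse qq)\<^sup>2 * (xi CARD('n))\<^sup>2)) ::
     Cq fps ^ ('n::finite idx \<times> 'n idx) ^ ('n idx \<times> 'n idx))"
proof -
  define z where "z = xi CARD('n)"
  define p where "p = inverse qq"
  define h where "h = hh"
  \<comment> \<open>The loop value, chosen so that \<open>Q_mat ** flip Q_mat = - t K_mat\<close>;
    here \<open>h\<close> must be nonzero.\<close>
  define t where "t = (inverse z * p - h - z * qq) / h"
  have h0: "h \<noteq> 0" unfolding h_def by (rule hh_nonzero)
  have z0: "z \<noteq> 0" by (simp add: z_def xi_eq)
  have p2: "qq powi (- 2) - 1 = p\<^sup>2 - 1" by (simp add: p_def power_int_minus power_inverse)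
  let ?C = "fps_const :: Cq \<Rightarrow> Cq fps"
  let ?X = "fps_X :: Cq fps"
  define f1 where "f1 = f_series CARD('n)"
  define f2 where "f2 = scaled z f1"
  define A1 where "A1 = ?C p * (?X - 1) * (?X - ?C z)"
  define B1 where "B1 = - (((?C p)\<^sup>2 - 1) * (?X - ?C z))"
  define C1 where "C1 = ((?C p)\<^sup>2 - 1) * (?X - 1) * ?C z"
  define A2 where "A2 = ?C p * (?C z * ?X - 1) * (?C z * ?X - ?C z)"
  define B2 where "B2 = - (((?C p)\<^sup>2 - 1) * (?C z * ?X - ?C z))"
  define C2 where "C2 = ((?C p)\<^sup>2 - 1) * (?C z * ?X - 1) * ?C z"
  have f12: "f1 * f2 * ((1 - ?X * (?C p)\<^sup>2) * (1 - ?X * (?C qq)\<^sup>2) * (1 - ?X * ?C z) * (1 - ?X * ?C (inverse z))) = 1"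
  proof -
    have "f1 * f2 = f_rhs CARD('n)" unfolding f1_def f2_def z_def by (rule f_series(2))
    moreover have "qq powi (- 2) = p\<^sup>2" by (simp add: p_def power_int_minus power_inverse)
    ultimately show ?thesis
      unfolding f_rhs_def z_def[symmetric] fps_const_power
      by (simp only:) (rule inverse_mult_eq_1, simp)
  qed
  have Rs: "R_series $ r $ c = f1 * (A1 * ?C (R_mat $ r $ c) + B1 * ?C (P_mat $ r $ c) + C1 * ?C (Q_mat $ r $ c))"
    for r c :: "'n idx \<times> 'n idx"
    by (simp add: R_series_def f1_def A1_def B1_def C1_def p2 z_def p_def fps_const_power
        flip: fps_const_sub fps_const_1_eq_1)
  have Rt: "Rt_series $ r $ c = f2 * (A2 * ?C (Rbar_mat $ r $ c) + B2 * ?C (flip Q_mat $ r $ c) + C2 * ?C (P_mat $ r $ c))"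
    for r c :: "'n idx \<times> 'n idx"
    by (simp add: Rt_series_def f1_def f2_def A2_def B2_def C2_def p2 z_def p_def fps_const_power
        flip: fps_const_sub fps_const_1_eq_1)
  have prod: "(\<Sum>d\<in>UNIV. ?C (M $ r $ d) * ?C (N $ d $ c)) = ?C ((M ** N) $ r $ c)"
    for M N :: "Cq ^ ('n idx \<times> 'n idx) ^ ('n idx \<times> 'n idx)" and r c
    by (simp add: matrix_matrix_mult_def fps_const_sum fps_const_mult)
  have "(R_series ** Rt_series) $ r $ c = (if r = c then ?C (p\<^sup>2 * z\<^sup>2) else 0)" for r c :: "'n idx \<times> 'n idx"
  proof -
    define k where "k = K_mat $ r $ c"
    define e :: Cq where "e = (if r = c then 1 else 0)"
    define u where "u = (R_mat ** P_mat) $ r $ c"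
    have e: "(mat 1 :: Cq ^ ('n idx \<times> 'n idx) ^ ('n idx \<times> 'n idx)) $ r $ c = e"
      by (simp add: mat_def e_def)
    have m1: "(R_mat ** Rbar_mat) $ r $ c = e" "(P_mat ** P_mat) $ r $ c = e"
      by (simp_all only: R_Rbar P_P e)
    have m2: "(P_mat ** Rbar_mat) $ r $ c = u + h * k - h * e"
      unfolding P_Rbar by (simp add: e u_def k_def h_def)
    have m3: "(R_mat ** flip Q_mat) $ r $ c = - (z * qq) * k"
      unfolding R_flip_Q z_def xi_eq k_def by simp
    have m4: "(Q_mat ** Rbar_mat) $ r $ c = - (inverse z * p) * k"
      unfolding Q_Rbar z_def p_def xi_eq k_def by simp
    have m5: "(Q_mat ** flip Q_mat) $ r $ c = - t * k"
    proof -
      have "h * (Q_mat ** flip Q_mat) $ r $ c = h * (- t * k)"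
        unfolding h_def Q_flip_Q xi_eq[symmetric] using h0
        by (simp add: t_def z_def p_def h_def k_def)
      then show ?thesis by (rule mult_left_cancel[OF h0, THEN iffD1])
    qed
    have m6: "(P_mat ** flip Q_mat) $ r $ c = k" "(Q_mat ** P_mat) $ r $ c = k"
      by (simp_all only: P_flip_Q K_mat_def[symmetric] k_def)
    have pq: "?C qq * ?C p = 1" using qq_nonzero by (simp add: p_def)
    have zy: "?C z * ?C (inverse z) = 1" using z0 by simp
    have ht: "(?C qq - ?C p) * ?C t = ?C (inverse z) * ?C p - (?C qq - ?C p) - ?C z * ?C qq"
      using h0 unfolding h_def p_def[symmetric] by (simp add: t_def h_def p_def[symmetric])
    have h: "?C h = ?C qq - ?C p" by (simp add: h_def p_def)
    have "(R_series ** Rt_series) $ r $ c = f1 * f2 *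
      (\<Sum>d\<in>UNIV. (A1 * ?C (R_mat $ r $ d) + B1 * ?C (P_mat $ r $ d) + C1 * ?C (Q_mat $ r $ d)) *
         (A2 * ?C (Rbar_mat $ d $ c) + B2 * ?C (flip Q_mat $ d $ c) + C2 * ?C (P_mat $ d $ c)))"
      unfolding matrix_matrix_mult_def vec_lambda_beta Rs Rt sum_distrib_left by (simp add: mult_ac)
    also have "\<dots> = f1 * f2 * (A1 * A2 * ?C e + A1 * B2 * ?C (- (z * qq) * k) + A1 * C2 * ?C u
      + B1 * A2 * ?C (u + h * k - h * e) + B1 * B2 * ?C k + B1 * C2 * ?C e
      + C1 * A2 * ?C (- (inverse z * p) * k) + C1 * B2 * ?C (- t * k) + C1 * C2 * ?C k)"
      unfolding sum_triple_expand prod m1 m2 m3 m4 m5 m6 u_def[symmetric] ..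
    also have "\<dots> = f1 * f2 * ((A1 * A2 - (?C qq - ?C p) * (B1 * A2) + B1 * C2) * ?C e
      + (- (?C z * ?C qq) * (A1 * B2) + (?C qq - ?C p) * (B1 * A2) + B1 * B2
         - ?C (inverse z) * ?C p * (C1 * A2) - ?C t * (C1 * B2) + C1 * C2) * ?C k
      + (A1 * C2 + B1 * A2) * ?C u)"
      unfolding h[symmetric]
      by (simp only: fps_const_mult[symmetric] fps_const_add[symmetric] fps_const_sub[symmetric]
          fps_const_neg[symmetric]) (simp add: algebra_simps
          del: fps_const_mult fps_const_add fps_const_sub fps_const_neg)
    \<comment> \<open>The coefficient of \<open>R_mat ** P_mat\<close>: one part from R times P, the
      other from the skein relation for P times \<open>Rbar_mat\<close>.\<close>
    also have "A1 * C2 + B1 * A2 = 0"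
      unfolding A1_def C2_def B1_def A2_def by (simp add: algebra_simps)
    also have "- (?C z * ?C qq) * (A1 * B2) + (?C qq - ?C p) * (B1 * A2) + B1 * B2
         - ?C (inverse z) * ?C p * (C1 * A2) - ?C t * (C1 * B2) + C1 * C2 = 0"
      unfolding A1_def A2_def B1_def B2_def C1_def C2_def
      by (rule crossing_scalar_K[OF pq zy ht])
    also have "A1 * A2 - (?C qq - ?C p) * (B1 * A2) + B1 * C2 = (?C p)\<^sup>2 * (?C z)\<^sup>2 *
       ((1 - ?X * (?C p)\<^sup>2) * (1 - ?X * (?C qq)\<^sup>2) * (1 - ?X * ?C z) * (1 - ?X * ?C (inverse z)))"
      unfolding A1_def A2_def B1_def C2_def
      by (rule crossing_scalar_one[OF pq zy])
    also have "f1 * f2 * ((?C p)\<^sup>2 * (?C z)\<^sup>2 *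
       ((1 - ?X * (?C p)\<^sup>2) * (1 - ?X * (?C qq)\<^sup>2) * (1 - ?X * ?C z) * (1 - ?X * ?C (inverse z))) * ?C e
       + 0 * ?C k + 0 * ?C u) = (?C p)\<^sup>2 * (?C z)\<^sup>2 * ?C e * (f1 * f2 *
       ((1 - ?X * (?C p)\<^sup>2) * (1 - ?X * (?C qq)\<^sup>2) * (1 - ?X * ?C z) * (1 - ?X * ?C (inverse z))))"
      by (simp only: mult_zero_left add_0_right mult_ac)
    also have "\<dots> = (if r = c then ?C (p\<^sup>2 * z\<^sup>2) else 0)"
      unfolding f12 by (simp add: e_def fps_const_power)
    finally show ?thesis .
  qed
  then show ?thesis by (simp add: vec_eq_iff mat_def p_def z_def)
qed

section \<open>Three tensor factors\<close>

definition leg1 :: "'a::zero ^ 'i ^ 'i \<Rightarrow> 'a ^ ('i::finite \<times> 'i) ^ ('i \<times> 'i)" where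
  "leg1 A = (\<chi> r c. if snd r = snd c then A $ fst r $ fst c else 0)"

definition leg2 :: "'a::zero ^ 'i ^ 'i \<Rightarrow> 'a ^ ('i::finite \<times> 'i) ^ ('i \<times> 'i)" where
  "leg2 A = (\<chi> r c. if fst r = fst c then A $ snd r $ snd c else 0)"

text \<open>A triple of indices labels three tensor factors. Nesting places a single matrix:
  \<open>legs13 (leg1 A)\<close> acts on the first factor, \<open>legs23 (leg1 A)\<close> on the
  second, and \<open>legs13 (leg2 C)\<close> or \<open>legs23 (leg2 C)\<close> on the third.\<close>

definition legs13 :: "'a::zero ^ ('i \<times> 'i) ^ ('i \<times> 'i) \<Rightarrow> 'a ^ ('i::finite \<times> 'i \<times> 'i) ^ ('i \<times> 'i \<times> 'i)" where
  "legs13 M = (\<chi> r c. if fst (snd r) = fst (snd c)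
     then M $ (fst r, snd (snd r)) $ (fst c, snd (snd c)) else 0)"

definition legs23 :: "'a::zero ^ ('i \<times> 'i) ^ ('i \<times> 'i) \<Rightarrow> 'a ^ ('i::finite \<times> 'i \<times> 'i) ^ ('i \<times> 'i \<times> 'i)" where
  "legs23 M = (\<chi> r c. if fst r = fst c then M $ snd r $ snd c else 0)"

lemma leg_nth:
  "leg1 A $ (a, b) $ (c, d) = (if b = d then A $ a $ c else 0)"
  "leg2 A $ (a, b) $ (c, d) = (if a = c then A $ b $ d else 0)"
  by (simp_all add: leg1_def leg2_def)

lemma legs_nth:
  "legs13 M $ (i, j, k) $ (a, b, c) = (if j = b then M $ (i, k) $ (a, c) else 0)"
  "legs23 M $ (i, j, k) $ (a, b, c) = (if i = a then M $ (j, k) $ (b, c) else 0)"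
  by (simp_all add: legs13_def legs23_def)

lemma legs13_row:
  fixes M :: "'a::semiring_1 ^ ('i::finite \<times> 'i) ^ ('i \<times> 'i)"
  shows "(legs13 M ** X) $ (i, j, k) $ l = (\<Sum>a\<in>UNIV. \<Sum>c\<in>UNIV. M $ (i, k) $ (a, c) * X $ (a, j, c) $ l)"
proof -
  have "(legs13 M ** X) $ (i, j, k) $ l = (\<Sum>a\<in>UNIV. \<Sum>b\<in>UNIV. \<Sum>c\<in>UNIV.
    if b = j then M $ (i, k) $ (a, c) * X $ (a, j, c) $ l else 0)"
    unfolding matrix_matrix_mult_def vec_lambda_beta sum_pair legs_nth
    by (intro sum.cong refl) auto
  also have "\<dots> = (\<Sum>a\<in>UNIV. \<Sum>b\<in>UNIV. if b = j then \<Sum>c\<in>UNIV. M $ (i, k) $ (a, c) * X $ (a, j, c) $ l else 0)"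
    by (intro sum.cong refl) auto
  finally show ?thesis by simp
qed

lemma legs23_row:
  fixes M :: "'a::semiring_1 ^ ('i::finite \<times> 'i) ^ ('i \<times> 'i)"
  shows "(legs23 M ** X) $ (i, j, k) $ l = (\<Sum>b\<in>UNIV. \<Sum>c\<in>UNIV. M $ (j, k) $ (b, c) * X $ (i, b, c) $ l)"
proof -
  have "(legs23 M ** X) $ (i, j, k) $ l = (\<Sum>a\<in>UNIV. if a = i then
      \<Sum>b\<in>UNIV. \<Sum>c\<in>UNIV. M $ (j, k) $ (b, c) * X $ (i, b, c) $ l else 0)"
    unfolding matrix_matrix_mult_def vec_lambda_beta sum_pair legs_nth
    by (intro sum.cong refl) auto
  then show ?thesis by simp
qed

lemma legs_mult:
  fixes M N :: "'a::semiring_1 ^ ('i::finite \<times> 'i) ^ ('i \<times> 'i)"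
  shows "legs13 (M ** N) = legs13 M ** legs13 N" "legs23 (M ** N) = legs23 M ** legs23 N"
proof -
  have "legs13 (M ** N) $ (i, j, k) $ (a, b, c) = (legs13 M ** legs13 N) $ (i, j, k) $ (a, b, c)"
    "legs23 (M ** N) $ (i, j, k) $ (a, b, c) = (legs23 M ** legs23 N) $ (i, j, k) $ (a, b, c)"
    for i j k a b c
    unfolding legs13_row legs23_row legs_nth by (simp_all add: matrix_matrix_mult_def sum_pair)
  then show "legs13 (M ** N) = legs13 M ** legs13 N" "legs23 (M ** N) = legs23 M ** legs23 N"
    by (simp_all add: vec_eq_iff split_paired_all)
qed

lemma legs_leg1_row:
  fixes A :: "'a::semiring_1 ^ 'i::finite ^ 'i"
  shows "(legs13 (leg1 A) ** X) $ (i, j, k) $ l = (\<Sum>a\<in>UNIV. A $ i $ a * X $ (a, j, k) $ l)"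
    "(legs23 (leg1 A) ** X) $ (i, j, k) $ l = (\<Sum>b\<in>UNIV. A $ j $ b * X $ (i, b, k) $ l)"
proof -
  have "(\<Sum>c\<in>UNIV. leg1 A $ (i, k) $ (a, c) * Y c) = (\<Sum>c\<in>UNIV. if c = k then A $ i $ a * Y k else 0)"
    for i a :: 'i and Y
    by (intro sum.cong refl) (auto simp: leg_nth)
  then have *: "(\<Sum>c\<in>UNIV. leg1 A $ (i, k) $ (a, c) * Y c) = A $ i $ a * Y k" for i a :: 'i and Y
    by simp
  show "(legs13 (leg1 A) ** X) $ (i, j, k) $ l = (\<Sum>a\<in>UNIV. A $ i $ a * X $ (a, j, k) $ l)"
    "(legs23 (leg1 A) ** X) $ (i, j, k) $ l = (\<Sum>b\<in>UNIV. A $ j $ b * X $ (i, b, k) $ l)"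
    unfolding legs13_row legs23_row * by simp_all
qed

lemma legs_leg2: "legs13 (leg2 C) = legs23 (leg2 C)"
  by (auto simp: vec_eq_iff split_paired_all legs_nth leg_nth)

lemma legs_leg2_row:
  fixes C :: "'a::semiring_1 ^ 'i::finite ^ 'i"
  shows "(legs13 (leg2 C) ** X) $ (i, j, k) $ l = (\<Sum>m\<in>UNIV. C $ k $ m * X $ (i, j, m) $ l)"
proof -
  have "(\<Sum>a\<in>UNIV. \<Sum>m\<in>UNIV. leg2 C $ (i, k) $ (a, m) * Y a m)
    = (\<Sum>a\<in>UNIV. if a = i then \<Sum>m\<in>UNIV. C $ k $ m * Y i m else 0)" for Y
    by (intro sum.cong refl) (auto simp: leg_nth)
  then show ?thesis unfolding legs13_row by simp
qed

text \<open>Over a noncommutative ring, acting on disjoint factors is not enough for two matrices to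
  commute. It suffices that the entries of one of them are central, as those of the R-matrix
  are.\<close>

lemma legs_commute:
  fixes M :: "'a::semiring_1 ^ ('i::finite \<times> 'i) ^ ('i \<times> 'i)"
  assumes "\<And>r c x. M $ r $ c * x = x * M $ r $ c"
  shows "legs23 M ** legs13 (leg1 A) = legs13 (leg1 A) ** legs23 M"
    "legs13 M ** legs23 (leg1 A) = legs23 (leg1 A) ** legs13 M"
proof -
  have "(legs23 M ** legs13 (leg1 A)) $ (i, j, k) $ (a, b, c) = (legs13 (leg1 A) ** legs23 M) $ (i, j, k) $ (a, b, c)"
    for i j k a b c
  proof -
    have "(legs23 M ** legs13 (leg1 A)) $ (i, j, k) $ (a, b, c) =
      (\<Sum>b'\<in>UNIV. \<Sum>c'\<in>UNIV. if b' = b \<and> c' = c then M $ (j, k) $ (b, c) * A $ i $ a else 0)"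
      unfolding legs23_row by (intro sum.cong refl) (auto simp: legs_nth leg_nth)
    also have "\<dots> = M $ (j, k) $ (b, c) * A $ i $ a"
      by (subst double_sum_UNIV_single[of _ b c]) (auto split: if_splits)
    also have "\<dots> = (\<Sum>a'\<in>UNIV. if a' = a then A $ i $ a * M $ (j, k) $ (b, c) else 0)"
      by (simp add: assms)
    also have "\<dots> = (legs13 (leg1 A) ** legs23 M) $ (i, j, k) $ (a, b, c)"
      unfolding legs_leg1_row by (intro sum.cong refl) (auto simp: legs_nth)
    finally show ?thesis .
  qed
  then show "legs23 M ** legs13 (leg1 A) = legs13 (leg1 A) ** legs23 M"
    by (simp add: vec_eq_iff split_paired_all)
  have "(legs13 M ** legs23 (leg1 A)) $ (i, j, k) $ (a, b, c) = (legs23 (leg1 A) ** legs13 M) $ (i, j, k) $ (a, b, c)"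
    for i j k a b c
  proof -
    have "(legs13 M ** legs23 (leg1 A)) $ (i, j, k) $ (a, b, c) =
      (\<Sum>a'\<in>UNIV. \<Sum>c'\<in>UNIV. if a' = a \<and> c' = c then M $ (i, k) $ (a, c) * A $ j $ b else 0)"
      unfolding legs13_row by (intro sum.cong refl) (auto simp: legs_nth leg_nth)
    also have "\<dots> = M $ (i, k) $ (a, c) * A $ j $ b"
      by (subst double_sum_UNIV_single[of _ a c]) (auto split: if_splits)
    also have "\<dots> = (\<Sum>b'\<in>UNIV. if b' = b then A $ j $ b * M $ (i, k) $ (a, c) else 0)"
      by (simp add: assms)
    also have "\<dots> = (legs23 (leg1 A) ** legs13 M) $ (i, j, k) $ (a, b, c)"
      unfolding legs_leg1_row by (intro sum.cong refl) (auto simp: legs_nth)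
    finally show ?thesis .
  qed
  then show "legs13 M ** legs23 (leg1 A) = legs23 (leg1 A) ** legs13 M"
    by (simp add: vec_eq_iff split_paired_all)
qed

section \<open>The fusion argument\<close>

definition lscale :: "'a::times \<Rightarrow> 'a ^ 'i ^ 'j \<Rightarrow> 'a ^ 'i ^ 'j" where
  "lscale x M = (\<chi> r c. x * M $ r $ c)"

lemma mult_lscale:
  fixes M :: "'a::semiring_1 ^ 'i::finite ^ 'j::finite"
  assumes "\<And>r c. M $ r $ c * x = x * M $ r $ c"
  shows "M ** lscale x N = lscale x (M ** N)"
proof -
  have "M $ r $ d * (x * N $ d $ c) = x * (M $ r $ d * N $ d $ c)" for r d c
    using assms[of r d] by (metis mult.assoc)
  then show ?thesis by (simp add: vec_eq_iff lscale_def matrix_matrix_mult_def sum_distrib_left)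
qed

lemma legs_central:
  fixes M :: "'a::semiring_1 ^ ('i::finite \<times> 'i) ^ ('i \<times> 'i)"
  assumes "\<And>r c. M $ r $ c * x = x * M $ r $ c"
  shows "legs13 M $ r $ c * x = x * legs13 M $ r $ c" "legs23 M $ r $ c * x = x * legs23 M $ r $ c"
  using assms by (auto simp: legs13_def legs23_def)

text \<open>The vector \<open>w\<close> in the first two factors, tensored with the identity of the
  third. Keeping the third factor open makes this a rectangular matrix, and
  \<open>leg2_pairing\<close> can move a matrix on the third factor to its right.\<close>

definition pairing :: "('n::finite idx \<Rightarrow> 'a::zero) \<Rightarrow> 'a ^ 'n idx ^ ('n idx \<times> 'n idx \<times> 'n idx)" where
  "pairing w = (\<chi> r l. if fst (snd r) = opp (fst r) \<and> snd (snd r) = l then w (fst r) else 0)"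

lemma pairing_nth: "pairing w $ (i, j, k) $ l = (if j = opp i \<and> k = l then w i else 0)"
  by (simp add: pairing_def)

context
  fixes w u :: "'n::finite idx \<Rightarrow> 'a::ring_1" and g :: 'a
    and A B C :: "'a ^ 'n idx ^ 'n idx" and Z :: 'a
    and Ra Ra' Rb Rb' :: "'a ^ ('n idx \<times> 'n idx) ^ ('n idx \<times> 'n idx)"
  assumes w: "\<And>i x. w i * x = x * w i" and g: "\<And>x. g * x = x * g"
    and unit: "\<And>i. g * w i * u i = 1"
    and Z: "legs13 (leg1 A) ** (legs23 (leg1 B) ** pairing w) = lscale Z (pairing w)"
    and R: "\<And>r c x. Ra $ r $ c * x = x * Ra $ r $ c" "\<And>r c x. Rb $ r $ c * x = x * Rb $ r $ c"
      "\<And>r c x. Ra' $ r $ c * x = x * Ra' $ r $ c" "\<And>r c x. Rb' $ r $ c * x = x * Rb' $ r $ c"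
begin

lemma leg2_pairing: "legs13 (leg2 C) ** pairing w = pairing w ** C"
proof -
  have "(legs13 (leg2 C) ** pairing w) $ (i, j, k) $ l = (pairing w ** C) $ (i, j, k) $ l" for i j k l
  proof -
    have "(legs13 (leg2 C) ** pairing w) $ (i, j, k) $ l
      = (\<Sum>m\<in>UNIV. if m = l then if j = opp i then C $ k $ l * w i else 0 else 0)"
      unfolding legs_leg2_row pairing_nth by (intro sum.cong refl) auto
    also have "\<dots> = (\<Sum>m\<in>UNIV. if m = k then if j = opp i then w i * C $ k $ l else 0 else 0)"
      by (simp add: w)
    also have "\<dots> = (pairing w ** C) $ (i, j, k) $ l"
      unfolding matrix_matrix_mult_def vec_lambda_beta pairing_nth by (intro sum.cong refl) auto
    finally show ?thesis .
  qed
  then show ?thesis by (simp add: vec_eq_iff split_paired_all)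
qed

text \<open>A single row \<open>(i, opp i, k)\<close> suffices: the central factor
  \<open>g * w i\<close> is moved to the end and cancelled by its right inverse
  \<open>u i\<close>.\<close>

lemma commute_of_pairing:
  assumes "legs13 (leg2 C) ** lscale g (lscale Z (pairing w)) = lscale Z (lscale g (pairing w)) ** C"
  shows "Z * C $ k $ l = C $ k $ l * Z"
proof -
  fix i :: "'n idx"
  have "(legs13 (leg2 C) ** lscale g (lscale Z (pairing w))) $ (i, opp i, k) $ l
    = (\<Sum>m\<in>UNIV. if m = l then C $ k $ l * (g * (Z * w i)) else 0)"
    unfolding legs_leg2_row lscale_def vec_lambda_beta pairing_nth by (intro sum.cong refl) auto
  moreover have "(lscale Z (lscale g (pairing w)) ** C) $ (i, opp i, k) $ l
    = (\<Sum>m\<in>UNIV. if m = k then Z * (g * w i) * C $ k $ l else 0)"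
    unfolding matrix_matrix_mult_def lscale_def vec_lambda_beta pairing_nth by (intro sum.cong refl) auto
  ultimately have "C $ k $ l * (g * (Z * w i)) = Z * (g * w i) * C $ k $ l"
    using assms by simp
  moreover have "C $ k $ l * (g * (Z * w i)) = C $ k $ l * Z * (g * w i)"
    by (metis g mult.assoc)
  moreover have "Z * (g * w i) * C $ k $ l = Z * C $ k $ l * (g * w i)"
    by (metis g w mult.assoc)
  ultimately have "C $ k $ l * Z * (g * w i) * u i = Z * C $ k $ l * (g * w i) * u i" by simp
  then show ?thesis using unit[of i] by (simp add: mult.assoc)
qed

text \<open>\<open>C\<close> on the third factor passes \<open>A\<close> and \<open>B\<close> by one
  exchange relation each. The primed crossing identity creates the R-matrices on the right out of
  \<open>g\<close>, and the unprimed one turns them back into the same \<open>g\<close> on the left;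
  so the primed and unprimed arguments may differ.\<close>

lemma fusion_commute:
  assumes rel: "Ra ** leg1 A ** leg2 C = leg2 C ** leg1 A ** Ra'" "Rb ** leg1 B ** leg2 C = leg2 C ** leg1 B ** Rb'"
    and cr: "legs13 Ra ** (legs23 Rb ** pairing w) = lscale g (pairing w)"
      "legs13 Ra' ** (legs23 Rb' ** pairing w) = lscale g (pairing w)"
  shows "Z * C $ k $ l = C $ k $ l * Z"
proof (rule commute_of_pairing)
  let ?A = "legs13 (leg1 A)" and ?B = "legs23 (leg1 B)" and ?C = "legs13 (leg2 C)"
  note as = matrix_mul_assoc[symmetric]
  have r1: "legs13 Ra ** (?A ** ?C) = ?C ** (?A ** legs13 Ra')"
    using rel(1)[THEN arg_cong, of legs13] by (simp only: legs_mult as)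
  have r2: "legs23 Rb ** (?B ** ?C) = ?C ** (?B ** legs23 Rb')"
    using rel(2)[THEN arg_cong, of legs23] by (simp only: legs_mult as legs_leg2)
  have gs: "legs23 (leg1 B) ** lscale g X = lscale g (legs23 (leg1 B) ** X)"
    "legs13 (leg1 A) ** lscale g X = lscale g (legs13 (leg1 A) ** X)"
    for X :: "'a ^ 'n idx ^ ('n idx \<times> 'n idx \<times> 'n idx)"
    by (rule mult_lscale, simp add: g)+
  have "?C ** lscale g (lscale Z (pairing w)) = ?C ** (?A ** (?B ** (legs13 Ra' ** (legs23 Rb' ** pairing w))))"
    unfolding cr gs Z ..
  also have "\<dots> = ?C ** (?A ** ((?B ** legs13 Ra') ** (legs23 Rb' ** pairing w)))"
    by (simp only: as)
  also have "\<dots> = (?C ** (?A ** legs13 Ra')) ** (?B ** (legs23 Rb' ** pairing w))"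
    unfolding legs_commute(2)[OF R(3), symmetric] by (simp only: as)
  also have "\<dots> = legs13 Ra ** (?A ** ((?C ** (?B ** legs23 Rb')) ** pairing w))"
    unfolding r1[symmetric] by (simp only: as)
  also have "\<dots> = legs13 Ra ** ((?A ** legs23 Rb) ** (?B ** (?C ** pairing w)))"
    unfolding r2[symmetric] by (simp only: as)
  also have "\<dots> = legs13 Ra ** (legs23 Rb ** ((?A ** (?B ** pairing w)) ** C))"
    unfolding legs_commute(1)[OF R(2), symmetric] leg2_pairing by (simp only: as)
  also have "\<dots> = (legs13 Ra ** (legs23 Rb ** lscale Z (pairing w))) ** C"
    unfolding Z by (simp only: as)
  also have "legs23 Rb ** lscale Z (pairing w) = lscale Z (legs23 Rb ** pairing w)"
    by (rule mult_lscale) (rule legs_central[OF R(2)])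
  also have "legs13 Ra ** lscale Z (legs23 Rb ** pairing w) = lscale Z (legs13 Ra ** (legs23 Rb ** pairing w))"
    by (rule mult_lscale) (rule legs_central[OF R(1)])
  finally show "?C ** lscale g (lscale Z (pairing w)) = lscale Z (lscale g (pairing w)) ** C"
    unfolding cr .
qed

text \<open>The mirrored version, for exchange relations in which \<open>C\<close> originally stands
  in the first factor. The R-matrices then meet \<open>w\<close> in the opposite order, with the one
  on legs 2 and 3 outermost.\<close>

lemma fusion_commute':
  assumes rel: "Ra ** leg2 C ** leg1 A = leg1 A ** leg2 C ** Ra'" "Rb ** leg2 C ** leg1 B = leg1 B ** leg2 C ** Rb'"
    and cr: "legs23 Rb ** (legs13 Ra ** pairing w) = lscale g (pairing w)"
      "legs23 Rb' ** (legs13 Ra' ** pairing w) = lscale g (pairing w)"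
  shows "Z * C $ k $ l = C $ k $ l * Z"
proof -
  let ?A = "legs13 (leg1 A)" and ?B = "legs23 (leg1 B)" and ?C = "legs13 (leg2 C)"
  note as = matrix_mul_assoc[symmetric]
  have r1: "legs13 Ra ** (?C ** ?A) = ?A ** (?C ** legs13 Ra')"
    using rel(1)[THEN arg_cong, of legs13] by (simp only: legs_mult as)
  have r2: "legs23 Rb ** (?C ** ?B) = ?B ** (?C ** legs23 Rb')"
    using rel(2)[THEN arg_cong, of legs23] by (simp only: legs_mult as legs_leg2)
  have gs: "?C ** lscale g X = lscale g (?C ** X)" "?B ** lscale g X = lscale g (?B ** X)"
    "?A ** lscale g X = lscale g (?A ** X)"
    for X :: "'a ^ 'n idx ^ ('n idx \<times> 'n idx \<times> 'n idx)"
    by (rule mult_lscale, simp add: g)+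
  have zg: "Z * (g * x) = g * (Z * x)" for x
    by (simp only: mult.assoc[symmetric] g[of Z])
  have "lscale Z (lscale g (pairing w)) ** C = (lscale g (lscale Z (pairing w))) ** C"
    by (rule arg_cong[where f = "\<lambda>X. X ** C"]) (simp add: lscale_def vec_eq_iff zg)
  also have "\<dots> = (lscale g (?A ** (?B ** pairing w))) ** C"
    unfolding Z ..
  also have "\<dots> = lscale g (?A ** (?B ** (?C ** pairing w)))"
  proof -
    have "lscale g X ** C = lscale g (X ** C)" for X :: "'a ^ 'n idx ^ ('n idx \<times> 'n idx \<times> 'n idx)"
      by (simp add: vec_eq_iff lscale_def matrix_matrix_mult_def sum_distrib_left mult.assoc)
    then show ?thesis unfolding leg2_pairing by (simp only: as)
  qed
  also have "\<dots> = ?A ** (?B ** (?C ** (legs23 Rb' ** (legs13 Ra' ** pairing w))))"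
    unfolding cr gs ..
  also have "\<dots> = ?A ** ((?B ** (?C ** legs23 Rb')) ** (legs13 Ra' ** pairing w))"
    by (simp only: as)
  also have "\<dots> = (?A ** legs23 Rb) ** (?C ** ((?B ** legs13 Ra') ** pairing w))"
    unfolding r2[symmetric] by (simp only: as)
  also have "\<dots> = legs23 Rb ** ((?A ** (?C ** legs13 Ra')) ** (?B ** pairing w))"
    unfolding legs_commute(1)[OF R(2), symmetric] legs_commute(2)[OF R(3), symmetric] by (simp only: as)
  also have "\<dots> = legs23 Rb ** (legs13 Ra ** (?C ** lscale Z (pairing w)))"
    unfolding r1[symmetric] Z[symmetric] by (simp only: as)
  \<comment> \<open>\<open>C\<close> does not yet commute with \<open>Z\<close>, so
    \<open>leg2_pairing\<close> does not apply directly. The product is instead recorded by a matrix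
    with entries \<open>C $ k $ l * Z\<close>, to be compared with
    \<open>Z * C $ k $ l\<close>.\<close>
  also have "?C ** lscale Z (pairing w) = pairing w ** (\<chi> k l. C $ k $ l * Z)"
  proof -
    have "(?C ** lscale Z (pairing w)) $ (i, j, k) $ l = (pairing w ** (\<chi> k l. C $ k $ l * Z)) $ (i, j, k) $ l"
      for i j k l
    proof -
      have "(?C ** lscale Z (pairing w)) $ (i, j, k) $ l
        = (\<Sum>m\<in>UNIV. if m = l then if j = opp i then C $ k $ l * (Z * w i) else 0 else 0)"
        unfolding legs_leg2_row lscale_def vec_lambda_beta pairing_nth by (intro sum.cong refl) auto
      also have "\<dots> = (\<Sum>m\<in>UNIV. if m = k then if j = opp i then w i * (C $ k $ l * Z) else 0 else 0)"
        by (simp add: w mult.assoc)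
      also have "\<dots> = (pairing w ** (\<chi> k l. C $ k $ l * Z)) $ (i, j, k) $ l"
        unfolding matrix_matrix_mult_def vec_lambda_beta pairing_nth by (intro sum.cong refl) auto
      finally show ?thesis .
    qed
    then show ?thesis by (simp add: vec_eq_iff split_paired_all)
  qed
  also have "legs23 Rb ** (legs13 Ra ** (pairing w ** (\<chi> k l. C $ k $ l * Z)))
      = lscale g (pairing w) ** (\<chi> k l. C $ k $ l * Z)"
    unfolding cr(1)[symmetric] by (simp only: as)
  finally have "(lscale Z (lscale g (pairing w)) ** C) $ (i, opp i, k) $ l
      = (lscale g (pairing w) ** (\<chi> k l. C $ k $ l * Z)) $ (i, opp i, k) $ l" for i
    by simp
  moreover have "(lscale Z (lscale g (pairing w)) ** C) $ (i, opp i, k) $ l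
    = (\<Sum>m\<in>UNIV. if m = k then Z * C $ k $ l * (g * w i) else 0)" for i
    unfolding matrix_matrix_mult_def lscale_def vec_lambda_beta pairing_nth
    by (intro sum.cong refl) (auto, metis g w mult.assoc)
  moreover have "(lscale g (pairing w) ** (\<chi> k l. C $ k $ l * Z)) $ (i, opp i, k) $ l
    = (\<Sum>m\<in>UNIV. if m = k then C $ k $ l * Z * (g * w i) else 0)" for i
    unfolding matrix_matrix_mult_def lscale_def vec_lambda_beta pairing_nth
    by (intro sum.cong refl) (auto, metis g w mult.assoc)
  ultimately have e: "Z * C $ k $ l * (g * w i) = C $ k $ l * Z * (g * w i)" for i
    by simp
  fix i :: "'n idx"
  have "Z * C $ k $ l * (g * w i) * u i = C $ k $ l * Z * (g * w i) * u i" unfolding e ..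
  then show ?thesis using unit[of i] by (simp add: mult.assoc)
qed

end

section \<open>Evaluation of power series at monomials in two variables\<close>

text \<open>In \<open>'a fps fps\<close> the outer variable plays the role of X and the inner one
  that of Y; the three maps send f to \<open>f(X)\<close>, \<open>f(Y)\<close> and
  \<open>f(XY)\<close>.\<close>

definition eval_X :: "'a::ring_1 fps \<Rightarrow> 'a fps fps" where
  "eval_X f = Abs_fps (\<lambda>m. fps_const (fps_nth f m))"

definition eval_Y :: "'a::ring_1 fps \<Rightarrow> 'a fps fps" where
  "eval_Y f = fps_const f"

definition eval_XY :: "'a::ring_1 fps \<Rightarrow> 'a fps fps" where
  "eval_XY f = Abs_fps (\<lambda>m. fps_const (fps_nth f m) * fps_X ^ m)"

lemma eval_nth:
  "fps_nth (eval_X f) m = fps_const (fps_nth f m)"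
  "fps_nth (eval_XY f) m = fps_const (fps_nth f m) * fps_X ^ m"
  by (simp_all add: eval_X_def eval_XY_def)

definition coeff_hom :: "('a::ring_1 fps \<Rightarrow> 'a fps fps) \<Rightarrow> bool" where
  "coeff_hom E \<longleftrightarrow> (\<forall>f g. E (f + g) = E f + E g) \<and> (\<forall>f g. E (f * g) = E f * E g) \<and>
     (\<forall>c. E (fps_const c) = fps_const (fps_const c))"

lemma coeff_hom_eval:
  "coeff_hom (eval_X :: 'a::ring_1 fps \<Rightarrow> _)" "coeff_hom (eval_Y :: 'a fps \<Rightarrow> _)"
  "coeff_hom (eval_XY :: 'a fps \<Rightarrow> _)"
proof -
  show "coeff_hom (eval_X :: 'a fps \<Rightarrow> _)"
    by (auto simp: coeff_hom_def eval_nth fps_eq_iff fps_mult_nth fps_const_sum fps_sum_nth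
        fps_const_mult[symmetric] simp del: fps_const_mult)
  show "coeff_hom (eval_Y :: 'a fps \<Rightarrow> _)"
    by (simp add: coeff_hom_def eval_Y_def)
  have m: "eval_XY (f * g) = eval_XY f * eval_XY g" for f g :: "'a fps"
  proof (rule fps_ext)
    fix m
    have "fps_const (fps_nth f i * fps_nth g (m - i)) * fps_X ^ m
      = fps_const (fps_nth f i) * fps_X ^ i * (fps_const (fps_nth g (m - i)) * fps_X ^ (m - i))"
      if "i \<in> {0..m}" for i
    proof -
      have "fps_const (fps_nth f i) * fps_X ^ i * (fps_const (fps_nth g (m - i)) * fps_X ^ (m - i))
        = fps_const (fps_nth f i) * (fps_X ^ i * fps_const (fps_nth g (m - i))) * fps_X ^ (m - i)"
        by (simp only: mult.assoc)
      also have "\<dots> = fps_const (fps_nth f i) * fps_const (fps_nth g (m - i)) * (fps_X ^ i * fps_X ^ (m - i))"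
        unfolding fps_mult_fps_X_power_commute[of i "fps_const _"] by (simp only: mult.assoc)
      finally show ?thesis using that by (simp add: power_add[symmetric])
    qed
    then show "fps_nth (eval_XY (f * g)) m = fps_nth (eval_XY f * eval_XY g) m"
      by (simp add: eval_nth fps_mult_nth fps_const_sum sum_distrib_right)
  qed
  show "coeff_hom (eval_XY :: 'a fps \<Rightarrow> _)"
    unfolding coeff_hom_def m
    by (auto simp: eval_nth fps_eq_iff fps_const_add[symmetric] distrib_right simp del: fps_const_add)
qed

lemma coeff_hom_simps:
  assumes "coeff_hom E"
  shows "E (f + g) = E f + E g" "E (f * g) = E f * E g" "E (fps_const c) = fps_const (fps_const c)"
    "E 0 = 0" "E (sum h S) = (\<Sum>x\<in>S. E (h x))"
proof -
  show *: "E (f + g) = E f + E g" "E (f * g) = E f * E g" "E (fps_const c) = fps_const (fps_const c)" for f g c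
    using assms by (auto simp: coeff_hom_def)
  show z: "E 0 = 0" using *(3)[of 0] by simp
  show "E (sum h S) = (\<Sum>x\<in>S. E (h x))"
    by (induction S rule: infinite_finite_induct) (simp_all add: * z)
qed

text \<open>The coefficient of \<open>u\<^sup>p\<close> in a series in \<open>u\<close> or \<open>u\<^sup>-\<^sup>1\<close>.\<close>

fun signed_nth :: "pm \<Rightarrow> 'a::zero fps \<Rightarrow> int \<Rightarrow> 'a" where
  "signed_nth Plus f p = (if p \<ge> 0 then fps_nth f (nat p) else 0)"
| "signed_nth Minus f p = (if p \<le> 0 then fps_nth f (nat (- p)) else 0)"

text \<open>Substitutions for \<open>u/v\<close>, \<open>u\<close>, \<open>v\<close> (in this order) by monomials with nonnegative exponents in two
  variables, such that all the coefficients of \<open>R(u/v) L\<^sup>s\<^sub>1(u) L\<^sup>t\<^sub>2(v)\<close> are preserved.\<close>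

locale substitution =
  fixes s t :: pm and Er Es Et :: "'a::ring_1 fps \<Rightarrow> 'a fps fps"
  assumes hom: "coeff_hom Er" "coeff_hom Es" "coeff_hom Et"
    and central: "\<And>F H. (\<And>n x. fps_nth F n * x = x * fps_nth F n) \<Longrightarrow> Er F * H = H * Er F"
    and triple: "\<And>A B. \<exists>a b. \<forall>F G H.
      fps_nth (fps_nth (Er F * Es G * Et H) A) B =
        (\<Sum>k\<le>nat (\<bar>a\<bar> + \<bar>b\<bar>). fps_nth F k * signed_nth s G (a - int k) * signed_nth t H (b + int k)) \<and>
      fps_nth (fps_nth (Et H * Es G * Er F) A) B =
        (\<Sum>k\<le>nat (\<bar>a\<bar> + \<bar>b\<bar>). signed_nth t H (b + int k) * signed_nth s G (a - int k) * fps_nth F k)"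
    and separated: "\<And>F G m p. Es F * Et G = Et G * Es F \<Longrightarrow>
      fps_nth F m * fps_nth G p = fps_nth G p * fps_nth F m"

lemma fps_const_X_nth:
  fixes c d :: "'a::ring_1"
  shows "fps_nth (fps_const c * fps_X ^ i * H) B = (if B < i then 0 else c * fps_nth H (B - i))"
    "fps_nth (H * (fps_const c * fps_X ^ i)) B = (if B < i then 0 else fps_nth H (B - i) * c)"
proof -
  show "fps_nth (fps_const c * fps_X ^ i * H) B = (if B < i then 0 else c * fps_nth H (B - i))"
    by (simp add: mult.assoc fps_X_power_mult_nth)
  show "fps_nth (H * (fps_const c * fps_X ^ i)) B = (if B < i then 0 else fps_nth H (B - i) * c)"
    by (simp add: mult.assoc[symmetric] fps_X_power_mult_right_nth)
qed

lemma fps_const_X_commute: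
  "fps_const c * fps_X ^ i * fps_const d = fps_const (c * d :: 'a::ring_1) * fps_X ^ i"
  "fps_const d * (fps_const c * fps_X ^ i) = fps_const (d * c :: 'a::ring_1) * fps_X ^ i"
  "fps_const d * fps_const c * fps_X ^ i = fps_const (d * c :: 'a::ring_1) * fps_X ^ i"
proof -
  show "fps_const c * fps_X ^ i * fps_const d = fps_const (c * d :: 'a::ring_1) * fps_X ^ i"
    by (simp only: mult.assoc fps_mult_fps_X_power_commute[of i "fps_const d"])
      (simp add: mult.assoc[symmetric])
qed (simp_all add: mult.assoc[symmetric])

lemma fps_central:
  assumes "\<And>n x. fps_nth F n * x = x * fps_nth F n"
  shows "F * G = G * (F :: 'a::ring_1 fps)"
proof (rule fps_ext)
  fix n
  have "fps_nth (F * G) n = (\<Sum>i=0..n. fps_nth G (n - i) * fps_nth F i)"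
    by (simp add: fps_mult_nth assms)
  also have "\<dots> = (\<Sum>i=0..n. fps_nth G i * fps_nth F (n - i))"
    by (rule sum.reindex_bij_witness[of _ "\<lambda>i. n - i" "\<lambda>i. n - i"]) auto
  finally show "fps_nth (F * G) n = fps_nth (G * F) n" by (simp add: fps_mult_nth)
qed

lemma const_central:
  assumes "\<And>x. c * x = x * (c :: 'a::ring_1)"
  shows "fps_const c * G = G * fps_const c"
  by (rule fps_central) (simp add: assms)

lemma eval_central:
  assumes F: "\<And>n x. fps_nth F n * x = x * fps_nth F n"
  shows "eval_X F * H = H * eval_X F" "eval_Y F * H = H * eval_Y F" "eval_XY F * H = H * eval_XY F"
proof -
  show "eval_X F * H = H * eval_X F"
    by (rule fps_central) (unfold eval_nth, rule const_central, rule F)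
  show "eval_Y F * H = H * eval_Y F"
    unfolding eval_Y_def by (rule const_central) (rule fps_central, rule F)
  have c: "fps_const (fps_nth F n) * fps_X ^ n * x = x * (fps_const (fps_nth F n) * fps_X ^ n)" for n x
    by (metis const_central[OF F] fps_mult_fps_X_power_commute mult.assoc)
  show "eval_XY F * H = H * eval_XY F"
    by (rule fps_central) (unfold eval_nth, rule c)
qed

lemma sum_restrict:
  fixes f g :: "nat \<Rightarrow> 'a::comm_monoid_add"
  assumes "\<And>k. k \<le> m \<Longrightarrow> k \<le> n \<Longrightarrow> f k = g k" "\<And>k. k \<le> m \<Longrightarrow> n < k \<Longrightarrow> f k = 0"
    "\<And>k. k \<le> n \<Longrightarrow> m < k \<Longrightarrow> g k = 0"
  shows "(\<Sum>k=0..m. f k) = (\<Sum>k\<le>n. g k)"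
proof -
  have "(\<Sum>k=0..m. f k) = (\<Sum>k\<in>{..min m n}. f k)"
    by (rule sum.mono_neutral_right) (auto intro: assms)
  also have "\<dots> = (\<Sum>k\<in>{..min m n}. g k)" by (intro sum.cong) (auto intro: assms)
  also have "\<dots> = (\<Sum>k\<le>n. g k)" by (rule sum.mono_neutral_left) (auto intro: assms)
  finally show ?thesis .
qed

lemma fps_mult_nth_rev: "fps_nth (f * g) n = (\<Sum>i=0..n. fps_nth f (n - i) * fps_nth g i)"
  unfolding fps_mult_nth by (rule sum.reindex_bij_witness[of _ "\<lambda>i. n - i" "\<lambda>i. n - i"]) auto

text \<open>Here \<open>u = X\<close> and \<open>1/v = Y\<close>, so \<open>u/v = XY\<close>; the
  coefficient of \<open>X^A Y^B\<close> is that of \<open>u^A v^(-B)\<close>.\<close>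

lemma substitution_plus_minus: "substitution Plus Minus (eval_XY :: 'a::ring_1 fps \<Rightarrow> _) eval_X eval_Y"
proof
  show "eval_XY F * H = H * eval_XY F" if "\<And>n x. fps_nth F n * x = x * fps_nth F n" for F and H :: "'a fps fps"
    using that by (rule eval_central)
  show "\<exists>a b. \<forall>(F :: 'a fps) G H.
      fps_nth (fps_nth (eval_XY F * eval_X G * eval_Y H) A) B =
        (\<Sum>k\<le>nat (\<bar>a\<bar> + \<bar>b\<bar>). fps_nth F k * signed_nth Plus G (a - int k) * signed_nth Minus H (b + int k)) \<and>
      fps_nth (fps_nth (eval_Y H * eval_X G * eval_XY F) A) B =
        (\<Sum>k\<le>nat (\<bar>a\<bar> + \<bar>b\<bar>). signed_nth Minus H (b + int k) * signed_nth Plus G (a - int k) * fps_nth F k)"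
    for A B :: nat
  proof (rule exI[of _ "int A"], rule exI[of _ "- int B"], intro allI conjI)
    fix F G H :: "'a fps"
    have "fps_nth (fps_nth (eval_XY F * eval_X G * eval_Y H) A) B =
      (\<Sum>k=0..A. if B < k then 0 else fps_nth F k * fps_nth G (A - k) * fps_nth H (B - k))"
      unfolding eval_Y_def fps_mult_right_const_nth fps_mult_nth[of "eval_XY F"] eval_nth
        fps_const_X_commute sum_distrib_right fps_sum_nth fps_const_X_nth ..
    also have "\<dots> = (\<Sum>k\<le>nat (\<bar>int A\<bar> + \<bar>- int B\<bar>). fps_nth F k * signed_nth Plus G (int A - int k) * signed_nth Minus H (- int B + int k))"
      by (rule sum_restrict) (auto simp: nat_diff_distrib)
    finally show "fps_nth (fps_nth (eval_XY F * eval_X G * eval_Y H) A) B = \<dots>" .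
    have "fps_nth (fps_nth (eval_Y H * eval_X G * eval_XY F) A) B =
      (\<Sum>k=0..A. if B < k then 0 else fps_nth H (B - k) * (fps_nth G (A - k) * fps_nth F k))"
      unfolding eval_Y_def mult.assoc fps_mult_left_const_nth fps_mult_nth_rev[of "eval_X G"] eval_nth
        fps_const_X_commute sum_distrib_left fps_sum_nth fps_const_X_nth ..
    also have "\<dots> = (\<Sum>k\<le>nat (\<bar>int A\<bar> + \<bar>- int B\<bar>). signed_nth Minus H (- int B + int k) * signed_nth Plus G (int A - int k) * fps_nth F k)"
      by (rule sum_restrict) (auto simp: nat_diff_distrib mult.assoc)
    finally show "fps_nth (fps_nth (eval_Y H * eval_X G * eval_XY F) A) B = \<dots>" .
  qed
  show "fps_nth F m * fps_nth G p = fps_nth G p * fps_nth F m"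
    if "eval_X F * eval_Y G = eval_Y G * eval_X F" for F G :: "'a fps" and m p
    using arg_cong[OF that, of "\<lambda>f. fps_nth (fps_nth f m) p"] by (simp add: eval_Y_def eval_nth)
qed (simp_all add: coeff_hom_eval)

text \<open>Here \<open>u/v = X\<close> and \<open>v = Y\<close>, so \<open>u = XY\<close>; the
  coefficient of \<open>X^A Y^B\<close> is that of \<open>u^A v^(B-A)\<close>.\<close>

lemma substitution_plus_plus: "substitution Plus Plus (eval_X :: 'a::ring_1 fps \<Rightarrow> _) eval_XY eval_Y"
proof
  show "eval_X F * H = H * eval_X F" if "\<And>n x. fps_nth F n * x = x * fps_nth F n" for F and H :: "'a fps fps"
    using that by (rule eval_central)
  show "\<exists>a b. \<forall>(F :: 'a fps) G H.
      fps_nth (fps_nth (eval_X F * eval_XY G * eval_Y H) A) B =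
        (\<Sum>k\<le>nat (\<bar>a\<bar> + \<bar>b\<bar>). fps_nth F k * signed_nth Plus G (a - int k) * signed_nth Plus H (b + int k)) \<and>
      fps_nth (fps_nth (eval_Y H * eval_XY G * eval_X F) A) B =
        (\<Sum>k\<le>nat (\<bar>a\<bar> + \<bar>b\<bar>). signed_nth Plus H (b + int k) * signed_nth Plus G (a - int k) * fps_nth F k)"
    for A B :: nat
  proof (rule exI[of _ "int A"], rule exI[of _ "int B - int A"], intro allI conjI)
    fix F G H :: "'a fps"
    have "fps_nth (fps_nth (eval_X F * eval_XY G * eval_Y H) A) B =
      (\<Sum>k=0..A. if B < A - k then 0 else fps_nth F k * fps_nth G (A - k) * fps_nth H (B - (A - k)))"
      unfolding eval_Y_def fps_mult_right_const_nth fps_mult_nth[of "eval_X F"] eval_nth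
        fps_const_X_commute sum_distrib_right fps_sum_nth fps_const_X_nth ..
    also have "\<dots> = (\<Sum>k\<le>nat (\<bar>int A\<bar> + \<bar>int B - int A\<bar>). fps_nth F k * signed_nth Plus G (int A - int k) * signed_nth Plus H (int B - int A + int k))"
      by (rule sum_restrict) (auto simp: nat_diff_distrib intro!: arg_cong2[where f = "(*)"] arg_cong[where f = "fps_nth _"])
    finally show "fps_nth (fps_nth (eval_X F * eval_XY G * eval_Y H) A) B = \<dots>" .
    have "fps_nth (fps_nth (eval_Y H * eval_XY G * eval_X F) A) B =
      (\<Sum>k=0..A. if B < A - k then 0 else fps_nth H (B - (A - k)) * (fps_nth G (A - k) * fps_nth F k))"
      unfolding eval_Y_def mult.assoc[of "fps_const H"] fps_mult_left_const_nth fps_mult_nth_rev[of "eval_XY G"] eval_nth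
        fps_const_X_commute sum_distrib_left fps_sum_nth fps_const_X_nth ..
    also have "\<dots> = (\<Sum>k\<le>nat (\<bar>int A\<bar> + \<bar>int B - int A\<bar>). signed_nth Plus H (int B - int A + int k) * signed_nth Plus G (int A - int k) * fps_nth F k)"
      by (rule sum_restrict) (auto simp: nat_diff_distrib mult.assoc intro!: arg_cong2[where f = "(*)"] arg_cong[where f = "fps_nth _"])
    finally show "fps_nth (fps_nth (eval_Y H * eval_XY G * eval_X F) A) B = \<dots>" .
  qed
  \<comment> \<open>The product \<open>(XY)^m Y^p\<close> is \<open>X^m Y^(m+p)\<close>, and no
    other pair of exponents gives this monomial.\<close>
  show "fps_nth F m * fps_nth G p = fps_nth G p * fps_nth F m"
    if "eval_XY F * eval_Y G = eval_Y G * eval_XY F" for F G :: "'a fps" and m p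
    using arg_cong[OF that, of "\<lambda>f. fps_nth (fps_nth f m) (m + p)"]
    by (simp add: eval_Y_def eval_nth fps_const_X_nth)
qed (simp_all add: coeff_hom_eval)

text \<open>Here \<open>u/v = X\<close> and \<open>1/u = Y\<close>, so \<open>1/v = XY\<close>; the
  coefficient of \<open>X^A Y^B\<close> is that of \<open>u^(A-B) v^(-A)\<close>.\<close>

lemma substitution_minus_minus: "substitution Minus Minus (eval_X :: 'a::ring_1 fps \<Rightarrow> _) eval_Y eval_XY"
proof
  show "eval_X F * H = H * eval_X F" if "\<And>n x. fps_nth F n * x = x * fps_nth F n" for F and H :: "'a fps fps"
    using that by (rule eval_central)
  show "\<exists>a b. \<forall>(F :: 'a fps) G H.
      fps_nth (fps_nth (eval_X F * eval_Y G * eval_XY H) A) B =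
        (\<Sum>k\<le>nat (\<bar>a\<bar> + \<bar>b\<bar>). fps_nth F k * signed_nth Minus G (a - int k) * signed_nth Minus H (b + int k)) \<and>
      fps_nth (fps_nth (eval_XY H * eval_Y G * eval_X F) A) B =
        (\<Sum>k\<le>nat (\<bar>a\<bar> + \<bar>b\<bar>). signed_nth Minus H (b + int k) * signed_nth Minus G (a - int k) * fps_nth F k)"
    for A B :: nat
  proof (rule exI[of _ "int A - int B"], rule exI[of _ "- int A"], intro allI conjI)
    fix F G H :: "'a fps"
    have "fps_nth (fps_nth (eval_X F * eval_Y G * eval_XY H) A) B =
      (\<Sum>k=0..A. if B < A - k then 0 else fps_nth F k * fps_nth G (B - (A - k)) * fps_nth H (A - k))"
      unfolding eval_Y_def mult.assoc[of "eval_X F"] fps_mult_nth[of "eval_X F"] fps_mult_left_const_nth eval_nth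
        fps_sum_nth fps_const_X_nth
      by (intro sum.cong refl) (simp add: mult.assoc)
    also have "\<dots> = (\<Sum>k\<le>nat (\<bar>int A - int B\<bar> + \<bar>- int A\<bar>). fps_nth F k * signed_nth Minus G (int A - int B - int k) * signed_nth Minus H (- int A + int k))"
      by (rule sum_restrict) (auto simp: nat_diff_distrib intro!: arg_cong2[where f = "(*)"] arg_cong[where f = "fps_nth _"])
    finally show "fps_nth (fps_nth (eval_X F * eval_Y G * eval_XY H) A) B = \<dots>" .
    have "fps_nth (fps_nth (eval_XY H * eval_Y G * eval_X F) A) B =
      (\<Sum>k=0..A. if B < A - k then 0 else fps_nth H (A - k) * fps_nth G (B - (A - k)) * fps_nth F k)"
      unfolding eval_Y_def fps_mult_nth_rev[of _ "eval_X F"] fps_mult_right_const_nth eval_nth fps_sum_nth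
        fps_const_X_nth
      by (intro sum.cong refl) simp
    also have "\<dots> = (\<Sum>k\<le>nat (\<bar>int A - int B\<bar> + \<bar>- int A\<bar>). signed_nth Minus H (- int A + int k) * signed_nth Minus G (int A - int B - int k) * fps_nth F k)"
      by (rule sum_restrict) (auto simp: nat_diff_distrib mult.assoc intro!: arg_cong2[where f = "(*)"] arg_cong[where f = "fps_nth _"])
    finally show "fps_nth (fps_nth (eval_XY H * eval_Y G * eval_X F) A) B = \<dots>" .
  qed
  show "fps_nth F m * fps_nth G p = fps_nth G p * fps_nth F m"
    if "eval_Y F * eval_XY G = eval_XY G * eval_Y F" for F G :: "'a fps" and m p
    using arg_cong[OF that, of "\<lambda>f. fps_nth (fps_nth f p) (m + p)"]
    by (simp add: eval_Y_def eval_nth fps_const_X_nth)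
qed (simp_all add: coeff_hom_eval)

section \<open>The algebra U(R)\<close>

definition map_mat :: "('a \<Rightarrow> 'b) \<Rightarrow> 'a ^ 'i ^ 'j \<Rightarrow> 'b ^ 'i ^ 'j" where
  "map_mat f A = (\<chi> r c. f (A $ r $ c))"

lemma map_mat_nth [simp]: "map_mat f A $ r $ c = f (A $ r $ c)"
  by (simp add: map_mat_def)

lemma map_mat_mult:
  fixes A :: "'a::semiring_1 ^ 'i::finite ^ 'j::finite" and \<phi> :: "'a \<Rightarrow> 'b::semiring_1"
  assumes "\<And>x y. \<phi> (x * y) = \<phi> x * \<phi> y" "\<And>(h :: 'i \<Rightarrow> 'a) S. \<phi> (sum h S) = (\<Sum>x\<in>S. \<phi> (h x))"
  shows "map_mat \<phi> (A ** B) = map_mat \<phi> A ** map_mat \<phi> B"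
  by (simp add: vec_eq_iff matrix_matrix_mult_def assms)

lemma abs_UR_eqI: "relation x y \<Longrightarrow> abs_UR x = abs_UR y"
proof -
  assume "relation x y"
  then have "1 * (x - y) * 1 \<in> relation_ideal"
    unfolding relation_ideal_def by (intro two_sided_ideal.gen) blast
  then show ?thesis by (simp add: UR.abs_eq_iff rel_equiv_def)
qed

lemma abs_UR_hom:
  "abs_UR (x + y) = abs_UR x + abs_UR y" "abs_UR (x * y) = abs_UR x * abs_UR y"
  "abs_UR (0 :: 'n gen free_alg) = 0" "abs_UR (1 :: 'n gen free_alg) = 1" "abs_UR (x ^ n) = abs_UR x ^ n"
  "abs_UR (sum h S) = (\<Sum>x\<in>S. abs_UR (h x))"
  for x y :: "'n::finite gen free_alg" and h :: "'b \<Rightarrow> 'n gen free_alg"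
proof -
  show a: "abs_UR (x + y) = abs_UR x + abs_UR y" for x y :: "'n gen free_alg"
    by (simp add: plus_UR.abs_eq)
  show m: "abs_UR (x * y) = abs_UR x * abs_UR y" for x y :: "'n gen free_alg"
    by (simp add: times_UR.abs_eq)
  show z: "abs_UR (0 :: 'n gen free_alg) = 0" by (simp add: zero_UR.abs_eq)
  show o: "abs_UR (1 :: 'n gen free_alg) = 1" by (simp add: one_UR.abs_eq)
  show "abs_UR (x ^ n) = abs_UR x ^ n" by (induction n) (simp_all add: m o)
  show "abs_UR (sum h S) = (\<Sum>x\<in>S. abs_UR (h x))"
    by (induction S rule: infinite_finite_induct) (simp_all add: z a)
qed

lemma fscal_hom:
  "fscal (a + b) = fscal a + fscal b" "fscal (a * b) = fscal a * fscal b"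
  "fscal 1 = 1" "fscal 0 = 0"
  by (simp_all add: fscal_def single_add mult_single)

lemma fscal_commute: "fscal c * x = x * fscal c" for x :: "'g free_alg"
proof -
  have "fscal c * Poly_Mapping.single w a = Poly_Mapping.single w a * fscal c" for w :: "'g mon" and a
    by (simp add: fscal_def mult_single mult.commute)
  then show ?thesis
    by (subst (1 2) sum_of_singles[of x]) (simp add: sum_distrib_left sum_distrib_right)
qed

lemma scal_eq: "scal c = abs_UR (fscal c)"
  by (simp add: scal.abs_eq)

lemma ell_eq: "ell s i j m = abs_UR (fgen (LGen s i j m))"
  by (simp add: ell.abs_eq)

lemma scal_hom [simp]:
  "scal (a + b) = scal a + scal b" "scal (a * b) = scal a * scal b" "scal 1 = 1" "scal 0 = 0"
  by (simp_all add: scal_eq fscal_hom abs_UR_hom)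

lemma scal_sum: "scal (sum h S) = (\<Sum>x\<in>S. scal (h x))"
  by (induction S rule: infinite_finite_induct) simp_all

lemma scal_commute: "scal c * x = x * scal c"
proof (induction x rule: UR.abs_induct)
  case (1 y)
  then show ?case by (simp add: scal_eq abs_UR_hom[symmetric] fscal_commute)
qed

text \<open>Words in the generators span the algebra over the scalars, which are central.\<close>

lemma centerI:
  fixes z :: "'n::finite UR"
  assumes "\<And>g. z * abs_UR (fgen g) = abs_UR (fgen g) * z"
  shows "z \<in> center"
proof -
  have word: "z * abs_UR (Poly_Mapping.single (Mon w) 1) = abs_UR (Poly_Mapping.single (Mon w) 1) * z" for w
  proof (induction w)
    case Nil
    have "Poly_Mapping.single (Mon []) 1 = (1 :: 'n gen free_alg)"
      by (simp add: zero_mon_def[symmetric])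
    then show ?case by (simp add: abs_UR_hom)
  next
    case (Cons g w)
    have "Poly_Mapping.single (Mon (g # w)) 1 = fgen g * (Poly_Mapping.single (Mon w) 1 :: 'n gen free_alg)"
      by (simp add: fgen_def mult_single)
    then show ?case using Cons assms[of g] by (simp add: abs_UR_hom) (metis mult.assoc)
  qed
  have single: "z * abs_UR (Poly_Mapping.single w c) = abs_UR (Poly_Mapping.single w c) * z" for w c
  proof (cases w)
    case (Mon v)
    have "Poly_Mapping.single w c = fscal c * Poly_Mapping.single (Mon v) 1"
      by (simp add: fscal_def mult_single Mon)
    then have "abs_UR (Poly_Mapping.single w c) = scal c * abs_UR (Poly_Mapping.single (Mon v) 1)"
      by (simp add: abs_UR_hom scal_eq)
    then show ?thesis using word[of v] scal_commute[of c z] by (metis mult.assoc)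
  qed
  have "z * x = x * z" for x
  proof (induction x rule: UR.abs_induct)
    case (1 y)
    show ?case by (subst (1 2) sum_of_singles[of y])
      (simp add: abs_UR_hom sum_distrib_left sum_distrib_right single)
  qed
  then show ?thesis by (simp add: center_def)
qed

definition q_half :: "'n::finite UR" where "q_half = abs_UR (fgen QHalf)"
definition q_half_inv :: "'n::finite UR" where "q_half_inv = abs_UR (fgen QHalfInv)"

text \<open>The relations state centrality only for \<open>QHalf\<close>; for
  \<open>QHalfInv\<close> it follows because the inverse of a central element is central.\<close>

lemma q_half_commute: "q_half * x = x * q_half" "q_half_inv * x = x * q_half_inv"
  for x :: "'n::finite UR"
proof -
  have "q_half \<in> (center :: 'n UR set)"
    unfolding q_half_def by (rule centerI) (simp only: abs_UR_hom[symmetric] abs_UR_eqI[OF relation.intros(3)])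
  then show *: "q_half * x = x * q_half" for x :: "'n UR" by (simp add: center_def)
  have i: "q_half * q_half_inv = (1 :: 'n UR)" "q_half_inv * q_half = (1 :: 'n UR)"
    unfolding q_half_def q_half_inv_def abs_UR_hom[symmetric]
    by (rule abs_UR_eqI relation.intros)+
  have "q_half_inv * x = q_half_inv * (x * (q_half * q_half_inv))" by (simp add: i)
  also have "\<dots> = q_half_inv * (q_half * x) * q_half_inv" by (simp only: * mult.assoc)
  also have "\<dots> = x * q_half_inv" by (simp only: mult.assoc[symmetric] i) simp
  finally show "q_half_inv * x = x * q_half_inv" .
qed

text \<open>\<open>Phi x e f\<close> is \<open>f(exu)\<close>; the argument \<open>x\<close> will be \<open>1\<close> or \<open>q\<^sup>\<plusminus>\<^sup>c\<close>, and \<open>e\<close> is \<open>1\<close> or \<open>\<xi>\<^sup>\<plusminus>\<^sup>1\<close>.\<close>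

definition Phi :: "'n::finite UR \<Rightarrow> Cq \<Rightarrow> Cq fps \<Rightarrow> 'n UR fps" where
  "Phi x e f = Abs_fps (\<lambda>k. scal (e ^ k * fps_nth f k) * x ^ k)"

lemma Phi_nth: "fps_nth (Phi x e f) k = scal (e ^ k * fps_nth f k) * x ^ k"
  by (simp add: Phi_def)

lemma power_commute_central: "(\<And>y. x * y = y * x) \<Longrightarrow> x ^ k * y = y * (x ^ k :: 'a::ring_1)"
  by (induction k) (simp_all, metis mult.assoc)

text \<open>Centrality of \<open>x\<close> makes the substitution multiplicative and gives the
  R-matrix central coefficients even when its argument contains a power of
  \<open>q\<^sup>c\<close>.\<close>

lemma Phi_hom:
  assumes x: "\<And>y. x * y = y * x"
  shows "Phi x e (f + g) = Phi x e f + Phi x e g" "Phi x e (f * g) = Phi x e f * Phi x e g"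
    "Phi x e (fps_const c) = fps_const (scal c)"
    "fps_nth (Phi x e f) n * y = y * fps_nth (Phi x e f) n"
    "Phi x e (fps_compose f (fps_const d * fps_X)) = Phi x (e * d) f"
proof -
  show "Phi x e (f + g) = Phi x e f + Phi x e g"
    by (simp add: fps_eq_iff Phi_nth algebra_simps del: scal_hom(2))
  show "Phi x e (f * g) = Phi x e f * Phi x e g"
  proof (rule fps_ext)
    fix n
    have "scal (e ^ n * (fps_nth f i * fps_nth g (n - i))) * x ^ n
      = fps_nth (Phi x e f) i * fps_nth (Phi x e g) (n - i)" if "i \<in> {0..n}" for i
    proof -
      have "fps_nth (Phi x e f) i * fps_nth (Phi x e g) (n - i)
        = scal (e ^ i * fps_nth f i) * scal (e ^ (n - i) * fps_nth g (n - i)) * (x ^ i * x ^ (n - i))"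
      proof -
        have "fps_nth (Phi x e f) i * fps_nth (Phi x e g) (n - i)
          = scal (e ^ i * fps_nth f i) * (x ^ i * scal (e ^ (n - i) * fps_nth g (n - i))) * x ^ (n - i)"
          unfolding Phi_nth by (simp only: mult.assoc)
        then show ?thesis unfolding scal_commute[of _ "x ^ i", symmetric] by (simp only: mult.assoc)
      qed
      also have "\<dots> = scal (e ^ i * e ^ (n - i) * (fps_nth f i * fps_nth g (n - i))) * (x ^ i * x ^ (n - i))"
        by (simp only: scal_hom(2)[symmetric] mult_ac)
      finally show ?thesis using that by (simp add: power_add[symmetric] del: scal_hom)
    qed
    then show "fps_nth (Phi x e (f * g)) n = fps_nth (Phi x e f * Phi x e g) n"
      unfolding fps_mult_nth[of "Phi x e f"] Phi_nth[of x e "f * g"] fps_mult_nth[of f]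
        sum_distrib_left scal_sum sum_distrib_right by (intro sum.cong refl) simp
  qed
  show "Phi x e (fps_const c) = fps_const (scal c)"
    by (auto simp: fps_eq_iff Phi_nth)
  show "fps_nth (Phi x e f) n * y = y * fps_nth (Phi x e f) n"
  proof -
    have "fps_nth (Phi x e f) n * y = scal (e ^ n * fps_nth f n) * y * x ^ n"
      unfolding Phi_nth by (simp only: mult.assoc power_commute_central[of x, OF x])
    then show ?thesis unfolding Phi_nth scal_commute[of _ y] by (simp only: mult.assoc)
  qed
  show "Phi x e (fps_compose f (fps_const d * fps_X)) = Phi x (e * d) f"
    by (simp add: fps_eq_iff Phi_nth power_mult_distrib mult.assoc del: scal_hom)
qed

text \<open>\<open>L_mat\<close> stores the series for \<open>Minus\<close> in powers of
  \<open>1/u\<close>; indexing by the signed exponent \<open>p\<close> gives both signs the same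
  scaling factor \<open>c powi p\<close>.\<close>

lemma signed_nth_L_mat:
  "signed_nth s (L_mat s c $ i $ j) p = scal (c powi p) * abs_UR (l_coeff s i j p)"
proof (cases s)
  case Plus
  have "c ^ nat p = c powi p" if "p \<ge> 0" using that by (simp add: power_int_def)
  then show ?thesis using Plus by (simp add: L_mat_def ell_eq abs_UR_hom)
qed (simp add: L_mat_def ell_eq abs_UR_hom)

lemma relation_UR:
  fixes x y :: "'n::finite gen free_alg"
  assumes "s = t \<and> x = 1 \<and> y = 1 \<or> s = Plus \<and> t = Minus \<and> x = (fgen QHalf)\<^sup>2 \<and> y = (fgen QHalfInv)\<^sup>2"
  shows "(\<Sum>k\<le>nat (\<bar>a\<bar> + \<bar>b\<bar>). map_mat abs_UR (R_coeff x k) ** map_mat abs_UR (L1_coeff s (a - int k)) ** map_mat abs_UR (L2_coeff t (b + int k)))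
    = (\<Sum>k\<le>nat (\<bar>a\<bar> + \<bar>b\<bar>). map_mat abs_UR (L2_coeff t (b + int k)) ** map_mat abs_UR (L1_coeff s (a - int k)) ** map_mat abs_UR (R_coeff y k))"
proof -
  have st: "s = Plus \<or> t = Minus" using assms by (cases s) auto
  have "relation (RLL_coeff x s t a b $ r $ c) (LLR_coeff y s t a b $ r $ c)" for r c
    using assms relation.intros(9,10) by blast
  then have "map_mat abs_UR (RLL_coeff x s t a b) = map_mat abs_UR (LLR_coeff y s t a b)"
    by (simp add: vec_eq_iff abs_UR_eqI)
  moreover have "map_mat abs_UR (sum h S) = (\<Sum>k\<in>S. map_mat abs_UR (h k))"
    for h :: "nat \<Rightarrow> 'n gen free_alg ^ ('n idx \<times> 'n idx) ^ ('n idx \<times> 'n idx)" and S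
    by (simp add: vec_eq_iff abs_UR_hom)
  moreover have "map_mat abs_UR (A ** B) = map_mat abs_UR A ** map_mat abs_UR B"
    for A B :: "'n gen free_alg ^ ('n idx \<times> 'n idx) ^ ('n idx \<times> 'n idx)"
    by (rule map_mat_mult) (simp_all add: abs_UR_hom)
  ultimately show ?thesis unfolding RLL_coeff_finite[OF st] by simp
qed


section \<open>The exchange relations as identities between matrices of series\<close>

lemma scal_triple:
  "scal u * X * (scal v * Y) * (scal w * Z) = scal (u * v * w) * (X * Y * Z)"
proof -
  have "scal u * X * (scal v * Y) * (scal w * Z) = scal u * (X * scal v) * (Y * scal w) * Z"
    by (simp only: mult.assoc)
  also have "\<dots> = scal u * scal v * (X * scal w) * Y * Z"
    unfolding scal_commute[of v X, symmetric] scal_commute[of w Y, symmetric] by (simp only: mult.assoc)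
  also have "\<dots> = scal (u * v * w) * (X * Y * Z)"
    unfolding scal_commute[of w X, symmetric] by (simp only: mult.assoc scal_hom)
  finally show ?thesis .
qed

lemma Phi_R_series_nth:
  "fps_nth (Phi (abs_UR x) e (R_series $ r $ c)) k = scal (e ^ k) * abs_UR (R_coeff x k $ r $ c)"
  by (simp add: Phi_nth R_coeff_def abs_UR_hom scal_eq[symmetric] mult.assoc)

lemma signed_nth_leg:
  "signed_nth s (leg1 (L_mat s c) $ d $ e) p = scal (c powi p) * abs_UR (L1_coeff s p $ d $ e)"
  "signed_nth s (leg2 (L_mat s c) $ d $ e) p = scal (c powi p) * abs_UR (L2_coeff s p $ d $ e)"
proof -
  have z: "signed_nth s 0 p = (0 :: 'a UR)" by (cases s) auto
  show "signed_nth s (leg1 (L_mat s c) $ d $ e) p = scal (c powi p) * abs_UR (L1_coeff s p $ d $ e)"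
    "signed_nth s (leg2 (L_mat s c) $ d $ e) p = scal (c powi p) * abs_UR (L2_coeff s p $ d $ e)"
    by (auto simp: leg1_def leg2_def L1_coeff_def L2_coeff_def signed_nth_L_mat z abs_UR_hom)
qed

lemma triple_mult_nth:
  fixes X :: "'a::semiring_1 ^ 'i::finite ^ 'i"
  shows "(X ** Y ** Z) $ r $ c = (\<Sum>d\<in>UNIV. \<Sum>e\<in>UNIV. X $ r $ e * Y $ e $ d * Z $ d $ c)"
  by (simp add: matrix_matrix_mult_def sum_distrib_right)

text \<open>Replacing \<open>u\<close>, \<open>v\<close> by \<open>cu\<close>, \<open>dv\<close>
  multiplies every summand of the coefficient of \<open>u^a v^b\<close> by the same scalar, since
  the powers of \<open>c\<close> and \<open>d\<close> depending on \<open>k\<close> cancel against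
  those from \<open>R\<close>.\<close>

lemma scale_factor:
  fixes c d :: Cq
  assumes "c \<noteq> 0" "d \<noteq> 0"
  shows "(c / d) ^ k * c powi (a - int k) * d powi (b + int k) = c powi a * d powi b"
    "d powi (b + int k) * c powi (a - int k) * (c / d) ^ k = c powi a * d powi b"
proof -
  have "(c / d) ^ k * c powi (a - int k) * d powi (b + int k)
    = c ^ k / d ^ k * (c powi a / c ^ k) * (d powi b * d ^ k)"
    using assms by (simp add: power_int_diff power_int_add power_divide)
  then show "(c / d) ^ k * c powi (a - int k) * d powi (b + int k) = c powi a * d powi b"
    using assms by simp
  then show "d powi (b + int k) * c powi (a - int k) * (c / d) ^ k = c powi a * d powi b"
    by (simp only: mult_ac)
qed

text \<open>\<open>R(ux/v)\<close> stands on the left and \<open>R(uy/v)\<close> on the right of the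
  exchange relation: without shift for equal signs, with \<open>x = q\<^sup>c\<close> and
  \<open>y = q^(-c)\<close> in the mixed relation.\<close>

definition shift_pair :: "pm \<Rightarrow> pm \<Rightarrow> 'n::finite gen free_alg \<Rightarrow> 'n gen free_alg \<Rightarrow> bool" where
  "shift_pair s t x y \<longleftrightarrow> s = t \<and> x = 1 \<and> y = 1 \<or>
     s = Plus \<and> t = Minus \<and> x = (fgen QHalf)\<^sup>2 \<and> y = (fgen QHalfInv)\<^sup>2"

lemma shift_pair_commute:
  fixes z :: "'n::finite UR"
  assumes "shift_pair s t x y"
  shows "abs_UR x * z = z * abs_UR x" "abs_UR y * z = z * abs_UR y"
  using assms power_commute_central[of "q_half :: 'n UR", OF q_half_commute(1), of 2 z]
    power_commute_central[of "q_half_inv :: 'n UR", OF q_half_commute(2), of 2 z]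
  by (auto simp: shift_pair_def abs_UR_hom q_half_def q_half_inv_def)

lemma map_mat_leg:
  assumes "E 0 = 0"
  shows "leg1 (map_mat E A) = map_mat E (leg1 A)" "leg2 (map_mat E A) = map_mat E (leg2 A)"
  using assms by (auto simp: vec_eq_iff leg1_def leg2_def)

text \<open>Each coefficient in the new variables is a coefficient of some \<open>u^a v^b\<close>,
  hence a defining relation multiplied by the scalar from \<open>scale_factor\<close>.\<close>

lemma series_relation:
  fixes Er Es Et :: "'n::finite UR fps \<Rightarrow> 'n UR fps fps"
  assumes sub: "substitution s t Er Es Et" and xy: "shift_pair s t x y" and cd: "c \<noteq> 0" "d \<noteq> 0"
  shows "map_mat (\<lambda>f. Er (Phi (abs_UR x) (c / d) f)) R_series ** leg1 (map_mat Es (L_mat s c)) ** leg2 (map_mat Et (L_mat t d))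
    = leg2 (map_mat Et (L_mat t d)) ** leg1 (map_mat Es (L_mat s c)) ** map_mat (\<lambda>f. Er (Phi (abs_UR y) (c / d) f)) R_series"
    (is "?L = ?R")
proof -
  interpret substitution s t Er Es Et by (rule sub)
  note legs = map_mat_leg(1)[of Es, OF coeff_hom_simps(4)[OF hom(2)]] map_mat_leg(2)[of Et, OF coeff_hom_simps(4)[OF hom(3)]]
  have "fps_nth (fps_nth (?L $ r $ e) A) B = fps_nth (fps_nth (?R $ r $ e) A) B" for r e A B
  proof -
    obtain a b where ab: "\<And>F G H.
      fps_nth (fps_nth (Er F * Es G * Et H) A) B =
        (\<Sum>k\<le>nat (\<bar>a\<bar> + \<bar>b\<bar>). fps_nth F k * signed_nth s G (a - int k) * signed_nth t H (b + int k))"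
      "\<And>F G H. fps_nth (fps_nth (Et H * Es G * Er F) A) B =
        (\<Sum>k\<le>nat (\<bar>a\<bar> + \<bar>b\<bar>). signed_nth t H (b + int k) * signed_nth s G (a - int k) * fps_nth F k)"
      using triple[of A B] by blast
    let ?N = "nat (\<bar>a\<bar> + \<bar>b\<bar>)"
    let ?z = "scal (c powi a * d powi b) :: 'n UR"
    have "fps_nth (fps_nth (?L $ r $ e) A) B = ?z * (\<Sum>k\<le>?N.
        map_mat abs_UR (R_coeff x k) ** map_mat abs_UR (L1_coeff s (a - int k)) ** map_mat abs_UR (L2_coeff t (b + int k))) $ r $ e"
      unfolding legs triple_mult_nth sum_component map_mat_nth fps_sum_nth ab signed_nth_leg Phi_R_series_nth
        scal_triple scale_factor[OF cd] sum_distrib_left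
      by (subst (2) sum.swap, intro sum.cong refl, rule sum.swap)
    also have "\<dots> = ?z * (\<Sum>k\<le>?N.
        map_mat abs_UR (L2_coeff t (b + int k)) ** map_mat abs_UR (L1_coeff s (a - int k)) ** map_mat abs_UR (R_coeff y k)) $ r $ e"
      using relation_UR[OF xy[unfolded shift_pair_def]] by simp
    also have "\<dots> = fps_nth (fps_nth (?R $ r $ e) A) B"
      unfolding legs triple_mult_nth sum_component map_mat_nth fps_sum_nth ab signed_nth_leg Phi_R_series_nth
        scal_triple scale_factor[OF cd] sum_distrib_left
      by (subst sum.swap, intro sum.cong refl, rule sum.swap)
    finally show ?thesis .
  qed
  then show ?thesis by (simp add: vec_eq_iff fps_eq_iff)
qed

lemma legs_pairing:
  fixes M :: "'a::ring_1 ^ ('n::finite idx \<times> 'n idx) ^ ('n idx \<times> 'n idx)"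
  shows "(legs23 M ** pairing w) $ (i, j, k) $ l = M $ (j, k) $ (opp i, l) * w i"
    "(legs13 M ** pairing w) $ (i, j, k) $ l = M $ (i, k) $ (opp j, l) * w (opp j)"
proof -
  show "(legs23 M ** pairing w) $ (i, j, k) $ l = M $ (j, k) $ (opp i, l) * w i"
    unfolding legs23_row pairing_nth
    by (subst double_sum_UNIV_single[of _ "opp i" l]) (auto split: if_splits)
  show "(legs13 M ** pairing w) $ (i, j, k) $ l = M $ (i, k) $ (opp j, l) * w (opp j)"
    unfolding legs13_row pairing_nth
    by (subst double_sum_UNIV_single[of _ "opp j" l]) (auto split: if_splits simp: opp_eq_commute)
qed

text \<open>Any additive and multiplicative map may be applied to crossing unitarity, in particular
  the substitution of a central multiple of \<open>u/v\<close>. The scalar does not depend on that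
  multiple, because it is the image of a constant. In the flipped version the scaled matrix sits on
  legs 1 and 3.\<close>

lemma crossing_hom:
  fixes \<theta> :: "Cq fps \<Rightarrow> 'b::ring_1"
  assumes add: "\<And>f g. \<theta> (f + g) = \<theta> f + \<theta> g" and mult: "\<And>f g. \<theta> (f * g) = \<theta> f * \<theta> g"
  defines "w \<equiv> \<lambda>i :: 'n::finite idx. \<theta> (fps_const (wt i))"
  shows "legs13 (map_mat \<theta> R_series) ** (legs23 (map_mat (\<lambda>f. \<theta> (scaled (xi CARD('n)) f)) R_series) ** pairing w)
      = lscale (\<theta> (fps_const ((inverse qq)\<^sup>2 * (xi CARD('n))\<^sup>2))) (pairing w)" (is ?A)
    "legs23 (flip (map_mat \<theta> R_series)) ** (legs13 (flip (map_mat (\<lambda>f. \<theta> (scaled (xi CARD('n)) f)) R_series)) ** pairing w)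
      = lscale (\<theta> (fps_const ((inverse qq)\<^sup>2 * (xi CARD('n))\<^sup>2))) (pairing w)" (is ?B)
proof -
  let ?g = "fps_const ((inverse qq)\<^sup>2 * (xi CARD('n))\<^sup>2) :: Cq fps"
  have zero: "\<theta> 0 = 0" using add[of 0 0] by simp
  have sum: "\<theta> (sum h S) = (\<Sum>x\<in>S. \<theta> (h x))" for h :: "'c \<Rightarrow> Cq fps" and S
    by (induction S rule: infinite_finite_induct) (simp_all add: zero add)
  have prod: "(\<Sum>a\<in>UNIV. \<Sum>m\<in>UNIV. \<theta> (R_series $ (i, k) $ (a, m)) * \<theta> (Rt_series $ (a, m) $ (j, l)))
    = (if i = j \<and> k = l then \<theta> ?g else 0)" for i j k l :: "'n idx"
  proof -
    have "(\<Sum>a\<in>UNIV. \<Sum>m\<in>UNIV. \<theta> (R_series $ (i, k) $ (a, m)) * \<theta> (Rt_series $ (a, m) $ (j, l)))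
      = \<theta> ((R_series ** Rt_series) $ (i, k) $ (j, l))"
      by (simp add: matrix_matrix_mult_def sum_pair sum mult)
    then show ?thesis unfolding R_series_Rt by (simp add: mat_def zero)
  qed
  have "(legs13 (map_mat \<theta> R_series) ** (legs23 (map_mat (\<lambda>f. \<theta> (scaled (xi CARD('n)) f)) R_series) ** pairing w)) $ (i, j, k) $ l
    = lscale (\<theta> ?g) (pairing w) $ (i, j, k) $ l" for i j k l
  proof -
    have "(legs13 (map_mat \<theta> R_series) ** (legs23 (map_mat (\<lambda>f. \<theta> (scaled (xi CARD('n)) f)) R_series) ** pairing w)) $ (i, j, k) $ l
      = (\<Sum>a\<in>UNIV. \<Sum>m\<in>UNIV. \<theta> (R_series $ (i, k) $ (a, m)) * \<theta> (Rt_series $ (a, m) $ (opp j, l))) * w (opp j)"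
      unfolding legs13_row legs_pairing map_mat_nth w_def mult[symmetric] crossing_series
      by (simp only: sum_distrib_right mult mult.assoc)
    then show ?thesis unfolding prod by (auto simp: lscale_def pairing_nth opp_eq_commute)
  qed
  then show ?A by (simp add: vec_eq_iff split_paired_all)
  have "(legs23 (flip (map_mat \<theta> R_series)) ** (legs13 (flip (map_mat (\<lambda>f. \<theta> (scaled (xi CARD('n)) f)) R_series)) ** pairing w)) $ (i, j, k) $ l
    = lscale (\<theta> ?g) (pairing w) $ (i, j, k) $ l" for i j k l
  proof -
    have "(legs23 (flip (map_mat \<theta> R_series)) ** (legs13 (flip (map_mat (\<lambda>f. \<theta> (scaled (xi CARD('n)) f)) R_series)) ** pairing w)) $ (i, j, k) $ l
      = (\<Sum>b\<in>UNIV. \<Sum>m\<in>UNIV. \<theta> (R_series $ (k, j) $ (m, b)) * \<theta> (Rt_series $ (m, b) $ (l, opp i))) * w i"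
      unfolding legs23_row legs_pairing flip_nth map_mat_nth w_def mult[symmetric] crossing_series
      by (simp only: sum_distrib_right mult mult.assoc)
    also have "\<dots> = (if k = l \<and> j = opp i then \<theta> ?g else 0) * w i"
      by (subst sum.swap) (simp only: prod)
    finally show ?thesis by (auto simp: lscale_def pairing_nth)
  qed
  then show ?B by (simp add: vec_eq_iff split_paired_all)
qed

section \<open>Centrality\<close>

lemma scal_minus: "scal (- c) = - scal c"
  using scal_hom(1)[of "- c" c] by (simp add: eq_neg_iff_add_eq_0)

lemma fps_scal_commute: "fps_const (scal c) * F = F * fps_const (scal c)"
  by (rule const_central) (rule scal_commute)

lemma of_int_eps: "of_int (eps i * eps j) = fps_const (scal (of_int (eps i * eps j)))"
  by (auto simp: eps_def scal_minus)

text \<open>The entry \<open>(i, opp j)\<close> of the defining equation, multiplied by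
  \<open>wt (opp j)\<close>: the conjugation by D and the signs of the transposition combine into
  the coefficients of \<open>w\<close>.\<close>

lemma z_entries:
  fixes z :: "'n::finite UR fps"
  assumes "L_mat s 1 ** D_mat ** transp_t (L_mat s (xi CARD('n))) ** D_inv = mat z"
  shows "(\<Sum>a\<in>UNIV. L_mat s 1 $ i $ a * (L_mat s (xi CARD('n)) $ j $ opp a * fps_const (scal (wt a))))
    = (if j = opp i then z * fps_const (scal (wt i)) else 0)"
proof -
  let ?A = "L_mat s 1 :: 'n UR fps ^ 'n idx ^ 'n idx" and ?B = "L_mat s (xi CARD('n)) :: 'n UR fps ^ 'n idx ^ 'n idx"
  let ?K = "\<lambda>c. fps_const (scal c) :: 'n UR fps"
  have D: "(M ** D_mat) $ i $ a = M $ i $ a * ?K (qq powi bar a)"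
    "(M ** D_inv) $ i $ a = M $ i $ a * ?K (qq powi - bar a)" for M :: "'n UR fps ^ 'n idx ^ 'n idx" and i a
    by (simp_all add: matrix_matrix_mult_def D_mat_def D_inv_def if_distrib cong: if_cong)
  have "?A $ i $ a * (?B $ j $ opp a * ?K (wt a))
    = ?A $ i $ a * ?K (qq powi bar a) * (transp_t ?B $ a $ opp j) * ?K (qq powi - bar (opp j)) * ?K (wt (opp j))" for a
  proof -
    have weq: "wt a = qq powi bar a * of_int (eps j * eps (opp a)) * qq powi - bar (opp j) * wt (opp j)"
    proof -
      have s: "qq powi bar j * qq powi - bar j = 1" "of_int (eps j) * of_int (eps j) = (1 :: Cq)"
        by (auto simp: power_int_minus qq_nonzero eps_def)
      have "qq powi bar a * of_int (eps j * eps (opp a)) * qq powi - bar (opp j) * wt (opp j)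
        = qq powi bar a * of_int (eps a) * (qq powi bar j * qq powi - bar j) * (of_int (eps j) * of_int (eps j))"
        by (simp only: wt_def bar_opp eps_opp of_int_mult of_int_minus minus_minus mult_minus_left mult_minus_right mult_ac)
      then show ?thesis unfolding s by (simp add: wt_def)
    qed
    have K: "?K (wt a) = ?K (qq powi bar a) * ?K (of_int (eps j * eps (opp a))) * (?K (qq powi - bar (opp j)) * ?K (wt (opp j)))"
      unfolding fps_const_mult scal_hom(2)[symmetric]
      by (rule arg_cong[where f = ?K]) (simp only: weq[symmetric] mult.assoc[symmetric])
    have "?A $ i $ a * ?K (qq powi bar a) * (transp_t ?B $ a $ opp j) * ?K (qq powi - bar (opp j)) * ?K (wt (opp j))
      = ?A $ i $ a * ((?K (qq powi bar a) * ?K (of_int (eps j * eps (opp a)))) * ?B $ j $ opp a)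
         * (?K (qq powi - bar (opp j)) * ?K (wt (opp j)))"
      unfolding transp_t_def vec_lambda_beta opp_opp of_int_eps by (simp only: mult.assoc)
    also have "\<dots> = ?A $ i $ a * (?B $ j $ opp a * ?K (wt a))"
      unfolding K fps_const_mult scal_hom(2)[symmetric] fps_scal_commute[of _ "?B $ j $ opp a"]
      by (simp only: mult.assoc) (simp only: fps_const_mult scal_hom(2)[symmetric] mult.assoc)
    finally show ?thesis ..
  qed
  then have "(\<Sum>a\<in>UNIV. ?A $ i $ a * (?B $ j $ opp a * ?K (wt a)))
    = (?A ** D_mat ** transp_t ?B ** D_inv) $ i $ opp j * ?K (wt (opp j))"
    unfolding D matrix_matrix_mult_def[of "?A ** D_mat"] vec_lambda_beta sum_distrib_right by simp
  also have "\<dots> = (if j = opp i then z * ?K (wt i) else 0)"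
    unfolding assms by (auto simp: mat_def)
  finally show ?thesis .
qed

lemma z_pairing:
  fixes z :: "'n::finite UR fps"
  assumes E: "coeff_hom E" and z: "L_mat s 1 ** D_mat ** transp_t (L_mat s (xi CARD('n))) ** D_inv = mat z"
  shows "legs13 (leg1 (map_mat E (L_mat s 1))) ** (legs23 (leg1 (map_mat E (L_mat s (xi CARD('n)))))
      ** pairing (\<lambda>i. fps_const (fps_const (scal (wt i))))) = lscale (E z) (pairing (\<lambda>i. fps_const (fps_const (scal (wt i)))))"
    (is "?L = ?R")
proof -
  note E = coeff_hom_simps[OF E]
  have "?L $ (i, j, k) $ l = ?R $ (i, j, k) $ l" for i j k l
  proof -
    have "?L $ (i, j, k) $ l = (\<Sum>a\<in>UNIV. E (L_mat s 1 $ i $ a) *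
        (if k = l then E (L_mat s (xi CARD('n)) $ j $ opp a) * E (fps_const (scal (wt a))) else 0))"
      unfolding legs_leg1_row(1) legs_pairing leg_nth map_mat_nth E(3) by (intro sum.cong refl) auto
    also have "\<dots> = (if k = l then E (\<Sum>a\<in>UNIV. L_mat s 1 $ i $ a * (L_mat s (xi CARD('n)) $ j $ opp a * fps_const (scal (wt a)))) else 0)"
      by (simp add: E(2,5))
    also have "\<dots> = ?R $ (i, j, k) $ l"
      unfolding z_entries[OF z] by (auto simp: lscale_def pairing_nth E)
    finally show ?thesis .
  qed
  then show ?thesis by (simp add: vec_eq_iff split_paired_all)
qed

lemma flip_mult: "flip (A ** B) = flip A ** flip B"
proof -
  have "flip (A ** B) $ (i, j) $ (k, l) = (flip A ** flip B) $ (i, j) $ (k, l)" for i j k l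
    unfolding flip_nth matrix_matrix_mult_def vec_lambda_beta sum_pair by (rule sum.swap)
  then show ?thesis by (simp add: vec_eq_iff split_paired_all)
qed

lemma flip_leg: "flip (leg1 A) = leg2 A" "flip (leg2 A) = leg1 A"
  by (simp_all add: vec_eq_iff split_paired_all flip_nth leg_nth)

lemma wt_nonzero: "wt i \<noteq> 0"
  by (auto simp: wt_def qq_nonzero eps_def)

text \<open>In the first statement z is formed from the matrices in the first factor of the exchange
  relation, in the second from those in the second factor; the two use \<open>fusion_commute\<close>
  and \<open>fusion_commute'\<close>.\<close>

lemma
  fixes z :: "'n::finite UR fps" and Er Es Et :: "'n UR fps \<Rightarrow> 'n UR fps fps"
    and x y :: "'n gen free_alg"
  assumes sub: "substitution s t Er Es Et" and xy: "shift_pair s t x y"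
  shows z_commute_left: "L_mat s 1 ** D_mat ** transp_t (L_mat s (xi CARD('n))) ** D_inv = mat z \<Longrightarrow>
      fps_nth z m * ell t k l p = ell t k l p * fps_nth z m"
    and z_commute_right: "L_mat t 1 ** D_mat ** transp_t (L_mat t (xi CARD('n))) ** D_inv = mat z \<Longrightarrow>
      fps_nth z m * ell s k l p = ell s k l p * fps_nth z m"
proof -
  interpret substitution s t Er Es Et by (rule sub)
  let ?w = "\<lambda>i :: 'n idx. fps_const (fps_const (scal (wt i))) :: 'n UR fps fps"
  define c where "c = (inverse qq)\<^sup>2 * (xi CARD('n))\<^sup>2"
  let ?g = "fps_const (fps_const (scal c)) :: 'n UR fps fps"
  let ?u = "\<lambda>i :: 'n idx. fps_const (fps_const (scal (inverse (c * wt i)))) :: 'n UR fps fps"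
  let ?th = "\<lambda>x e f. Er (Phi (abs_UR x) e f)"
  have K: "fps_const (fps_const (scal a)) * X = X * fps_const (fps_const (scal a))" for a and X :: "'n UR fps fps"
    by (rule const_central) (rule fps_scal_commute)
  have c0: "c \<noteq> 0" by (simp add: c_def xi_eq qq_nonzero)
  have unit: "?g * ?w i * ?u i = 1" for i
  proof -
    have "c * wt i * inverse (c * wt i) = 1" by (rule right_inverse) (use c0 wt_nonzero[of i] in simp)
    then show ?thesis by (simp only: fps_const_mult scal_hom(2)[symmetric] scal_hom(3) fps_const_1_eq_1)
  qed
  have L: "fps_nth (L_mat s 1 $ k $ l) p = ell s k l p" for s k l p
    by (cases s) (simp_all add: L_mat_def)
  \<comment> \<open>Collected once for both arguments of a shift pair, the one on the left and the
    one on the right of the exchange relation.\<close>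
  have th: "?th x e (f + h) = ?th x e f + ?th x e h" "?th x e (f * h) = ?th x e f * ?th x e h"
    "?th x e (fps_const a) = fps_const (fps_const (scal a))"
    "?th x e f * X = X * ?th x e f"
    "?th x e (scaled a f) = ?th x (e * a) f"
    if "x = x0 \<or> x = y0" "shift_pair s t x0 y0" for x x0 y0 e f h a X
  proof -
    have cx: "abs_UR x * v = v * abs_UR x" for v using that shift_pair_commute[of s t x0 y0] by blast
    note P = Phi_hom[of "abs_UR x", OF cx] and E = coeff_hom_simps[OF hom(1)]
    show "?th x e (f + h) = ?th x e f + ?th x e h" "?th x e (f * h) = ?th x e f * ?th x e h"
      "?th x e (fps_const a) = fps_const (fps_const (scal a))"
      "?th x e (scaled a f) = ?th x (e * a) f"
      by (simp_all only: P E)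
    show "?th x e f * X = X * ?th x e f"
      by (rule central) (rule P)
  qed
  note thx = th[OF disjI1[OF refl] xy] and thy = th[OF disjI2[OF refl] xy]
  have xi0: "xi CARD('n) \<noteq> 0" by (rule xi_eq)
  show "fps_nth z m * ell t k l p = ell t k l p * fps_nth z m"
    if z: "L_mat s 1 ** D_mat ** transp_t (L_mat s (xi CARD('n))) ** D_inv = mat z"
  proof -
    have "Es z * map_mat Et (L_mat t 1) $ k $ l = map_mat Et (L_mat t 1) $ k $ l * Es z"
    proof (rule fusion_commute[where w = ?w and g = ?g and u = ?u and A = "map_mat Es (L_mat s 1)"
        and B = "map_mat Es (L_mat s (xi CARD('n)))"
        and Ra = "map_mat (?th x 1) R_series" and Rb = "map_mat (?th x (xi CARD('n))) R_series"
        and Ra' = "map_mat (?th y 1) R_series" and Rb' = "map_mat (?th y (xi CARD('n))) R_series"])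
      show "map_mat (?th x 1) R_series ** leg1 (map_mat Es (L_mat s 1)) ** leg2 (map_mat Et (L_mat t 1))
        = leg2 (map_mat Et (L_mat t 1)) ** leg1 (map_mat Es (L_mat s 1)) ** map_mat (?th y 1) R_series"
        using series_relation[OF sub xy, of 1 1] by simp
      show "map_mat (?th x (xi CARD('n))) R_series ** leg1 (map_mat Es (L_mat s (xi CARD('n)))) ** leg2 (map_mat Et (L_mat t 1))
        = leg2 (map_mat Et (L_mat t 1)) ** leg1 (map_mat Es (L_mat s (xi CARD('n)))) ** map_mat (?th y (xi CARD('n))) R_series"
        using series_relation[OF sub xy, of "xi CARD('n)" 1] xi0 by simp
      show "legs13 (map_mat (?th x 1) R_series) ** (legs23 (map_mat (?th x (xi CARD('n))) R_series) ** pairing ?w) = lscale ?g (pairing ?w)"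
        using crossing_hom(1)[of "?th x 1", OF thx(1,2), where ?'n = 'n] by (simp only: thx(3,5) mult_1_left c_def)
      show "legs13 (map_mat (?th y 1) R_series) ** (legs23 (map_mat (?th y (xi CARD('n))) R_series) ** pairing ?w) = lscale ?g (pairing ?w)"
        using crossing_hom(1)[of "?th y 1", OF thy(1,2), where ?'n = 'n] by (simp only: thy(3,5) mult_1_left c_def)
      show "legs13 (leg1 (map_mat Es (L_mat s 1))) ** (legs23 (leg1 (map_mat Es (L_mat s (xi CARD('n))))) ** pairing ?w) = lscale (Es z) (pairing ?w)"
        by (rule z_pairing[OF hom(2) z])
      show "?w i * X = X * ?w i" for i X by (rule K)
      show "?g * X = X * ?g" for X by (rule K)
      show "?g * ?w i * ?u i = 1" for i by (rule unit)
      show "map_mat (?th x 1) R_series $ r $ c * X = X * map_mat (?th x 1) R_series $ r $ c" for r c X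
        unfolding map_mat_nth by (rule thx(4))
      show "map_mat (?th x (xi CARD('n))) R_series $ r $ c * X = X * map_mat (?th x (xi CARD('n))) R_series $ r $ c" for r c X
        unfolding map_mat_nth by (rule thx(4))
      show "map_mat (?th y 1) R_series $ r $ c * X = X * map_mat (?th y 1) R_series $ r $ c" for r c X
        unfolding map_mat_nth by (rule thy(4))
      show "map_mat (?th y (xi CARD('n))) R_series $ r $ c * X = X * map_mat (?th y (xi CARD('n))) R_series $ r $ c" for r c X
        unfolding map_mat_nth by (rule thy(4))
    qed
    then have "Es z * Et (L_mat t 1 $ k $ l) = Et (L_mat t 1 $ k $ l) * Es z" by simp
    then show ?thesis using separated[of z "L_mat t 1 $ k $ l" m p] by (simp only: L)
  qed
  show "fps_nth z m * ell s k l p = ell s k l p * fps_nth z m"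
    if z: "L_mat t 1 ** D_mat ** transp_t (L_mat t (xi CARD('n))) ** D_inv = mat z"
  proof -
    \<comment> \<open>Scaling \<open>v\<close> by \<open>\<xi>\<close> divides the argument
      \<open>u/v\<close> by \<open>\<xi>\<close>. Crossing is therefore applied at
      \<open>x/\<xi>\<close>, whose rescaling by \<open>\<xi>\<close> is the unscaled argument of
      the other matrix.\<close>
    let ?i = "1 / xi CARD('n)"
    have "Et z * map_mat Es (L_mat s 1) $ k $ l = map_mat Es (L_mat s 1) $ k $ l * Et z"
    proof (rule fusion_commute'[where w = ?w and g = ?g and u = ?u and A = "map_mat Et (L_mat t 1)"
        and B = "map_mat Et (L_mat t (xi CARD('n)))"
        and Ra = "flip (map_mat (?th x 1) R_series)" and Rb = "flip (map_mat (?th x ?i) R_series)"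
        and Ra' = "flip (map_mat (?th y 1) R_series)" and Rb' = "flip (map_mat (?th y ?i) R_series)"])
      have f: "flip R ** leg2 C ** leg1 A = leg1 A ** leg2 C ** flip R'" if "R ** leg1 C ** leg2 A = leg2 A ** leg1 C ** R'"
        for A C :: "'n UR fps fps ^ 'n idx ^ 'n idx" and R R'
        using arg_cong[OF that, of flip] by (simp only: flip_mult flip_leg)
      show "flip (map_mat (?th x 1) R_series) ** leg2 (map_mat Es (L_mat s 1)) ** leg1 (map_mat Et (L_mat t 1))
        = leg1 (map_mat Et (L_mat t 1)) ** leg2 (map_mat Es (L_mat s 1)) ** flip (map_mat (?th y 1) R_series)"
        using series_relation[OF sub xy, of 1 1] by (intro f) simp
      show "flip (map_mat (?th x ?i) R_series) ** leg2 (map_mat Es (L_mat s 1)) ** leg1 (map_mat Et (L_mat t (xi CARD('n))))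
        = leg1 (map_mat Et (L_mat t (xi CARD('n)))) ** leg2 (map_mat Es (L_mat s 1)) ** flip (map_mat (?th y ?i) R_series)"
        using series_relation[OF sub xy, of 1 "xi CARD('n)"] xi0 by (intro f) simp
      have i: "?i * xi CARD('n) = 1" using xi0 by simp
      show "legs23 (flip (map_mat (?th x ?i) R_series)) ** (legs13 (flip (map_mat (?th x 1) R_series)) ** pairing ?w) = lscale ?g (pairing ?w)"
        using crossing_hom(2)[of "?th x ?i", OF thx(1,2), where ?'n = 'n] by (simp only: thx(3,5) i c_def)
      show "legs23 (flip (map_mat (?th y ?i) R_series)) ** (legs13 (flip (map_mat (?th y 1) R_series)) ** pairing ?w) = lscale ?g (pairing ?w)"
        using crossing_hom(2)[of "?th y ?i", OF thy(1,2), where ?'n = 'n] by (simp only: thy(3,5) i c_def)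
      show "legs13 (leg1 (map_mat Et (L_mat t 1))) ** (legs23 (leg1 (map_mat Et (L_mat t (xi CARD('n))))) ** pairing ?w) = lscale (Et z) (pairing ?w)"
        by (rule z_pairing[OF hom(3) z])
      show "?w i * X = X * ?w i" for i X by (rule K)
      show "?g * X = X * ?g" for X by (rule K)
      show "?g * ?w i * ?u i = 1" for i by (rule unit)
      show "flip (map_mat (?th x 1) R_series) $ r $ c * X = X * flip (map_mat (?th x 1) R_series) $ r $ c" for r c X
        unfolding flip_def vec_lambda_beta map_mat_nth by (rule thx(4))
      show "flip (map_mat (?th x ?i) R_series) $ r $ c * X = X * flip (map_mat (?th x ?i) R_series) $ r $ c" for r c X
        unfolding flip_def vec_lambda_beta map_mat_nth by (rule thx(4))
      show "flip (map_mat (?th y 1) R_series) $ r $ c * X = X * flip (map_mat (?th y 1) R_series) $ r $ c" for r c X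
        unfolding flip_def vec_lambda_beta map_mat_nth by (rule thy(4))
      show "flip (map_mat (?th y ?i) R_series) $ r $ c * X = X * flip (map_mat (?th y ?i) R_series) $ r $ c" for r c X
        unfolding flip_def vec_lambda_beta map_mat_nth by (rule thy(4))
    qed
    then have "Es (L_mat s 1 $ k $ l) * Et z = Et z * Es (L_mat s 1 $ k $ l)" by simp
    then show ?thesis using separated[of "L_mat s 1 $ k $ l" z p m] by (simp only: L)
  qed
qed

theorem proposition3p4:
  fixes z :: "pm \<Rightarrow> 'n::finite UR fps"
  assumes "\<And>s. L_mat s 1 ** D_mat ** transp_t (L_mat s (xi CARD('n))) ** D_inv = mat (z s)"
  shows "fps_nth (z s) m \<in> center"
proof (rule centerI)
  have same: "shift_pair s s 1 1" for s by (simp add: shift_pair_def)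
  have mixed: "shift_pair Plus Minus ((fgen QHalf)\<^sup>2) ((fgen QHalfInv)\<^sup>2 :: 'n gen free_alg)"
    by (simp add: shift_pair_def)
  have ell: "fps_nth (z s) m * ell t k l p = ell t k l p * fps_nth (z s) m" for t k l p
  proof (cases s; cases t)
    assume "s = Plus" "t = Plus"
    then show ?thesis using z_commute_left[OF substitution_plus_plus same assms] by simp
  next
    assume "s = Plus" "t = Minus"
    then show ?thesis using z_commute_left[OF substitution_plus_minus mixed assms] by simp
  next
    \<comment> \<open>The mixed relation has \<open>L\<^sup>+\<close> in its first factor, so
      \<open>z\<^sup>-\<close> has to be formed in the second.\<close>
    assume "s = Minus" "t = Plus"
    then show ?thesis using z_commute_right[OF substitution_plus_minus mixed assms] by simp
  next
    assume "s = Minus" "t = Minus"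
    then show ?thesis using z_commute_left[OF substitution_minus_minus same assms] by simp
  qed
  show "fps_nth (z s) m * abs_UR (fgen g) = abs_UR (fgen g) * fps_nth (z s) m" for g
  proof (cases g)
    case QHalf
    then show ?thesis using q_half_commute(1) by (metis q_half_def)
  next
    case QHalfInv
    then show ?thesis using q_half_commute(2) by (metis q_half_inv_def)
  next
    case (LGen t k l p)
    then show ?thesis using ell by (simp add: ell_eq)
  qed
qed

end
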